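(* Let $\phi^\theta$ be a rotation of $\mathbb{R}^2$ (of angle $\theta$), let $p\in(2,\infty)$ and $s>\frac{2}{p}$, and set $\delta:=\min\left(s-\frac{2}{p},\frac{1}{p}\right)>0$. Then for every $\alpha\in\left(0,\frac{\delta}{2+\delta}\right]$ there is a constant $C$ such that for every function $F\in\mathrm{BMO}(\mathbb{R}^2)\cap W^{s,p}(\mathbb{R}^2)$, $$\|F\circ\phi^\theta\|_{\mathrm{BMO}(\mathbb{R}^2)}\le C\,\|F\|_{\mathrm{BMO}(\mathbb{R}^2)}^{\alpha}\,\|F\|_{W^{s,p}(\mathbb{R}^2)}^{1-\alpha}.$$
   Context: $\mathrm{BMO}(\mathbb{R}^2)$ denotes the biparameter (Chang–Fefferman, product) BMO space, defined as follows. Let $\mathbb{D}=\mathbb{D}^0=\{2^k[j,j+1): j,k\in\mathbb{Z}\}$. For $\delta_0\in\mathbb{R}$ let $\mathbb{D}^{\delta_0}=\{\delta_I+I: I\in\mathbb{D}\}$, where $\delta_I=\delta_0$ if $|I|\le 1$, $\delta_I=\delta_0+\frac13(|I|-1)$ if $|I|=2^k$ with $k>0$ even, and $\delta_I=\delta_0+\frac13(2|I|-1)$ if $|I|=2^k$ with $k>0$ odd. For an interval $I=[a,b)$ the Haar wavelet is $h_I=|I|^{-1/2}\big(\mathbf{1}_{[a,\frac{a+b}{2})}-\mathbf{1}_{[\frac{a+b}{2},b)}\big)$. For $a,b\in\{0,\delta_0\}$ and $F\in L^2_{loc}(\mathbb{R}^2)$, $$\|F\|_{\mathrm{BMO}^{a,b}(\mathbb{R}^2)}=\sup_{\Omega}\Big(\frac{1}{|\Omega|}\sum_{\substack{I\in\mathbb{D}^a,\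 J\in\mathbb{D}^b\\ I\times J\subset\Omega}}|\langle F,h_I\otimes h_J\rangle|^2\Big)^{1/2},$$ the supremum being over all (nonempty) open sets $\Omega\subset\mathbb{R}^2$ of finite measure. A parameter $\delta_0\in(0,1/2)$ is fixed once and for all such that the product BMO space is the intersection of the four dyadic spaces: $\mathrm{BMO}(\mathbb{R}^2)=\bigcap_{a,b\in\{0,\delta_0\}}\mathrm{BMO}^{a,b}(\mathbb{R}^2)$, with $\|F\|_{\mathrm{BMO}(\mathbb{R}^2)}=\sup_{a,b\in\{0,\delta_0\}}\|F\|_{\mathrm{BMO}^{a,b}(\mathbb{R}^2)}$; this is taken as the definition. (It is a pseudo-norm.) $W^{s,p}(\mathbb{R}^2)$ is the usual $L^p$-based (possibly fractional) Sobolev space of order $s$, e.g. with norm $\|(1-\Delta)^{s/2}F\|_{L^p}$. The rotation $\phi^\theta$ is the linear map with matrix $\begin{bmatrix}\cos\theta&-\sin\theta\\ \sin\theta&\cos\theta\end{bmatrix}$. *)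

theory Defs
  imports "HOL-Analysis.Analysis"
begin

section \<open>Dyadic grids and Haar wavelets\<close>

text \<open>The translation \<open>\<delta>\<^sub>I\<close> applied to the dyadic intervals of length \<open>2\<^sup>k\<close>.\<close>

definition dyadic_shift :: "real \<Rightarrow> int \<Rightarrow> real" where
  "dyadic_shift \<delta>\<^sub>0 k =
     (if k \<le> 0 then \<delta>\<^sub>0
      else if even k then \<delta>\<^sub>0 + (2 powi k - 1) / 3
      else \<delta>\<^sub>0 + (2 * 2 powi k - 1) / 3)"

definition dyadic_interval :: "int \<Rightarrow> int \<Rightarrow> real set" where
  "dyadic_interval k j = {2 powi k * of_int j ..< 2 powi k * (of_int j + 1)}"

text \<open>The grid of parameter \<open>0\<close> is the standard one. It has to be a separate case, because
  \<open>dyadic_shift 0\<close> still moves the intervals of length greater than \<open>1\<close>.\<close>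

definition dyadic_grid :: "real \<Rightarrow> real set set" where
  "dyadic_grid a =
     (if a = 0 then {dyadic_interval k j | k j. True}
      else {(+) (dyadic_shift a k) ` dyadic_interval k j | k j. True})"

text \<open>Intended for bounded half-open intervals \<open>I = {a..<b}\<close>, whose endpoints are recovered
  as \<open>Inf I\<close> and \<open>Sup I\<close>.\<close>

definition haar :: "real set \<Rightarrow> real \<Rightarrow> real" where
  "haar I x =
     (let a = Inf I; b = Sup I; m = (a + b) / 2
      in (b - a) powr (-1/2) * (indicator {a..<m} x - indicator {m..<b} x))"

definition haar_coeff :: "(real \<times> real \<Rightarrow> complex) \<Rightarrow> real set \<Rightarrow> real set \<Rightarrow> complex" where
  "haar_coeff F I J = (LINT z|lebesgue. F z * of_real (haar I (fst z) * haar J (snd z)))"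


section \<open>Biparameter BMO\<close>

definition L2_loc :: "(real \<times> real \<Rightarrow> complex) set" where
  "L2_loc = {F. F \<in> borel_measurable lebesgue \<and>
     (\<forall>K. compact K \<longrightarrow> set_integrable lebesgue K (\<lambda>z. (cmod (F z))\<^sup>2))}"

definition esqrt :: "ennreal \<Rightarrow> ennreal" where
  "esqrt x = (if x = \<infinity> then \<infinity> else ennreal (sqrt (enn2real x)))"

definition dyadic_bmo_norm :: "real \<Rightarrow> real \<Rightarrow> (real \<times> real \<Rightarrow> complex) \<Rightarrow> ennreal" where
  "dyadic_bmo_norm a b F =
     (SUP \<Omega> \<in> {\<Omega>. open \<Omega> \<and> \<Omega> \<noteq> {} \<and> emeasure lborel \<Omega> < \<infinity>}.
        esqrt ((\<Sum>\<^sub>\<infinity>(I, J) \<in> {(I, J). I \<in> dyadic_grid a \<and> J \<in> dyadic_grid b \<and> I \<times> J \<subseteq> \<Omega>}.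
                  ennreal ((cmod (haar_coeff F I J))\<^sup>2))
               / emeasure lborel \<Omega>))"

definition bmo_norm :: "real \<Rightarrow> (real \<times> real \<Rightarrow> complex) \<Rightarrow> ennreal" where
  "bmo_norm \<delta>\<^sub>0 F = (SUP (a, b) \<in> {0, \<delta>\<^sub>0} \<times> {0, \<delta>\<^sub>0}. dyadic_bmo_norm a b F)"

definition bmo :: "real \<Rightarrow> (real \<times> real \<Rightarrow> complex) set" where
  "bmo \<delta>\<^sub>0 = {F \<in> L2_loc. \<forall>a\<in>{0, \<delta>\<^sub>0}. \<forall>b\<in>{0, \<delta>\<^sub>0}. dyadic_bmo_norm a b F < \<infinity>}"


section \<open>Sobolev spaces\<close>

definition Lp_space :: "real \<Rightarrow> (real \<times> real \<Rightarrow> complex) set" where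
  "Lp_space p = {f. f \<in> borel_measurable lebesgue \<and>
     integrable lebesgue (\<lambda>z. cmod (f z) powr p)}"

definition Lp_norm :: "real \<Rightarrow> (real \<times> real \<Rightarrow> complex) \<Rightarrow> real" where
  "Lp_norm p f = (LINT z|lebesgue. cmod (f z) powr p) powr (1 / p)"

text \<open>Here \<open>D m n\<close> is the partial derivative of order \<open>m\<close> in the first and \<open>n\<close> in the second
  variable.\<close>

definition schwartz :: "(real \<times> real \<Rightarrow> complex) set" where
  "schwartz = {\<phi>. \<exists>D :: nat \<Rightarrow> nat \<Rightarrow> real \<times> real \<Rightarrow> complex. D 0 0 = \<phi> \<and>
     (\<forall>m n z. (D m n has_derivative
        (\<lambda>h. of_real (fst h) * D (Suc m) n z + of_real (snd h) * D m (Suc n) z)) (at z)) \<and>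
     (\<forall>k m n. bounded (range (\<lambda>z. (1 + norm z) ^ k *\<^sub>R D m n z)))}"

definition fourier :: "(real \<times> real \<Rightarrow> complex) \<Rightarrow> real \<times> real \<Rightarrow> complex" where
  "fourier \<phi> \<xi> = (LINT z|lborel. cis (- (z \<bullet> \<xi>)) * \<phi> z)"

text \<open>The operator \<open>(1 - \<Delta>)\<^bsup>s/2\<^esup>\<close> on Schwartz functions, as a Fourier multiplier.\<close>

definition bessel_op :: "real \<Rightarrow> (real \<times> real \<Rightarrow> complex) \<Rightarrow> real \<times> real \<Rightarrow> complex" where
  "bessel_op s \<phi> z =
     (LINT \<xi>|lborel. cis (z \<bullet> \<xi>) * of_real ((1 + (norm \<xi>)\<^sup>2) powr (s / 2)) * fourier \<phi> \<xi>)
       / of_real ((2 * pi)\<^sup>2)"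

text \<open>\<open>f = (1 - \<Delta>)\<^bsup>s/2\<^esup> F\<close> in the sense of tempered distributions. The pairing is bilinear, and
  the symbol of \<open>bessel_op s\<close> is even, so the operator is its own transpose.\<close>

definition has_bessel_power ::
    "real \<Rightarrow> (real \<times> real \<Rightarrow> complex) \<Rightarrow> (real \<times> real \<Rightarrow> complex) \<Rightarrow> bool" where
  "has_bessel_power s F f \<longleftrightarrow>
     (\<forall>\<phi>\<in>schwartz. (LINT z|lebesgue. f z * \<phi> z) = (LINT z|lebesgue. F z * bessel_op s \<phi> z))"

text \<open>For \<open>s \<ge> 0\<close> and \<open>p \<ge> 1\<close> the space is contained in \<open>L\<^sup>p\<close>, so requiring
  \<open>F \<in> Lp_space p\<close> is no restriction. It makes all the pairings above absolutely convergent.\<close>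

definition sobolev :: "real \<Rightarrow> real \<Rightarrow> (real \<times> real \<Rightarrow> complex) set" where
  "sobolev s p = {F \<in> Lp_space p. \<exists>f\<in>Lp_space p. has_bessel_power s F f}"

text \<open>The function \<open>f\<close> is determined by \<open>F\<close> almost everywhere, so its choice does not affect
  the norm.\<close>

definition sobolev_norm :: "real \<Rightarrow> real \<Rightarrow> (real \<times> real \<Rightarrow> complex) \<Rightarrow> real" where
  "sobolev_norm s p F = Lp_norm p (SOME f. f \<in> Lp_space p \<and> has_bessel_power s F f)"


definition rotation :: "real \<Rightarrow> real \<times> real \<Rightarrow> real \<times> real" where
  "rotation \<theta> z = (cos \<theta> * fst z - sin \<theta> * snd z, sin \<theta> * fst z + cos \<theta> * snd z)"

end

theory Submission
  imports Defs "HOL-Probability.Characteristic_Functions"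
begin

text \<open>
  Bessel's inequality for the Haar system bounds every dyadic BMO norm by the essential supremum,
  which is invariant under rotations. So it suffices to bound \<open>\<parallel>F\<parallel>\<^sub>\<infinity>\<close> by
  \<open>C B\<^sup>\<alpha> S\<^sup>1\<^sup>-\<^sup>\<alpha>\<close>, where \<open>B\<close> is the BMO norm and \<open>S\<close> the Sobolev norm of \<open>F\<close>.

  The mixed second difference of the averages of \<open>F\<close> over a dyadic rectangle and its ancestors is
  a normalised Haar coefficient, hence at most \<open>2 B\<close>. Summing over \<open>3k\<close> generations in both
  variables, starting from a square of side \<open>2\<^sup>-\<^sup>k\<close>, bounds the average over that square by
  \<open>18 k\<^sup>2 B\<close> plus three averages over rectangles of area at least \<open>2\<^sup>k\<close>. Writing \<open>F\<close> as a
  Bessel potential of \<open>f\<close>, the latter are at most a constant times \<open>2\<^sup>-\<^sup>k\<^sup>/\<^sup>p S\<close>, and the oscillation of \<open>F\<close> at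
  scale \<open>2\<^sup>-\<^sup>k\<close> is at most a constant times \<open>2\<^sup>-\<^sup>\<gamma>\<^sup>k S\<close>. Finally \<open>k\<close> is optimised.

  The potential is reached through test functions. With \<open>\<mu>\<close> the Gamma distribution of shape \<open>s/2\<close>,
  the function \<open>\<integral> gauss (2(t + \<tau>)) d\<mu>(\<tau>)\<close> is a Schwartz function whose image under
  \<open>bessel_op s\<close> is the heat kernel at time \<open>t\<close>.
\<close>

section \<open>Gaussian mixtures are Schwartz functions\<close>

text \<open>A rotation does not preserve rectangles with sides parallel to the axes, so the dyadic
  structure of F cannot be transported; a size bound can. But biparameter coefficients annihilate
  functions of one variable, so the BMO norm alone cannot bound averages of F. Mixed differences
  determine the average over a small square only up to three corner terms, and for these the L^p
  decay on large rectangles is essential. The price is the factor k^2, a squared logarithm of S / B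
  once k is chosen, which is absorbed by lowering the power of B from 1 to \<alpha>. The Sobolev
  hypothesis is only a distributional identity, and the Bessel kernel is not smooth at the origin,
  so it is no test function. Heat smoothing for time t repairs this. All estimates are uniform in t
  and pass to the limit t -> 0 in averages, where no pointwise convergence is involved. Mixtures are
  convenient because every kernel bound reduces to one for a single Gaussian, integrated over the
  Gamma distribution.\<close>

primrec hermite :: "nat \<Rightarrow> real poly" where
  "hermite 0 = 1"
| "hermite (Suc n) = pderiv (hermite n) - pCons 0 (hermite n)"

text \<open>The n-th derivative of exp (- y^2 / 2); \<open>hermite n\<close> is the probabilists'
  Hermite polynomial up to the sign (-1)^n.\<close>

definition hermite_fun :: "nat \<Rightarrow> real \<Rightarrow> real" where
  "hermite_fun n y = poly (hermite n) y * exp (- y\<^sup>2 / 2)"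

lemma hermite_fun_deriv:
  "(hermite_fun n has_real_derivative hermite_fun (Suc n) y) (at y)"
  unfolding hermite_fun_def
  by (auto intro!: derivative_eq_intros poly_DERIV simp: algebra_simps power2_eq_square)

lemma poly_abs_bound:
  fixes q :: "real poly"
  shows "\<exists>K d. \<forall>y. \<bar>poly q y\<bar> \<le> K * (1 + \<bar>y\<bar>) ^ d"
proof (induction q)
  case 0
  show ?case by (rule exI[of _ 0]) auto
next
  case (pCons a q)
  then obtain K d where K: "\<And>y. \<bar>poly q y\<bar> \<le> K * (1 + \<bar>y\<bar>) ^ d" by blast
  have "\<bar>poly (pCons a q) y\<bar> \<le> (\<bar>a\<bar> + K) * (1 + \<bar>y\<bar>) ^ Suc d" for y
  proof -
    have "\<bar>poly (pCons a q) y\<bar> \<le> \<bar>a\<bar> + \<bar>y\<bar> * \<bar>poly q y\<bar>"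
      by (simp add: abs_mult[symmetric])
    also have "\<dots> \<le> \<bar>a\<bar> * (1 + \<bar>y\<bar>) ^ Suc d + (1 + \<bar>y\<bar>) * (K * (1 + \<bar>y\<bar>) ^ d)"
    proof (intro add_mono mult_mono K)
      have "\<bar>a\<bar> * 1 \<le> \<bar>a\<bar> * (1 + \<bar>y\<bar>) ^ Suc d"
        by (intro mult_left_mono one_le_power) auto
      then show "\<bar>a\<bar> \<le> \<bar>a\<bar> * (1 + \<bar>y\<bar>) ^ Suc d" by simp
    qed auto
    finally show ?thesis by (simp add: algebra_simps)
  qed
  then show ?case by blast
qed

lemma power_le_fact_exp:
  fixes x :: real assumes "x \<ge> 0" shows "x ^ n \<le> fact n * exp x"
proof -
  have "x ^ n / fact n \<le> (\<Sum>k. x ^ k /\<^sub>R fact k)"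
    using sum_le_suminf[OF summable_exp_generic[of x], of "{n}"] assms
    by (simp add: divide_inverse mult.commute)
  then show ?thesis by (simp add: exp_def field_simps)
qed

text \<open>One term of the exponential series bounds a power of 1 + |y| by an exponential, and the
  Gaussian beats that exponential.\<close>

lemma hermite_fun_bound:
  "\<exists>K. \<forall>y. (1 + \<bar>y\<bar>) ^ k * \<bar>hermite_fun n y\<bar> \<le> K"
proof -
  obtain K d where K: "\<And>y. \<bar>poly (hermite n) y\<bar> \<le> K * (1 + \<bar>y\<bar>) ^ d"
    using poly_abs_bound by blast
  have K0: "K \<ge> 0" using K[of 0] by simp
  have "(1 + \<bar>y\<bar>) ^ k * \<bar>hermite_fun n y\<bar> \<le> K * (fact (k + d) * exp (3/2))" for y
  proof -
    have "(1 + \<bar>y\<bar>) ^ k * \<bar>hermite_fun n y\<bar>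
        = (1 + \<bar>y\<bar>) ^ k * (\<bar>poly (hermite n) y\<bar> * exp (- y\<^sup>2 / 2))"
      by (simp add: hermite_fun_def abs_mult)
    also have "\<dots> \<le> (1 + \<bar>y\<bar>) ^ k * (K * (1 + \<bar>y\<bar>) ^ d * exp (- y\<^sup>2 / 2))"
      by (intro mult_left_mono mult_right_mono K) auto
    also have "\<dots> = K * ((1 + \<bar>y\<bar>) ^ (k + d) * exp (- y\<^sup>2 / 2))"
      by (simp add: power_add)
    also have "\<dots> \<le> K * ((fact (k + d) * exp (1 + \<bar>y\<bar>)) * exp (- y\<^sup>2 / 2))"
      using K0 by (intro mult_left_mono mult_right_mono power_le_fact_exp) auto
    also have "\<dots> = K * (fact (k + d) * exp (1 + \<bar>y\<bar> - y\<^sup>2 / 2))"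
      by (simp add: mult.assoc flip: exp_add)
    also have "\<dots> \<le> K * (fact (k + d) * exp (3/2))"
    proof -
      \<comment> \<open>The maximum of 1 + |y| - y^2 / 2 is 3/2, attained at |y| = 1.\<close>
      have "0 \<le> (\<bar>y\<bar> - 1)\<^sup>2" by simp
      then have "1 + \<bar>y\<bar> - y\<^sup>2 / 2 \<le> 3/2" by (simp add: power2_eq_square algebra_simps)
      then show ?thesis using K0 by (intro mult_left_mono) auto
    qed
    finally show ?thesis .
  qed
  then show ?thesis by blast
qed

text \<open>The \<open>n\<close>-th derivative of \<open>exp (- x\<^sup>2 / (2 \<sigma>\<^sup>2)) / \<sigma>\<close>.\<close>

definition gauss_deriv :: "nat \<Rightarrow> real \<Rightarrow> real \<Rightarrow> real" where
  "gauss_deriv n \<sigma> x = hermite_fun n (x / \<sigma>) / \<sigma> ^ Suc n"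

lemma gauss_deriv_deriv:
  assumes "\<sigma> \<noteq> 0"
  shows "(gauss_deriv n \<sigma> has_real_derivative gauss_deriv (Suc n) \<sigma> x) (at x)"
  unfolding gauss_deriv_def
  using assms
  by (auto intro!: derivative_eq_intros DERIV_chain2[OF hermite_fun_deriv] simp: field_simps)

lemma hermite_fun_measurable [measurable]: "hermite_fun n \<in> borel_measurable borel"
  unfolding hermite_fun_def by (intro borel_measurable_continuous_onI continuous_intros) simp

lemma gauss_deriv_measurable [measurable]:
  "(\<lambda>(\<sigma>, x). gauss_deriv n \<sigma> x) \<in> borel_measurable (borel \<Otimes>\<^sub>M borel)"
  unfolding gauss_deriv_def by measurable

text \<open>Uniformity in \<sigma> is the point, since \<sigma> will be random. Away from \<sigma> =
  0 the powers of 1 / \<sigma> are harmless, and the weight in x costs a power of 1 + \<sigma>,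
  which a distribution with finite moments can integrate.\<close>

lemma gauss_deriv_bound:
  assumes "\<sigma>\<^sub>0 > 0"
  shows "\<exists>K\<ge>0. \<forall>\<sigma>\<ge>\<sigma>\<^sub>0. \<forall>x. (1 + \<bar>x\<bar>) ^ k * \<bar>gauss_deriv n \<sigma> x\<bar> \<le> K * (1 + \<sigma>) ^ k"
proof -
  obtain K where K: "\<And>y. (1 + \<bar>y\<bar>) ^ k * \<bar>hermite_fun n y\<bar> \<le> K"
    using hermite_fun_bound by blast
  have K0: "K \<ge> 0" using order_trans[OF _ K[of 0]] by simp
  have "(1 + \<bar>x\<bar>) ^ k * \<bar>gauss_deriv n \<sigma> x\<bar> \<le> K / \<sigma>\<^sub>0 ^ Suc n * (1 + \<sigma>) ^ k" if "\<sigma> \<ge> \<sigma>\<^sub>0" for \<sigma> x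
  proof -
    have s: "\<sigma> > 0" using that assms by simp
    define y where "y = x / \<sigma>"
    have "1 + \<bar>x\<bar> \<le> (1 + \<sigma>) * (1 + \<bar>y\<bar>)"
      using s by (simp add: y_def field_simps)
    then have "(1 + \<bar>x\<bar>) ^ k * \<bar>gauss_deriv n \<sigma> x\<bar>
        \<le> ((1 + \<sigma>) * (1 + \<bar>y\<bar>)) ^ k * \<bar>gauss_deriv n \<sigma> x\<bar>"
      by (intro mult_right_mono power_mono) auto
    also have "\<dots> = (1 + \<sigma>) ^ k * ((1 + \<bar>y\<bar>) ^ k * \<bar>hermite_fun n y\<bar>) / \<sigma> ^ Suc n"
      using s by (simp add: gauss_deriv_def y_def power_mult_distrib abs_mult abs_divide)
    also have "\<dots> \<le> (1 + \<sigma>) ^ k * K / \<sigma>\<^sub>0 ^ Suc n"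
      using s that assms K0 by (intro frac_le mult_left_mono K power_mono mult_nonneg_nonneg) auto
    finally show ?thesis by (simp add: field_simps)
  qed
  moreover have "K / \<sigma>\<^sub>0 ^ Suc n \<ge> 0" using K0 assms by simp
  ultimately show ?thesis by blast
qed

lemma taylor_bound_2:
  fixes a :: "real \<Rightarrow> real"
  assumes d1: "\<And>x. (a has_real_derivative a' x) (at x)"
    and d2: "\<And>x. (a' has_real_derivative a'' x) (at x)"
    and b: "\<And>x. \<bar>a'' x\<bar> \<le> K"
  shows "\<bar>a (x + h) - a x - a' x * h\<bar> \<le> K * h\<^sup>2"
proof -
  have lip: "\<bar>a' y - a' x\<bar> \<le> K * \<bar>y - x\<bar>" for y
    using field_differentiable_bound[of UNIV a' a'' K y x] d2 b by auto
  have K0: "K \<ge> 0" using b[of 0] by linarith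
  have "norm ((a (x + h) - a' x * (x + h)) - (a x - a' x * x)) \<le> (K * \<bar>h\<bar>) * norm (x + h - x)"
  proof (rule field_differentiable_bound[of "closed_segment x (x + h)" _ "\<lambda>y. a' y - a' x"])
    fix y assume y: "y \<in> closed_segment x (x + h)"
    show "((\<lambda>y. a y - a' x * y) has_field_derivative a' y - a' x) (at y within closed_segment x (x + h))"
      by (auto intro!: derivative_eq_intros has_field_derivative_at_within[OF d1])
    have "\<bar>y - x\<bar> \<le> \<bar>h\<bar>" using segment_bound1[OF y] by simp
    then show "norm (a' y - a' x) \<le> K * \<bar>h\<bar>"
      using lip[of y] K0 mult_left_mono[of "\<bar>y - x\<bar>" "\<bar>h\<bar>" K] by simp
  qed auto
  then show ?thesis by (simp add: algebra_simps power2_eq_square)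
qed

text \<open>Differentiation under an integral goes through this criterion: a quadratic remainder
  bound that is uniform in a parameter can simply be integrated over it.\<close>

lemma has_derivative_quadratic_remainder:
  fixes f :: "'a::real_normed_vector \<Rightarrow> 'b::real_normed_vector"
  assumes "bounded_linear L" and K: "\<And>h. norm (f (z + h) - f z - L h) \<le> K * (norm h)\<^sup>2"
  shows "(f has_derivative L) (at z)"
proof (rule has_derivativeI_sandwich[of 1])
  show "norm (f y - f z - L (y - z)) / norm (y - z) \<le> K * norm (y - z)"
    if "y \<noteq> z" for y
    using K[of "y - z"] that by (simp add: field_simps power2_eq_square)
  show "(\<lambda>y. K * norm (y - z)) \<midarrow>z\<rightarrow> 0"
    by (auto intro!: tendsto_eq_intros)
qed (use assms in auto)

text \<open>\<open>gauss_deriv\<close> carries no normalising constant. With the factor 1 / (2 pi)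
  the case m = n = 0 is the centred normal density in the plane with variance
  \<open>\<sigma>\<^sup>2\<close> in each coordinate.\<close>

definition gauss2_deriv :: "nat \<Rightarrow> nat \<Rightarrow> real \<Rightarrow> real \<times> real \<Rightarrow> real" where
  "gauss2_deriv m n \<sigma> z = gauss_deriv m \<sigma> (fst z) * gauss_deriv n \<sigma> (snd z) / (2 * pi)"

lemma gauss2_deriv_measurable [measurable]:
  "(\<lambda>(\<sigma>, z). gauss2_deriv m n \<sigma> z) \<in> borel_measurable (borel \<Otimes>\<^sub>M borel)"
proof -
  have "(\<lambda>w. gauss_deriv m (fst w) (fst (snd w)) * gauss_deriv n (fst w) (snd (snd w)) / (2 * pi))
      \<in> borel_measurable (borel \<Otimes>\<^sub>M (borel \<Otimes>\<^sub>M borel))"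
    using measurable_compose[OF _ gauss_deriv_measurable] by measurable
  then show ?thesis
    by (simp add: gauss2_deriv_def case_prod_beta borel_prod)
qed

lemma gauss2_deriv_bound:
  assumes "\<sigma>\<^sub>0 > 0"
  shows "\<exists>K\<ge>0. \<forall>\<sigma>\<ge>\<sigma>\<^sub>0. \<forall>z. (1 + norm z) ^ k * \<bar>gauss2_deriv m n \<sigma> z\<bar> \<le> K * (1 + \<sigma>) ^ (k + k)"
proof -
  obtain K where K0: "K \<ge> 0" and
    K: "\<And>\<sigma> x. \<sigma> \<ge> \<sigma>\<^sub>0 \<Longrightarrow> (1 + \<bar>x\<bar>) ^ k * \<bar>gauss_deriv m \<sigma> x\<bar> \<le> K * (1 + \<sigma>) ^ k"
    using gauss_deriv_bound[OF assms, of k m] by blast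
  obtain L where L0: "L \<ge> 0" and
    L: "\<And>\<sigma> x. \<sigma> \<ge> \<sigma>\<^sub>0 \<Longrightarrow> (1 + \<bar>x\<bar>) ^ k * \<bar>gauss_deriv n \<sigma> x\<bar> \<le> L * (1 + \<sigma>) ^ k"
    using gauss_deriv_bound[OF assms, of k n] by blast
  have "(1 + norm z) ^ k * \<bar>gauss2_deriv m n \<sigma> z\<bar> \<le> (K * L / (2 * pi)) * (1 + \<sigma>) ^ (k + k)"
    if "\<sigma> \<ge> \<sigma>\<^sub>0" for \<sigma> and z :: "real \<times> real"
  proof -
    have "norm z \<le> \<bar>fst z\<bar> + \<bar>snd z\<bar>"
      using norm_Pair_le[of "fst z" "snd z"] by simp
    also have "1 + (\<bar>fst z\<bar> + \<bar>snd z\<bar>) \<le> (1 + \<bar>fst z\<bar>) * (1 + \<bar>snd z\<bar>)"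
      by (simp add: algebra_simps)
    finally have "1 + norm z \<le> (1 + \<bar>fst z\<bar>) * (1 + \<bar>snd z\<bar>)" by simp
    then have "(1 + norm z) ^ k * \<bar>gauss2_deriv m n \<sigma> z\<bar>
       \<le> ((1 + \<bar>fst z\<bar>) * (1 + \<bar>snd z\<bar>)) ^ k * \<bar>gauss2_deriv m n \<sigma> z\<bar>"
      by (intro mult_right_mono power_mono) auto
    also have "\<dots> = ((1 + \<bar>fst z\<bar>) ^ k * \<bar>gauss_deriv m \<sigma> (fst z)\<bar>)
        * ((1 + \<bar>snd z\<bar>) ^ k * \<bar>gauss_deriv n \<sigma> (snd z)\<bar>) / (2 * pi)"
      by (simp add: gauss2_deriv_def power_mult_distrib abs_mult)
    also have "\<dots> \<le> (K * (1 + \<sigma>) ^ k) * (L * (1 + \<sigma>) ^ k) / (2 * pi)"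
      using that assms K0
      by (intro divide_right_mono mult_mono K L mult_nonneg_nonneg) auto
    finally show ?thesis by (simp add: power_add field_simps)
  qed
  moreover have "K * L / (2 * pi) \<ge> 0" using K0 L0 by simp
  ultimately show ?thesis by blast
qed

lemma gauss2_deriv_taylor:
  assumes "\<sigma>\<^sub>0 > 0"
  shows "\<exists>K\<ge>0. \<forall>\<sigma>\<ge>\<sigma>\<^sub>0. \<forall>z h. \<bar>gauss2_deriv m n \<sigma> (z + h) - gauss2_deriv m n \<sigma> z
      - (fst h * gauss2_deriv (Suc m) n \<sigma> z + snd h * gauss2_deriv m (Suc n) \<sigma> z)\<bar> \<le> K * (norm h)\<^sup>2"
proof -
  have "\<exists>K\<ge>0. \<forall>\<sigma>\<ge>\<sigma>\<^sub>0. \<forall>x. \<bar>gauss_deriv n \<sigma> x\<bar> \<le> K" for n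
    using gauss_deriv_bound[OF assms, of 0 n] by simp
  then obtain K where K0: "\<And>n. K n \<ge> 0" and K: "\<And>n \<sigma> x. \<sigma> \<ge> \<sigma>\<^sub>0 \<Longrightarrow> \<bar>gauss_deriv n \<sigma> x\<bar> \<le> K n"
    by metis
  define C where "C = K (Suc (Suc m)) * K n + K (Suc m) * K (Suc n) + K m * K (Suc (Suc n))"
  have C0: "C \<ge> 0" using K0 by (simp add: C_def)
  have "\<bar>gauss2_deriv m n \<sigma> (z + h) - gauss2_deriv m n \<sigma> z
      - (fst h * gauss2_deriv (Suc m) n \<sigma> z + snd h * gauss2_deriv m (Suc n) \<sigma> z)\<bar> \<le> C * (norm h)\<^sup>2"
    if s: "\<sigma> \<ge> \<sigma>\<^sub>0" for \<sigma> z h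
  proof -
    have s0: "\<sigma> \<noteq> 0" using s assms by simp
    obtain x y where z: "z = (x, y)" by force
    obtain u v where h: "h = (u, v)" by force
    let ?a = "gauss_deriv m \<sigma>" and ?a1 = "gauss_deriv (Suc m) \<sigma>"
    let ?b = "gauss_deriv n \<sigma>" and ?b1 = "gauss_deriv (Suc n) \<sigma>"
    have Ra: "\<bar>?a (x + u) - ?a x - ?a1 x * u\<bar> \<le> K (Suc (Suc m)) * u\<^sup>2"
      by (rule taylor_bound_2[OF gauss_deriv_deriv[OF s0] gauss_deriv_deriv[OF s0] K[OF s]])
    have Rb: "\<bar>?b (y + v) - ?b y - ?b1 y * v\<bar> \<le> K (Suc (Suc n)) * v\<^sup>2"
      by (rule taylor_bound_2[OF gauss_deriv_deriv[OF s0] gauss_deriv_deriv[OF s0] K[OF s]])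
    have Lb: "\<bar>?b (y + v) - ?b y\<bar> \<le> K (Suc n) * \<bar>v\<bar>"
      using field_differentiable_bound[of UNIV ?b ?b1 "K (Suc n)" "y + v" y]
        gauss_deriv_deriv[OF s0] K[OF s] by auto
    have nu: "\<bar>u\<bar> \<le> norm h" and nv: "\<bar>v\<bar> \<le> norm h"
      using norm_fst_le[of u v] norm_snd_le[of v u] by (simp_all add: h)
    have u2: "u\<^sup>2 \<le> (norm h)\<^sup>2" and v2: "v\<^sup>2 \<le> (norm h)\<^sup>2" and uv: "\<bar>u\<bar> * \<bar>v\<bar> \<le> (norm h)\<^sup>2"
      using nu nv power_mono[OF nu, of 2] power_mono[OF nv, of 2]
        mult_mono[OF nu nv] by (auto simp: power2_eq_square)
    \<comment> \<open>The product is expanded so that every term is visibly quadratic in h: two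
      Taylor remainders and one product of two first-order increments.\<close>
    have "\<bar>?a (x + u) * ?b (y + v) - ?a x * ?b y - (u * (?a1 x * ?b y) + v * (?a x * ?b1 y))\<bar>
      = \<bar>(?a (x + u) - ?a x - ?a1 x * u) * ?b (y + v) + (?a1 x * u) * (?b (y + v) - ?b y)
          + ?a x * (?b (y + v) - ?b y - ?b1 y * v)\<bar>"
      by (simp add: algebra_simps)
    also have "\<dots> \<le> \<bar>?a (x + u) - ?a x - ?a1 x * u\<bar> * \<bar>?b (y + v)\<bar>
        + \<bar>?a1 x\<bar> * \<bar>u\<bar> * \<bar>?b (y + v) - ?b y\<bar> + \<bar>?a x\<bar> * \<bar>?b (y + v) - ?b y - ?b1 y * v\<bar>"
      by (simp only: abs_mult[symmetric])
    also have "\<dots> \<le> (K (Suc (Suc m)) * u\<^sup>2) * K n + K (Suc m) * \<bar>u\<bar> * (K (Suc n) * \<bar>v\<bar>)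
        + K m * (K (Suc (Suc n)) * v\<^sup>2)"
      using K0 by (intro add_mono mult_mono Ra Rb Lb K s mult_nonneg_nonneg order_refl) auto
    also have "\<dots> = (K (Suc (Suc m)) * K n) * u\<^sup>2 + (K (Suc m) * K (Suc n)) * (\<bar>u\<bar> * \<bar>v\<bar>)
        + (K m * K (Suc (Suc n))) * v\<^sup>2" by (simp add: algebra_simps)
    also have "\<dots> \<le> (K (Suc (Suc m)) * K n) * (norm h)\<^sup>2 + (K (Suc m) * K (Suc n)) * (norm h)\<^sup>2
        + (K m * K (Suc (Suc n))) * (norm h)\<^sup>2"
      using K0 by (intro add_mono mult_left_mono u2 v2 uv mult_nonneg_nonneg) auto
    also have "\<dots> = C * (norm h)\<^sup>2" by (simp add: C_def algebra_simps)
    finally have *: "\<bar>?a (x + u) * ?b (y + v) - ?a x * ?b y - (u * (?a1 x * ?b y) + v * (?a x * ?b1 y))\<bar>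
       \<le> C * (norm h)\<^sup>2" (is "\<bar>?E\<bar> \<le> _") .
    have "\<bar>gauss2_deriv m n \<sigma> (z + h) - gauss2_deriv m n \<sigma> z
      - (fst h * gauss2_deriv (Suc m) n \<sigma> z + snd h * gauss2_deriv m (Suc n) \<sigma> z)\<bar> = \<bar>?E / (2 * pi)\<bar>"
      by (rule arg_cong[where f = abs])
         (simp add: gauss2_deriv_def z h diff_divide_distrib add_divide_distrib)
    also have "\<dots> \<le> \<bar>?E\<bar> / 1"
      unfolding abs_divide using pi_ge_two by (intro frac_le) auto
    finally show ?thesis using * by simp
  qed
  then show ?thesis using C0 by blast
qed

text \<open>The derivatives of the mixture are the mixtures of the derivatives. Remainder and decay
  bounds hold uniformly for \<sigma> above \<open>\<sigma>\<^sub>0\<close>, up to powers of 1 +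
  \<sigma> that \<open>mom\<close> integrates.\<close>

proposition gauss_mixture_schwartz:
  fixes M :: "'a measure" and c :: "real \<times> real"
  assumes "prob_space M" and [measurable]: "\<sigma> \<in> borel_measurable M"
    and "\<sigma>\<^sub>0 > 0" and low: "AE \<tau> in M. \<sigma>\<^sub>0 \<le> \<sigma> \<tau>"
    and mom: "\<And>k. integrable M (\<lambda>\<tau>. (1 + \<sigma> \<tau>) ^ k)"
  shows "(\<lambda>z. complex_of_real (LINT \<tau>|M. gauss2_deriv 0 0 (\<sigma> \<tau>) (z - c))) \<in> schwartz"
proof -
  interpret prob_space M by fact
  define D where "D m n z = (LINT \<tau>|M. gauss2_deriv m n (\<sigma> \<tau>) (z - c))" for m n z
  have meas [measurable]: "(\<lambda>\<tau>. gauss2_deriv m n (\<sigma> \<tau>) z) \<in> borel_measurable M" for m n z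
    using measurable_compose[of "\<lambda>\<tau>. (\<sigma> \<tau>, z)" M _ _ _, OF _ gauss2_deriv_measurable[of m n]]
    by simp
  have int: "integrable M (\<lambda>\<tau>. gauss2_deriv m n (\<sigma> \<tau>) z)" for m n z
  proof -
    obtain K where K: "\<And>\<sigma> z. \<sigma> \<ge> \<sigma>\<^sub>0 \<Longrightarrow> \<bar>gauss2_deriv m n \<sigma> z\<bar> \<le> K"
      using gauss2_deriv_bound[OF \<open>\<sigma>\<^sub>0 > 0\<close>, of 0 m n] by (auto simp del: split_paired_All)
    have "AE \<tau> in M. norm (gauss2_deriv m n (\<sigma> \<tau>) z) \<le> K"
      using low by eventually_elim (simp add: K)
    then show ?thesis
      by (rule integrable_const_bound) measurable
  qed
  have "((\<lambda>z. complex_of_real (D m n z)) has_derivative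
      (\<lambda>h. of_real (fst h) * of_real (D (Suc m) n z) + of_real (snd h) * of_real (D m (Suc n) z))) (at z)"
    for m n z
  proof -
    obtain K where K0: "K \<ge> 0" and K: "\<And>\<sigma> z h. \<sigma> \<ge> \<sigma>\<^sub>0 \<Longrightarrow>
      \<bar>gauss2_deriv m n \<sigma> (z + h) - gauss2_deriv m n \<sigma> z
        - (fst h * gauss2_deriv (Suc m) n \<sigma> z + snd h * gauss2_deriv m (Suc n) \<sigma> z)\<bar> \<le> K * (norm h)\<^sup>2"
      using gauss2_deriv_taylor[OF \<open>\<sigma>\<^sub>0 > 0\<close>, of m n] by blast
    have "(D m n has_derivative (\<lambda>h. fst h * D (Suc m) n z + snd h * D m (Suc n) z)) (at z)"
    proof (rule has_derivative_quadratic_remainder)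
      show "bounded_linear (\<lambda>h. fst h * D (Suc m) n z + snd h * D m (Suc n) z)"
        by (intro bounded_linear_add bounded_linear_mult_const bounded_linear_fst bounded_linear_snd)
      fix h
      let ?E = "\<lambda>\<tau>. gauss2_deriv m n (\<sigma> \<tau>) (z + h - c) - gauss2_deriv m n (\<sigma> \<tau>) (z - c)
        - (fst h * gauss2_deriv (Suc m) n (\<sigma> \<tau>) (z - c) + snd h * gauss2_deriv m (Suc n) (\<sigma> \<tau>) (z - c))"
      have "norm (D m n (z + h) - D m n z - (fst h * D (Suc m) n z + snd h * D m (Suc n) z))
          = norm (LINT \<tau>|M. ?E \<tau>)"
        unfolding D_def by (simp add: int)
      also have "\<dots> \<le> (LINT \<tau>|M. norm (?E \<tau>))"
        by (rule integral_norm_bound)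
      also have "\<dots> \<le> (LINT \<tau>|M. K * (norm h)\<^sup>2)"
      proof (rule integral_mono_AE)
        show "AE \<tau> in M. norm (?E \<tau>) \<le> K * (norm h)\<^sup>2"
          using low
        proof eventually_elim
          case (elim \<tau>)
          have eq: "z - c + h = z + h - c" by simp
          show ?case using K[OF elim, of "z - c" h] unfolding real_norm_def eq .
        qed
      qed (intro integrable_norm Bochner_Integration.integrable_diff
          Bochner_Integration.integrable_add integrable_mult_right int | simp)+
      also have "\<dots> = K * (norm h)\<^sup>2" using prob_space by simp
      finally show "norm (D m n (z + h) - D m n z - (fst h * D (Suc m) n z + snd h * D m (Suc n) z))
          \<le> K * (norm h)\<^sup>2" .
    qed
    then show ?thesis
      by (auto dest!: has_derivative_of_real[where 'a = complex])
  qed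
  moreover have "bounded (range (\<lambda>z. (1 + norm z) ^ k *\<^sub>R complex_of_real (D m n z)))" for k m n
  proof -
    obtain K where K0: "K \<ge> 0" and K: "\<And>\<sigma> z. \<sigma> \<ge> \<sigma>\<^sub>0 \<Longrightarrow>
        (1 + norm z) ^ k * \<bar>gauss2_deriv m n \<sigma> z\<bar> \<le> K * (1 + \<sigma>) ^ (k + k)"
      using gauss2_deriv_bound[OF \<open>\<sigma>\<^sub>0 > 0\<close>, of k m n] by blast
    have "norm ((1 + norm z) ^ k *\<^sub>R complex_of_real (D m n z))
        \<le> (1 + norm c) ^ k * (K * (LINT \<tau>|M. (1 + \<sigma> \<tau>) ^ (k + k)))" for z
    proof -
      \<comment> \<open>Decay is known in z - c; recentring the weight at the origin costs the
        factor (1 + norm c)^k.\<close>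
      have "norm z \<le> norm (z - c) + norm c" by (metis add.commute norm_triangle_sub)
      then have "1 + norm z \<le> (1 + norm c) * (1 + norm (z - c))"
        using mult_nonneg_nonneg[OF norm_ge_zero[of c] norm_ge_zero[of "z - c"]]
        unfolding ring_distribs by linarith
      then have 1: "(1 + norm z) ^ k \<le> (1 + norm c) ^ k * (1 + norm (z - c)) ^ k"
        by (metis norm_ge_zero power_mono power_mult_distrib add_nonneg_nonneg zero_le_one)
      have 2: "AE \<tau> in M. (1 + norm (z - c)) ^ k * \<bar>gauss2_deriv m n (\<sigma> \<tau>) (z - c)\<bar>
          \<le> K * (1 + \<sigma> \<tau>) ^ (k + k)"
        using low by eventually_elim (rule K)
      have "norm ((1 + norm z) ^ k *\<^sub>R complex_of_real (D m n z)) = (1 + norm z) ^ k * \<bar>D m n z\<bar>"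
        by simp
      also have "\<dots> \<le> ((1 + norm c) ^ k * (1 + norm (z - c)) ^ k) * (LINT \<tau>|M. \<bar>gauss2_deriv m n (\<sigma> \<tau>) (z - c)\<bar>)"
        unfolding D_def by (intro mult_mono 1 integral_abs_bound) auto
      also have "\<dots> = (1 + norm c) ^ k * (LINT \<tau>|M. (1 + norm (z - c)) ^ k * \<bar>gauss2_deriv m n (\<sigma> \<tau>) (z - c)\<bar>)"
        by simp
      also have "\<dots> \<le> (1 + norm c) ^ k * (LINT \<tau>|M. K * (1 + \<sigma> \<tau>) ^ (k + k))"
        by (intro mult_left_mono integral_mono_AE integrable_mult_right integrable_abs int mom 2) auto
      finally show ?thesis by simp
    qed
    then show ?thesis by (auto simp: bounded_iff)
  qed
  ultimately show ?thesis
    unfolding schwartz_def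
    by (intro CollectI exI[of _ "\<lambda>m n z. complex_of_real (D m n z)"]) (auto simp: D_def)
qed

section \<open>The Gaussian mixture representing the Bessel kernel\<close>

text \<open>V is the variance of each coordinate, so the heat kernel at time t is
  \<open>gauss (2 * t)\<close>, with Fourier transform exp (- t |\<xi>|^2).\<close>

definition gauss :: "real \<Rightarrow> real \<times> real \<Rightarrow> real" where
  "gauss V z = exp (- (norm z)\<^sup>2 / (2 * V)) / (2 * pi * V)"

lemma norm_prod_sq: "(norm z)\<^sup>2 = (fst z)\<^sup>2 + (snd z)\<^sup>2" for z :: "real \<times> real"
  by (simp add: norm_prod_def)

lemma gauss_eq_gauss2_deriv:
  assumes "V > 0" shows "gauss V z = gauss2_deriv 0 0 (sqrt V) z"
  using assms
  by (simp add: gauss_def gauss2_deriv_def gauss_deriv_def hermite_fun_def norm_prod_sq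
      power_divide add_divide_distrib exp_add[symmetric] field_simps)

lemma gauss_measurable [measurable]: "(\<lambda>(V, z). gauss V z) \<in> borel_measurable (borel \<Otimes>\<^sub>M borel)"
  unfolding gauss_def by measurable

lemma gauss_measurable_snd [measurable]: "gauss V \<in> borel_measurable borel"
  unfolding gauss_def by measurable

lemma gauss_nonneg: "V > 0 \<Longrightarrow> gauss V z \<ge> 0"
  by (simp add: gauss_def)

lemma gauss_le: "V > 0 \<Longrightarrow> gauss V z \<le> 1 / (2 * pi * V)"
  by (simp add: gauss_def divide_right_mono)

section \<open>Fourier transform of Gaussians\<close>

lemma cis_measurable [measurable]: "cis \<in> borel_measurable borel"
  by (intro borel_measurable_continuous_onI continuous_intros)

lemma integral_product:
  fixes f g :: "real \<Rightarrow> complex"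
  assumes f: "integrable lborel f" and g: "integrable lborel g"
  shows integrable_product: "integrable lborel (\<lambda>z :: real \<times> real. f (fst z) * g (snd z))"
    and integral_product_eq: "(LINT z|lborel. f (fst z) * g (snd z)) = (LINT x|lborel. f x) * (LINT y|lborel. g y)"
proof -
  have [measurable]: "f \<in> borel_measurable borel" "g \<in> borel_measurable borel"
    using f g by auto
  have "integrable (lborel \<Otimes>\<^sub>M lborel) (\<lambda>z. f (fst z) * g (snd z))"
    by (rule lborel_pair.Fubini_integrable)
       (use f g in \<open>auto simp: norm_mult\<close>)
  then show "integrable lborel (\<lambda>z :: real \<times> real. f (fst z) * g (snd z))"
    by (simp add: lborel_prod)
  from lborel_pair.integral_fst'[OF \<open>integrable (lborel \<Otimes>\<^sub>M lborel) _\<close>]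
  show "(LINT z|lborel. f (fst z) * g (snd z)) = (LINT x|lborel. f x) * (LINT y|lborel. g y)"
    by (simp add: lborel_prod)
qed

text \<open>Scaling by \<open>sqrt V\<close> reduces both claims to the characteristic function of
  the standard normal distribution.\<close>

lemma gaussian_fourier_1d:
  fixes \<xi> V :: real assumes "V > 0"
  shows "integrable lborel (\<lambda>x. cis (- (x * \<xi>)) * complex_of_real (exp (- x\<^sup>2 / (2 * V)) / sqrt (2 * pi * V)))"
    and "(LINT x|lborel. cis (- (x * \<xi>)) * complex_of_real (exp (- x\<^sup>2 / (2 * V)) / sqrt (2 * pi * V)))
      = complex_of_real (exp (- V * \<xi>\<^sup>2 / 2))"
proof -
  define f where "f x = cis (- (x * \<xi>)) * complex_of_real (exp (- x\<^sup>2 / (2 * V)) / sqrt (2 * pi * V))" for x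
  have f: "complex_of_real (sqrt V) * f (0 + sqrt V * x)
      = std_normal_density x *\<^sub>R cis ((- (sqrt V * \<xi>)) * x)" for x
    using assms by (simp add: f_def std_normal_density_def real_sqrt_mult scaleR_conv_of_real field_simps)
  have "integrable lborel (\<lambda>x. std_normal_density x *\<^sub>R cis ((- (sqrt V * \<xi>)) * x))"
    by (rule Bochner_Integration.integrable_bound[OF integrable_normal_density[of 1 0]]) auto
  then have "integrable lborel (\<lambda>x. complex_of_real (sqrt V) * f (0 + sqrt V * x))"
    by (simp only: f)
  then have "integrable lborel (\<lambda>x. f (0 + sqrt V * x))"
    using assms integrable_mult_right[of "complex_of_real (1 / sqrt V)" lborel] by fastforce
  then show "integrable lborel (\<lambda>x. cis (- (x * \<xi>)) * complex_of_real (exp (- x\<^sup>2 / (2 * V)) / sqrt (2 * pi * V)))"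
    using assms lborel_integrable_real_affine_iff[of "sqrt V" f 0] unfolding f_def[abs_def] by fastforce
  have "(LINT x|lborel. f x) = \<bar>sqrt V\<bar> *\<^sub>R (LINT x|lborel. f (0 + sqrt V * x))"
    by (rule lborel_integral_real_affine) (use assms in simp)
  also have "\<dots> = (LINT x|lborel. complex_of_real (sqrt V) * f (0 + sqrt V * x))"
    using assms by (simp add: scaleR_conv_of_real)
  also have "\<dots> = (LINT x|lborel. std_normal_density x *\<^sub>R cis ((- (sqrt V * \<xi>)) * x))"
    by (simp only: f)
  also have "\<dots> = char std_normal_distribution (- (sqrt V * \<xi>))"
    unfolding char_def
    by (subst integral_density) (auto simp: cis_conv_exp mult_ac)
  also have "\<dots> = complex_of_real (exp (- V * \<xi>\<^sup>2 / 2))"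
    using assms by (simp add: char_std_normal_distribution power_mult_distrib)
  finally show "(LINT x|lborel. cis (- (x * \<xi>)) * complex_of_real (exp (- x\<^sup>2 / (2 * V)) / sqrt (2 * pi * V)))
      = complex_of_real (exp (- V * \<xi>\<^sup>2 / 2))"
    by (simp add: f_def)
qed

lemma gauss_fourier:
  fixes \<xi> :: "real \<times> real" assumes "V > 0"
  shows integrable_cis_gauss: "integrable lborel (\<lambda>z. cis (- (z \<bullet> \<xi>)) * complex_of_real (gauss V z))"
    and integral_cis_gauss: "(LINT z|lborel. cis (- (z \<bullet> \<xi>)) * complex_of_real (gauss V z))
      = complex_of_real (exp (- V * (norm \<xi>)\<^sup>2 / 2))"
proof -
  let ?f = "\<lambda>\<xi> x. cis (- (x * \<xi>)) * complex_of_real (exp (- x\<^sup>2 / (2 * V)) / sqrt (2 * pi * V))"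
  have *: "cis (- (z \<bullet> \<xi>)) * complex_of_real (gauss V z) = ?f (fst \<xi>) (fst z) * ?f (snd \<xi>) (snd z)" for z
  proof -
    have "z \<bullet> \<xi> = fst z * fst \<xi> + snd z * snd \<xi>" by (simp add: inner_prod_def)
    then have "cis (- (z \<bullet> \<xi>)) = cis (- (fst z * fst \<xi>)) * cis (- (snd z * snd \<xi>))"
      by (simp add: cis_mult)
    moreover have "gauss V z = (exp (- (fst z)\<^sup>2 / (2 * V)) / sqrt (2 * pi * V)) * (exp (- (snd z)\<^sup>2 / (2 * V)) / sqrt (2 * pi * V))"
      using assms by (simp add: gauss_def norm_prod_sq add_divide_distrib diff_divide_distrib exp_add[symmetric])
    ultimately show ?thesis by (simp only: of_real_mult mult_ac)
  qed
  show "integrable lborel (\<lambda>z. cis (- (z \<bullet> \<xi>)) * complex_of_real (gauss V z))"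
    unfolding * by (rule integrable_product[OF gaussian_fourier_1d(1) gaussian_fourier_1d(1)]; fact)
  show "(LINT z|lborel. cis (- (z \<bullet> \<xi>)) * complex_of_real (gauss V z))
      = complex_of_real (exp (- V * (norm \<xi>)\<^sup>2 / 2))"
    unfolding * integral_product_eq[OF gaussian_fourier_1d(1)[OF assms] gaussian_fourier_1d(1)[OF assms]]
      gaussian_fourier_1d(2)[OF assms]
    by (simp add: norm_prod_sq exp_add[symmetric] ring_distribs add_divide_distrib diff_divide_distrib
        flip: exp_of_real of_real_mult)
qed

lemma integrable_gauss: "V > 0 \<Longrightarrow> integrable lborel (gauss V)"
  and integral_gauss: "V > 0 \<Longrightarrow> (LINT z|lborel. gauss V z) = 1"
  using integrable_Re[OF integrable_cis_gauss[of V 0]] integral_cis_gauss[of V 0] by simp_all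

lemma nn_integral_gauss: "V > 0 \<Longrightarrow> (\<integral>\<^sup>+z. gauss V z \<partial>lborel) = 1"
  using nn_integral_eq_integral[OF integrable_gauss] integral_gauss gauss_nonneg by simp

text \<open>The Gamma distribution with unit rate, chosen for its Laplace transform (1 + r)^(- s /
  2): at r = |\<xi>|^2 the superposition of the heat multipliers exp (- \<tau> |\<xi>|^2) is the
  Bessel multiplier.\<close>

definition bessel_measure :: "real \<Rightarrow> real measure" where
  "bessel_measure s = density lborel (\<lambda>\<tau>.
     ennreal (indicator {0<..} \<tau> * \<tau> powr (s / 2 - 1) * exp (- \<tau>) / Gamma (s / 2)))"

lemma space_bessel_measure [simp]: "space (bessel_measure s) = UNIV"
  and sets_bessel_measure [simp, measurable_cong]: "sets (bessel_measure s) = sets borel"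
  by (simp_all add: bessel_measure_def)

lemma nn_integral_bessel_measure:
  assumes "f \<in> borel_measurable borel"
  shows "(\<integral>\<^sup>+\<tau>. f \<tau> \<partial>bessel_measure s) =
    (\<integral>\<^sup>+\<tau>. ennreal (indicator {0<..} \<tau> * \<tau> powr (s / 2 - 1) * exp (- \<tau>) / Gamma (s / 2)) * f \<tau> \<partial>lborel)"
  unfolding bessel_measure_def using assms by (subst nn_integral_density) auto

lemma bessel_measure_pos: "AE \<tau> in bessel_measure s. \<tau> > 0"
  unfolding bessel_measure_def by (subst AE_density) (auto simp: indicator_def)

lemma gamma_nn_integral_scaled:
  assumes "a > 0" "r > 0"
  shows "(\<integral>\<^sup>+\<tau>. ennreal (indicator {0<..} \<tau> * \<tau> powr (a - 1) * exp (- (r * \<tau>))) \<partial>lborel)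
    = ennreal (Gamma a * r powr (- a))"
proof -
  let ?g = "\<lambda>t. ennreal (indicator {0..} t * t powr (a - 1) / exp t)"
  have "ennreal (Gamma a) = (\<integral>\<^sup>+t. ?g t \<partial>lborel)"
    by (rule Gamma_conv_nn_integral_real) fact
  also have "\<dots> = \<bar>r\<bar> * (\<integral>\<^sup>+t. ?g (0 + r * t) \<partial>lborel)"
    by (rule nn_integral_real_affine) (use assms in auto)
  also have "(\<integral>\<^sup>+t. ?g (0 + r * t) \<partial>lborel)
      = (\<integral>\<^sup>+\<tau>. ennreal (r powr (a - 1)) * ennreal (indicator {0<..} \<tau> * \<tau> powr (a - 1) * exp (- (r * \<tau>))) \<partial>lborel)"
    using assms
    by (intro nn_integral_cong)
       (auto simp: indicator_def powr_mult exp_minus field_simps zero_le_mult_iff mult_less_0_iff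
          simp flip: ennreal_mult)
  also have "\<dots> = ennreal (r powr (a - 1)) *
      (\<integral>\<^sup>+\<tau>. ennreal (indicator {0<..} \<tau> * \<tau> powr (a - 1) * exp (- (r * \<tau>))) \<partial>lborel)"
    by (rule nn_integral_cmult) measurable
  finally have *: "ennreal (Gamma a) = ennreal (r powr a) *
      (\<integral>\<^sup>+\<tau>. ennreal (indicator {0<..} \<tau> * \<tau> powr (a - 1) * exp (- (r * \<tau>))) \<partial>lborel)"
    using assms by (simp add: mult.assoc[symmetric] ennreal_mult[symmetric] powr_mult_base)
  have "ennreal (Gamma a * r powr (- a)) = ennreal (r powr (- a)) * ennreal (Gamma a)"
    using assms by (simp add: ennreal_mult' mult.commute)
  also have "\<dots> = ennreal (r powr (- a)) * ennreal (r powr a) * 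
      (\<integral>\<^sup>+\<tau>. ennreal (indicator {0<..} \<tau> * \<tau> powr (a - 1) * exp (- (r * \<tau>))) \<partial>lborel)"
    unfolding * by (simp only: mult.assoc)
  also have "ennreal (r powr (- a)) * ennreal (r powr a) = 1"
    using assms by (simp add: ennreal_mult[symmetric] powr_add[symmetric])
  finally show ?thesis by simp
qed

text \<open>One formula for three uses: q = r = 0 gives the total mass, r = 0 the moments, q = 0 the
  Laplace transform. Its condition on negative q is where s > 2 / p will be felt.\<close>

lemma bessel_measure_powr_exp:
  assumes "s > 0" "s / 2 + q > 0" "r \<ge> 0"
  shows "(\<integral>\<^sup>+\<tau>. ennreal (\<tau> powr q * exp (- (r * \<tau>))) \<partial>bessel_measure s)
    = ennreal (Gamma (s / 2 + q) * (1 + r) powr (- (s / 2 + q)) / Gamma (s / 2))"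
proof -
  have G: "Gamma (s / 2) > 0" using assms by (simp add: Gamma_real_pos)
  have "(\<integral>\<^sup>+\<tau>. ennreal (\<tau> powr q * exp (- (r * \<tau>))) \<partial>bessel_measure s)
     = (\<integral>\<^sup>+\<tau>. ennreal (1 / Gamma (s / 2)) *
         ennreal (indicator {0<..} \<tau> * \<tau> powr (s / 2 + q - 1) * exp (- ((1 + r) * \<tau>))) \<partial>lborel)"
  proof (subst nn_integral_bessel_measure, measurable, intro nn_integral_cong)
    fix \<tau> :: real
    have "\<tau> powr (s / 2 + q - 1) = \<tau> powr (s / 2 - 1) * \<tau> powr q"
      by (simp add: powr_add[symmetric] algebra_simps)
    moreover have "exp (- ((1 + r) * \<tau>)) = exp (- \<tau>) * exp (- (r * \<tau>))"
      by (simp add: exp_add[symmetric] algebra_simps)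
    ultimately show "ennreal (indicator {0<..} \<tau> * \<tau> powr (s / 2 - 1) * exp (- \<tau>) / Gamma (s / 2))
          * ennreal (\<tau> powr q * exp (- (r * \<tau>)))
        = ennreal (1 / Gamma (s / 2)) *
         ennreal (indicator {0<..} \<tau> * \<tau> powr (s / 2 + q - 1) * exp (- ((1 + r) * \<tau>)))"
      using G by (simp add: ennreal_mult[symmetric])
  qed
  also have "\<dots> = ennreal (1 / Gamma (s / 2)) * ennreal (Gamma (s / 2 + q) * (1 + r) powr (- (s / 2 + q)))"
    by (subst nn_integral_cmult, measurable, subst gamma_nn_integral_scaled) (use assms in auto)
  finally show ?thesis using G assms by (simp flip: ennreal_mult')
qed

lemma prob_space_bessel_measure: "s > 0 \<Longrightarrow> prob_space (bessel_measure s)"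
proof (rule prob_spaceI)
  assume "s > 0"
  then have G: "Gamma (s / 2) \<noteq> 0" using Gamma_real_pos[of "s / 2"] by linarith
  have "emeasure (bessel_measure s) (space (bessel_measure s)) = (\<integral>\<^sup>+\<tau>. 1 \<partial>bessel_measure s)"
    by simp
  also have "\<dots> = (\<integral>\<^sup>+\<tau>. ennreal (\<tau> powr 0 * exp (- (0 * \<tau>))) \<partial>bessel_measure s)"
    \<comment> \<open>Since \<open>0 powr 0 = 0\<close>, the integrands agree only for nonzero
      \<tau>, hence almost everywhere.\<close>
    using bessel_measure_pos[of s] by (intro nn_integral_cong_AE) (auto elim!: eventually_mono)
  also have "\<dots> = 1"
    using G \<open>s > 0\<close> by (subst bessel_measure_powr_exp) auto
  finally show "emeasure (bessel_measure s) (space (bessel_measure s)) = 1" .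
qed

lemma integrable_bessel_powr:
  assumes "s > 0" "s / 2 + q > 0"
  shows "integrable (bessel_measure s) (\<lambda>\<tau>. \<tau> powr q)"
  using bessel_measure_powr_exp[OF assms, of 0]
  by (intro integrableI_nonneg) auto

lemma bessel_measure_laplace:
  assumes "s > 0" "r \<ge> 0"
  shows "(LINT \<tau>|bessel_measure s. exp (- (r * \<tau>))) = (1 + r) powr (- s / 2)"
proof -
  have G: "Gamma (s / 2) \<noteq> 0" using assms Gamma_real_pos[of "s / 2"] by linarith
  have "(\<integral>\<^sup>+\<tau>. ennreal (exp (- (r * \<tau>))) \<partial>bessel_measure s)
     = (\<integral>\<^sup>+\<tau>. ennreal (\<tau> powr 0 * exp (- (r * \<tau>))) \<partial>bessel_measure s)"
    using bessel_measure_pos[of s] by (intro nn_integral_cong_AE) (auto elim!: eventually_mono)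
  also have "\<dots> = ennreal ((1 + r) powr (- s / 2))"
    using assms G by (subst bessel_measure_powr_exp) auto
  finally show ?thesis by (subst integral_eq_nn_integral) auto
qed

section \<open>The Bessel kernel smoothed by the heat flow\<close>

lemma lborel_integral_translate:
  fixes f :: "'a::euclidean_space \<Rightarrow> 'b::{banach, second_countable_topology}"
  assumes "f \<in> borel_measurable borel"
  shows "(LINT z|lborel. f (c + z)) = (LINT z|lborel. f z)"
  using integral_distr[of "(+) c" lborel borel f] assms lborel_distr_plus[of c] by simp

text \<open>For t = 0 this would be the Bessel kernel of order s. The shift by t keeps all variances
  above 2 t, which makes the mixture smooth.\<close>

definition bessel_heat :: "real \<Rightarrow> real \<Rightarrow> real \<times> real \<Rightarrow> real" where
  "bessel_heat s t z = (LINT \<tau>|bessel_measure s. gauss (2 * (t + \<tau>)) z)"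

lemma sigma_finite_bessel_measure: "s > 0 \<Longrightarrow> sigma_finite_measure (bessel_measure s)"
  using prob_space_bessel_measure[of s]
  by (simp add: finite_measure.sigma_finite_measure prob_space.finite_measure)

lemma bessel_heat_measurable [measurable]:
  assumes "s > 0" shows "bessel_heat s t \<in> borel_measurable borel"
proof -
  interpret sigma_finite_measure "bessel_measure s" by (rule sigma_finite_bessel_measure) fact
  show ?thesis unfolding bessel_heat_def by measurable
qed

lemma bessel_heat_schwartz:
  assumes "s > 0" "t > 0"
  shows "(\<lambda>z. complex_of_real (bessel_heat s t (z - c))) \<in> schwartz"
proof -
  let ?\<sigma> = "\<lambda>\<tau>. sqrt (2 * (t + \<tau>))"
  interpret prob_space "bessel_measure s" by (rule prob_space_bessel_measure) fact
  have "(\<lambda>z. complex_of_real (LINT \<tau>|bessel_measure s. gauss2_deriv 0 0 (?\<sigma> \<tau>) (z - c))) \<in> schwartz"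
  proof (rule gauss_mixture_schwartz[where \<sigma>\<^sub>0 = "sqrt (2 * t)"])
    show "AE \<tau> in bessel_measure s. sqrt (2 * t) \<le> ?\<sigma> \<tau>"
      using bessel_measure_pos by eventually_elim (use assms in auto)
    show "integrable (bessel_measure s) (\<lambda>\<tau>. (1 + ?\<sigma> \<tau>) ^ k)" for k
    proof (rule Bochner_Integration.integrable_bound)
      have "integrable (bessel_measure s) (\<lambda>\<tau>. 2 ^ k * ((2 + 2 * t) ^ k + 2 ^ k * \<tau> powr k))"
        using assms by (intro integrable_mult_right Bochner_Integration.integrable_add integrable_bessel_powr) auto
      then show "integrable (bessel_measure s) (\<lambda>\<tau>. 2 ^ k * ((2 + 2 * t) ^ k + 2 ^ k * \<tau> powr k))" .
      show "AE \<tau> in bessel_measure s. norm ((1 + ?\<sigma> \<tau>) ^ k) \<le> norm (2 ^ k * ((2 + 2 * t) ^ k + 2 ^ k * \<tau> powr k))"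
        using bessel_measure_pos
      proof eventually_elim
        case (elim \<tau>)
        \<comment> \<open>The inequality sqrt x <= 1 + x dominates moments of the square root by
          moments of \<tau>; bounding a sum by twice the maximum then separates \<tau> from the
          constants.\<close>
        have "?\<sigma> \<tau> \<le> 1 + 2 * (t + \<tau>)"
          using assms elim by (intro real_le_lsqrt) (auto simp: power2_eq_square algebra_simps)
        moreover have "2 + 2 * (t + \<tau>) \<le> 2 * max (2 + 2 * t) (2 * \<tau>)"
          by (simp add: max_def)
        ultimately have "1 + ?\<sigma> \<tau> \<le> 2 * max (2 + 2 * t) (2 * \<tau>)" by linarith
        then have "(1 + ?\<sigma> \<tau>) ^ k \<le> (2 * max (2 + 2 * t) (2 * \<tau>)) ^ k"
          using assms elim by (intro power_mono) auto
        also have "\<dots> \<le> 2 ^ k * ((2 + 2 * t) ^ k + 2 ^ k * \<tau> powr k)"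
          using assms elim by (auto simp: power_mult_distrib powr_realpow max_def)
        finally show ?case using assms elim by simp
      qed
    qed measurable
  qed (use assms prob_space_axioms in auto)
  moreover have "(LINT \<tau>|bessel_measure s. gauss2_deriv 0 0 (?\<sigma> \<tau>) z) = bessel_heat s t z" for z
    unfolding bessel_heat_def
  proof (rule integral_cong_AE)
    show "(\<lambda>\<tau>. gauss2_deriv 0 0 (?\<sigma> \<tau>) z) \<in> borel_measurable (bessel_measure s)"
      using measurable_compose[of "\<lambda>\<tau>. (?\<sigma> \<tau>, z)" "bessel_measure s" _ _ _, OF _ gauss2_deriv_measurable[of 0 0]]
      by simp
    show "AE \<tau> in bessel_measure s. gauss2_deriv 0 0 (?\<sigma> \<tau>) z = gauss (2 * (t + \<tau>)) z"
      using bessel_measure_pos by eventually_elim (use assms in \<open>simp add: gauss_eq_gauss2_deriv\<close>)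
  qed measurable
  ultimately show ?thesis by simp
qed

text \<open>Fubini applies because every Gaussian of the mixture has mass one. Each transform splits
  into exp (- t |\<xi>|^2) and the Laplace kernel in \<tau> at |\<xi>|^2; the phase comes from the
  translation by c.\<close>

lemma fourier_bessel_heat:
  assumes "s > 0" "t > 0"
  shows "fourier (\<lambda>z. complex_of_real (bessel_heat s t (z - c))) \<xi>
    = cis (- (c \<bullet> \<xi>)) * complex_of_real (exp (- t * (norm \<xi>)\<^sup>2) * (1 + (norm \<xi>)\<^sup>2) powr (- s / 2))"
proof -
  interpret B: prob_space "bessel_measure s" by (rule prob_space_bessel_measure) fact
  interpret P: pair_sigma_finite "bessel_measure s" "lborel :: (real \<times> real) measure" ..
  let ?f = "\<lambda>\<tau> z. cis (- (z \<bullet> \<xi>)) * complex_of_real (gauss (2 * (t + \<tau>)) z)"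
  have gi: "(LINT z|lborel. norm (?f \<tau> z)) = 1" if "\<tau> > 0" for \<tau>
    using assms that integral_gauss[of "2 * (t + \<tau>)"] by (simp add: norm_mult gauss_nonneg)
  have "integrable (bessel_measure s \<Otimes>\<^sub>M lborel) (\<lambda>(\<tau>, z). ?f \<tau> z)"
  proof (rule P.Fubini_integrable)
    show "integrable (bessel_measure s) (\<lambda>\<tau>. LINT z|lborel. norm (case (\<tau>, z) of (\<tau>, z) \<Rightarrow> ?f \<tau> z))"
      using bessel_measure_pos[of s]
      by (intro B.integrable_const_bound[where B = 1])
         (auto elim!: eventually_mono simp: gi simp del: norm_mult distrib_left_numeral)
    show "AE \<tau> in bessel_measure s. integrable lborel (\<lambda>z. case (\<tau>, z) of (\<tau>, z) \<Rightarrow> ?f \<tau> z)"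
      using bessel_measure_pos[of s]
      by eventually_elim (use assms in \<open>auto intro: integrable_cis_gauss\<close>)
  qed measurable
  from P.Fubini_integral[OF this]
  have swap: "(LINT z|lborel. LINT \<tau>|bessel_measure s. ?f \<tau> z) = (LINT \<tau>|bessel_measure s. LINT z|lborel. ?f \<tau> z)" .
  have "fourier (\<lambda>z. complex_of_real (bessel_heat s t (z - c))) \<xi>
      = (LINT z|lborel. cis (- ((c + z) \<bullet> \<xi>)) * complex_of_real (bessel_heat s t (c + z - c)))"
    unfolding fourier_def using assms by (subst lborel_integral_translate) auto
  also have "\<dots> = (LINT z|lborel. cis (- (c \<bullet> \<xi>)) * (LINT \<tau>|bessel_measure s. ?f \<tau> z))"
  proof (rule Bochner_Integration.integral_cong[OF refl])
    fix z
    have "cis (- ((c + z) \<bullet> \<xi>)) = cis (- (c \<bullet> \<xi>)) * cis (- (z \<bullet> \<xi>))"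
      by (simp add: cis_mult inner_add_left)
    then show "cis (- ((c + z) \<bullet> \<xi>)) * complex_of_real (bessel_heat s t (c + z - c))
        = cis (- (c \<bullet> \<xi>)) * (LINT \<tau>|bessel_measure s. ?f \<tau> z)"
      by (simp add: bessel_heat_def)
  qed
  also have "\<dots> = cis (- (c \<bullet> \<xi>)) * (LINT \<tau>|bessel_measure s. LINT z|lborel. ?f \<tau> z)"
    unfolding swap[symmetric] by (rule integral_mult_right_zero)
  also have "(LINT \<tau>|bessel_measure s. LINT z|lborel. ?f \<tau> z)
     = (LINT \<tau>|bessel_measure s. complex_of_real (exp (- t * (norm \<xi>)\<^sup>2) * exp (- ((norm \<xi>)\<^sup>2 * \<tau>))))"
  proof (rule integral_cong_AE)
    show "AE \<tau> in bessel_measure s. (LINT z|lborel. ?f \<tau> z)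
        = complex_of_real (exp (- t * (norm \<xi>)\<^sup>2) * exp (- ((norm \<xi>)\<^sup>2 * \<tau>)))"
      using bessel_measure_pos[of s]
    proof eventually_elim
      case (elim \<tau>)
      have "(LINT z|lborel. ?f \<tau> z) = complex_of_real (exp (- (2 * (t + \<tau>)) * (norm \<xi>)\<^sup>2 / 2))"
        using assms elim by (intro integral_cis_gauss) auto
      also have "exp (- (2 * (t + \<tau>)) * (norm \<xi>)\<^sup>2 / 2) = exp (- t * (norm \<xi>)\<^sup>2) * exp (- ((norm \<xi>)\<^sup>2 * \<tau>))"
        by (simp add: exp_add[symmetric] field_simps)
      finally show ?case .
    qed
  qed measurable
  also have "\<dots> = complex_of_real (exp (- t * (norm \<xi>)\<^sup>2) * (1 + (norm \<xi>)\<^sup>2) powr (- s / 2))"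
    unfolding integral_complex_of_real using bessel_measure_laplace[of s "(norm \<xi>)\<^sup>2"] assms by simp
  finally show ?thesis .
qed

text \<open>The two Bessel weights cancel and leave a Gaussian in \<xi>. As a multiple of a normal
  density it has a transform given by \<open>integral_cis_gauss\<close>, which therefore serves for
  the inverse transform too.\<close>

proposition bessel_op_bessel_heat:
  assumes "s > 0" "t > 0"
  shows "bessel_op s (\<lambda>z. complex_of_real (bessel_heat s t (z - c))) z = complex_of_real (gauss (2 * t) (z - c))"
proof -
  \<comment> \<open>The variance, in frequency, of the density proportional to exp (- t |\<xi>|^2);
    the factor pi / t below undoes its normalisation.\<close>
  let ?V = "1 / (2 * t)"
  have V: "?V > 0" using assms by simp
  have pw: "(1 + (norm \<xi>)\<^sup>2) powr (s / 2) * (1 + (norm \<xi>)\<^sup>2) powr (- s / 2) = 1" for \<xi> :: "real \<times> real"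
    by (simp add: powr_add[symmetric] add_pos_nonneg order.strict_implies_not_eq[symmetric] add_nonneg_eq_0_iff)
  have "cis (z \<bullet> \<xi>) * of_real ((1 + (norm \<xi>)\<^sup>2) powr (s / 2)) * fourier (\<lambda>z. complex_of_real (bessel_heat s t (z - c))) \<xi>
     = of_real (pi / t) * (cis (- (\<xi> \<bullet> (c - z))) * of_real (gauss ?V \<xi>))" for \<xi>
  proof -
    have "cis (z \<bullet> \<xi>) * of_real ((1 + (norm \<xi>)\<^sup>2) powr (s / 2)) * fourier (\<lambda>z. complex_of_real (bessel_heat s t (z - c))) \<xi>
      = (cis (z \<bullet> \<xi>) * cis (- (c \<bullet> \<xi>))) * of_real (exp (- t * (norm \<xi>)\<^sup>2) *
         ((1 + (norm \<xi>)\<^sup>2) powr (s / 2) * (1 + (norm \<xi>)\<^sup>2) powr (- s / 2)))"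
      unfolding fourier_bessel_heat[OF assms] by (simp only: of_real_mult mult_ac)
    also have "cis (z \<bullet> \<xi>) * cis (- (c \<bullet> \<xi>)) = cis (- (\<xi> \<bullet> (c - z)))"
      by (simp add: cis_mult inner_diff_right inner_commute)
    also have "exp (- t * (norm \<xi>)\<^sup>2) = pi / t * gauss ?V \<xi>"
      using assms by (simp add: gauss_def field_simps)
    finally show ?thesis unfolding pw by (simp add: mult_ac)
  qed
  then have "bessel_op s (\<lambda>z. complex_of_real (bessel_heat s t (z - c))) z
      = of_real (pi / t) * of_real (exp (- ?V * (norm (c - z))\<^sup>2 / 2)) / of_real ((2 * pi)\<^sup>2)"
    unfolding bessel_op_def by (simp only: integral_mult_right_zero integral_cis_gauss[OF V])
  also have "\<dots> = complex_of_real (pi / t * exp (- ?V * (norm (c - z))\<^sup>2 / 2) / (2 * pi)\<^sup>2)"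
    by (simp only: of_real_mult of_real_divide)
  also have "pi / t * exp (- ?V * (norm (c - z))\<^sup>2 / 2) / (2 * pi)\<^sup>2 = gauss (2 * t) (z - c)"
    using assms by (simp add: gauss_def norm_minus_commute power2_eq_square field_simps)
  finally show ?thesis .
qed

section \<open>Pairing an \<open>L\<^sup>p\<close> function with Gaussian kernels\<close>

text \<open>A splitting at the level L: above it, \<open>x powr (1 - p)\<close> is at most
  \<open>L powr (1 - p)\<close>, the exponent not being positive.\<close>

lemma le_add_powr:
  fixes x L p :: real
  assumes "x \<ge> 0" "L > 0" "p \<ge> 1"
  shows "x \<le> L + x powr p * L powr (1 - p)"
proof (cases "x \<le> L")
  case True
  then show ?thesis by (simp add: add_increasing2)
next
  case False
  then have "x = x powr p * x powr (1 - p)"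
    using assms by (simp add: powr_add[symmetric])
  also have "\<dots> \<le> x powr p * L powr (1 - p)"
    using False assms by (intro mult_left_mono powr_mono2') auto
  finally show ?thesis using assms by simp
qed

text \<open>This is Hoelder's inequality up to the factor 2, in the form needed for a weight \<open>W\<close> that
  is bounded by \<open>c\<close> and has mass at most 1.\<close>

lemma nn_integral_Lp_pairing:
  fixes g :: "real \<times> real \<Rightarrow> complex" and W :: "real \<times> real \<Rightarrow> ennreal"
  assumes p: "p > 1" and [measurable]: "g \<in> borel_measurable borel" "W \<in> borel_measurable borel"
    and int: "integrable lborel (\<lambda>z. cmod (g z) powr p)"
    and N: "N = (LINT z|lborel. cmod (g z) powr p) powr (1 / p)"
    and c: "c > 0" "\<And>z. W z \<le> ennreal c" and W1: "(\<integral>\<^sup>+z. W z \<partial>lborel) \<le> 1"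
  shows "(\<integral>\<^sup>+z. ennreal (cmod (g z)) * W z \<partial>lborel) \<le> ennreal (2 * c powr (1 / p) * N)"
proof -
  have N0: "N \<ge> 0" using N by simp
  have Np: "(LINT z|lborel. cmod (g z) powr p) = N powr p"
    using p unfolding N by (simp add: powr_powr)
  have *: "(\<integral>\<^sup>+z. ennreal (cmod (g z)) * W z \<partial>lborel) \<le> ennreal (L + L powr (1 - p) * c * N powr p)"
    if L: "L > 0" for L
  proof -
    have "(\<integral>\<^sup>+z. ennreal (cmod (g z)) * W z \<partial>lborel)
      \<le> (\<integral>\<^sup>+z. ennreal L * W z + ennreal (L powr (1 - p) * c) * ennreal (cmod (g z) powr p) \<partial>lborel)"
    proof (rule nn_integral_mono)
      fix z
      have "ennreal (cmod (g z)) * W z \<le> ennreal (L + cmod (g z) powr p * L powr (1 - p)) * W z"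
        using le_add_powr[of "cmod (g z)" L p] L p by (intro mult_right_mono ennreal_leI) auto
      also have "\<dots> = ennreal L * W z + ennreal (cmod (g z) powr p * L powr (1 - p)) * W z"
        using L by (simp add: distrib_right)
      also have "\<dots> \<le> ennreal L * W z + ennreal (cmod (g z) powr p * L powr (1 - p)) * ennreal c"
        by (intro add_left_mono mult_left_mono c) auto
      also have "ennreal (cmod (g z) powr p * L powr (1 - p)) * ennreal c
          = ennreal (L powr (1 - p) * c) * ennreal (cmod (g z) powr p)"
        using c L by (simp add: ennreal_mult[symmetric] mult_ac)
      finally show "ennreal (cmod (g z)) * W z
        \<le> ennreal L * W z + ennreal (L powr (1 - p) * c) * ennreal (cmod (g z) powr p)" .
    qed
    also have "\<dots> = ennreal L * (\<integral>\<^sup>+z. W z \<partial>lborel)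
        + ennreal (L powr (1 - p) * c) * (\<integral>\<^sup>+z. ennreal (cmod (g z) powr p) \<partial>lborel)"
      by (subst nn_integral_add, measurable, subst (1 2) nn_integral_cmult, measurable)
    also have "(\<integral>\<^sup>+z. ennreal (cmod (g z) powr p) \<partial>lborel) = ennreal (N powr p)"
      using int by (subst nn_integral_eq_integral) (auto simp: Np)
    also have "ennreal L * (\<integral>\<^sup>+z. W z \<partial>lborel) \<le> ennreal L * 1"
      by (intro mult_left_mono W1) auto
    also have "ennreal L * 1 + ennreal (L powr (1 - p) * c) * ennreal (N powr p)
        = ennreal (L + L powr (1 - p) * c * N powr p)"
      using L c by (simp add: ennreal_mult[symmetric] ennreal_plus[symmetric] del: ennreal_plus)
    finally show ?thesis by (simp add: add_right_mono)
  qed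
  show ?thesis
  proof (cases "N = 0")
    case True
    \<comment> \<open>The balanced level would be 0 here, so all positive levels e are used
      instead.\<close>
    have "(\<integral>\<^sup>+z. ennreal (cmod (g z)) * W z \<partial>lborel) \<le> 0"
    proof (rule ennreal_le_epsilon)
      show "(\<integral>\<^sup>+z. ennreal (cmod (g z)) * W z \<partial>lborel) \<le> 0 + ennreal e" if "e > 0" for e
        using *[OF that] True by simp
    qed
    then show ?thesis by simp
  next
    case False
    then have N: "N > 0" using N0 by simp
    \<comment> \<open>At this level the two terms of the bound are equal.\<close>
    define L where "L = c powr (1 / p) * N"
    have "L > 0" using c N by (simp add: L_def)
    have "L powr (1 - p) * c * N powr p = (c powr (1 / p)) powr (1 - p) * c * (N powr (1 - p) * N powr p)"
      using N by (simp add: L_def powr_mult)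
    also have "N powr (1 - p) * N powr p = N" using N by (simp add: powr_add[symmetric])
    also have "(c powr (1 / p)) powr (1 - p) * c = c powr (1 / p * (1 - p) + 1)"
      using c by (simp add: powr_powr powr_add)
    also have "1 / p * (1 - p) + 1 = 1 / p" using p by (simp add: field_simps)
    finally have "L + L powr (1 - p) * c * N powr p = 2 * c powr (1 / p) * N"
      by (simp add: L_def)
    then show ?thesis using *[OF \<open>L > 0\<close>] by simp
  qed
qed

section \<open>Translates of a Gaussian\<close>

lemma abs_exp_diff_1_le: "\<bar>exp (- u) - 1\<bar> \<le> \<bar>u\<bar> * exp \<bar>u\<bar>" for u :: real
proof (cases "u \<ge> 0")
  case True
  have "1 - exp (- u) \<le> u" using exp_ge_add_one_self[of "- u"] by simp
  also have "u * 1 \<le> u * exp u" using True by (intro mult_left_mono) auto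
  finally show ?thesis using True by simp
next
  case False
  define v where "v = - u"
  have v: "v > 0" using False by (simp add: v_def)
  have "1 - v \<le> exp (- v)" using exp_ge_add_one_self[of "- v"] by simp
  then have "(1 - v) * exp v \<le> exp (- v) * exp v" by (intro mult_right_mono) auto
  then have "exp v - 1 \<le> v * exp v" by (simp add: algebra_simps exp_add[symmetric])
  then show ?thesis using v by (simp add: v_def)
qed

text \<open>Doubling the variance leaves half of the exponent over, a^2 / 4 in the scaled variable
  a. This surplus absorbs the factor exp (2 a + 1) caused by the displacement.\<close>

lemma gauss_diff_le:
  fixes z h :: "real \<times> real"
  assumes V: "V > 0" and h: "norm h \<le> sqrt V"
  shows "\<bar>gauss V (z + h) - gauss V z\<bar> \<le> 2 * exp 5 * (norm h / sqrt V) * gauss (2 * V) z"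
proof -
  define a b where "a = norm z / sqrt V" and "b = norm h / sqrt V"
  have a: "a \<ge> 0" and b: "0 \<le> b" "b \<le> 1" using V h by (auto simp: a_def b_def)
  define u where "u = ((norm (z + h))\<^sup>2 - (norm z)\<^sup>2) / (2 * V)"
  have "(norm (z + h))\<^sup>2 - (norm z)\<^sup>2 = 2 * (z \<bullet> h) + (norm h)\<^sup>2"
    by (simp add: power2_norm_eq_inner inner_add_left inner_add_right inner_commute)
  then have "\<bar>u\<bar> \<le> (2 * \<bar>z \<bullet> h\<bar> + (norm h)\<^sup>2) / (2 * V)"
    using V by (simp add: u_def abs_mult abs_divide divide_right_mono abs_triangle_ineq[THEN order_trans])
  also have "\<dots> \<le> (2 * (norm z * norm h) + (norm h)\<^sup>2) / (2 * V)"
    using V by (intro divide_right_mono add_right_mono mult_left_mono Cauchy_Schwarz_ineq2) auto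
  also have "\<dots> = a * b + b\<^sup>2 / 2"
    using V by (simp add: a_def b_def field_simps power2_eq_square)
  also have "\<dots> \<le> a * b + b"
    using b mult_right_mono[of b 1 b] by (simp add: power2_eq_square)
  finally have u1: "\<bar>u\<bar> \<le> b * (a + 1)" by (simp add: algebra_simps)
  also have "\<dots> \<le> 1 * (a + 1)" using a b by (intro mult_right_mono) auto
  finally have u2: "\<bar>u\<bar> \<le> a + 1" by simp
  have g1: "gauss V (z + h) = gauss V z * exp (- u)"
    using V by (simp add: gauss_def u_def diff_divide_distrib exp_add[symmetric])
  have g2: "gauss V z = 2 * gauss (2 * V) z * exp (- a\<^sup>2 / 4)"
    using V by (simp add: gauss_def a_def power_divide exp_add[symmetric])
  have g0: "gauss V z \<ge> 0" and g3: "gauss (2 * V) z \<ge> 0" using V by (simp_all add: gauss_nonneg)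
  have "gauss V (z + h) - gauss V z = gauss V z * (exp (- u) - 1)"
    unfolding g1 by (simp add: right_diff_distrib)
  then have "\<bar>gauss V (z + h) - gauss V z\<bar> = gauss V z * \<bar>exp (- u) - 1\<bar>"
    using g0 by (simp add: abs_mult)
  also have "\<dots> \<le> gauss V z * (\<bar>u\<bar> * exp \<bar>u\<bar>)"
    by (intro mult_left_mono abs_exp_diff_1_le g0)
  also have "\<dots> \<le> gauss V z * ((b * (a + 1)) * exp (a + 1))"
    using a b by (intro mult_left_mono mult_mono u1 g0) (use u2 in auto)
  also have "\<dots> \<le> gauss V z * ((b * exp a) * exp (a + 1))"
    using a b exp_ge_add_one_self[of a, unfolded add.commute[of 1 a]] by (intro mult_left_mono mult_right_mono g0) auto
  also have "\<dots> = 2 * b * gauss (2 * V) z * exp (2 * a + 1 - a\<^sup>2 / 4)"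
  proof -
    have "exp (2 * a + 1 - a\<^sup>2 / 4) = exp (- a\<^sup>2 / 4) * exp a * exp (a + 1)"
      by (simp add: exp_add[symmetric])
    then show ?thesis unfolding g2 by (simp only: mult_ac)
  qed
  also have "\<dots> \<le> 2 * b * gauss (2 * V) z * exp 5"
  proof -
    \<comment> \<open>The maximum of 2 a + 1 - a^2 / 4 is 5, attained at a = 4.\<close>
    have "0 \<le> (a - 4)\<^sup>2" by simp
    then have "2 * a + 1 - a\<^sup>2 / 4 \<le> 5" by (simp add: power2_eq_square algebra_simps)
    then show ?thesis using b g3 by (intro mult_left_mono) auto
  qed
  finally show ?thesis by (simp add: b_def mult_ac)
qed

lemma nn_integral_lborel_translate:
  fixes f :: "'a::euclidean_space \<Rightarrow> ennreal"
  assumes "f \<in> borel_measurable borel"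
  shows "(\<integral>\<^sup>+z. f (c + z) \<partial>lborel) = (\<integral>\<^sup>+z. f z \<partial>lborel)"
  using nn_integral_distr[of "(+) c" lborel borel f] assms lborel_distr_plus[of c] by simp

lemma nn_integral_gauss_translate: "V > 0 \<Longrightarrow> (\<integral>\<^sup>+z. gauss V (z - c) \<partial>lborel) = 1"
  using nn_integral_lborel_translate[of "\<lambda>z. ennreal (gauss V z)" "- c"] nn_integral_gauss[of V]
  by simp

context
  fixes g :: "real \<times> real \<Rightarrow> complex" and p N :: real
  assumes p: "p > 1" and g [measurable]: "g \<in> borel_measurable borel"
    and gp: "integrable lborel (\<lambda>z. cmod (g z) powr p)"
    and N: "N = (LINT z|lborel. cmod (g z) powr p) powr (1 / p)"
begin

lemma nn_integral_Lp_gauss: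
  assumes V: "V > 0"
  shows "(\<integral>\<^sup>+z. ennreal (cmod (g z)) * ennreal (gauss V (z - c)) \<partial>lborel) \<le> ennreal (2 * V powr (- 1 / p) * N)"
proof -
  have "1 / (2 * pi * V) \<le> 1 / V"
    using V pi_ge_two by (intro frac_le) (auto simp: field_simps)
  then have "gauss V z \<le> 1 / V" for z
    using gauss_le[OF V, of z] by linarith
  then have "(\<integral>\<^sup>+z. ennreal (cmod (g z)) * ennreal (gauss V (z - c)) \<partial>lborel) \<le> ennreal (2 * (1 / V) powr (1 / p) * N)"
    using V p gp N nn_integral_gauss_translate[OF V, of c]
    by (intro nn_integral_Lp_pairing) (auto intro!: ennreal_leI)
  also have "(1 / V) powr (1 / p) = V powr (- 1 / p)"
    using V by (simp add: powr_divide powr_minus_divide)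
  finally show ?thesis .
qed

text \<open>The exponent \<gamma> interpolates between a Lipschitz bound and the triangle
  inequality. With b the displacement in units of \<open>sqrt V\<close>, b <= b^\<gamma> if b <= 1,
  and 1 <= b^\<gamma> otherwise.\<close>

lemma nn_integral_Lp_gauss_diff:
  assumes V: "V > 0" and \<gamma>: "0 < \<gamma>" "\<gamma> \<le> 1"
  shows "(\<integral>\<^sup>+z. ennreal (cmod (g z)) * ennreal \<bar>gauss V (z - c) - gauss V (z - c')\<bar> \<partial>lborel)
    \<le> ennreal (4 * exp 5 * norm (c - c') powr \<gamma> * V powr (- \<gamma> / 2 - 1 / p) * N)"
proof -
  have N0: "N \<ge> 0" using N by simp
  define b where "b = norm (c - c') / sqrt V"
  have b0: "b \<ge> 0" using V by (simp add: b_def)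
  have b: "b powr \<gamma> * V powr (- 1 / p) = norm (c - c') powr \<gamma> * V powr (- \<gamma> / 2 - 1 / p)"
  proof -
    have "sqrt V powr \<gamma> = V powr (\<gamma> / 2)"
      using V by (simp add: powr_half_sqrt[symmetric] powr_powr)
    then have "b powr \<gamma> = norm (c - c') powr \<gamma> * V powr (- \<gamma> / 2)"
      using V by (simp add: b_def powr_divide powr_minus_divide)
    then show ?thesis by (simp add: powr_add[symmetric] mult.assoc)
  qed
  have "(\<integral>\<^sup>+z. ennreal (cmod (g z)) * ennreal \<bar>gauss V (z - c) - gauss V (z - c')\<bar> \<partial>lborel)
     \<le> ennreal (4 * exp 5 * b powr \<gamma> * V powr (- 1 / p) * N)"
  proof (cases "b \<le> 1")
    case True
    have "b \<le> b powr \<gamma>"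
      using b0 True \<gamma> powr_mono'[of \<gamma> 1 b] by (cases "b = 0") auto
    have "(\<integral>\<^sup>+z. ennreal (cmod (g z)) * ennreal \<bar>gauss V (z - c) - gauss V (z - c')\<bar> \<partial>lborel)
      \<le> (\<integral>\<^sup>+z. ennreal (2 * exp 5 * b) * (ennreal (cmod (g z)) * ennreal (gauss (2 * V) (z - c'))) \<partial>lborel)"
    proof (rule nn_integral_mono)
      fix z
      have "\<bar>gauss V (z - c') + 0 - gauss V (z - c)\<bar> \<le> 2 * exp 5 * b * gauss (2 * V) (z - c')"
        using gauss_diff_le[OF V, of "c' - c" "z - c'"] True V
        by (simp add: b_def norm_minus_commute abs_minus_commute field_simps)
      then have "ennreal (cmod (g z)) * ennreal \<bar>gauss V (z - c) - gauss V (z - c')\<bar>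
         \<le> ennreal (cmod (g z)) * ennreal (2 * exp 5 * b * gauss (2 * V) (z - c'))"
        by (intro mult_left_mono ennreal_leI) (auto simp: abs_minus_commute)
      then show "ennreal (cmod (g z)) * ennreal \<bar>gauss V (z - c) - gauss V (z - c')\<bar>
         \<le> ennreal (2 * exp 5 * b) * (ennreal (cmod (g z)) * ennreal (gauss (2 * V) (z - c')))"
        using b0 V by (simp add: ennreal_mult gauss_nonneg mult_ac)
    qed
    also have "\<dots> = ennreal (2 * exp 5 * b) * (\<integral>\<^sup>+z. ennreal (cmod (g z)) * ennreal (gauss (2 * V) (z - c')) \<partial>lborel)"
      by (rule nn_integral_cmult) measurable
    also have "\<dots> \<le> ennreal (2 * exp 5 * b) * ennreal (2 * (2 * V) powr (- 1 / p) * N)"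
      using V by (intro mult_left_mono nn_integral_Lp_gauss) auto
    also have "\<dots> \<le> ennreal (2 * exp 5 * b powr \<gamma>) * ennreal (2 * V powr (- 1 / p) * N)"
      using \<open>b \<le> b powr \<gamma>\<close> V N0 p
      by (intro mult_mono ennreal_leI mult_left_mono mult_right_mono powr_mono2') auto
    also have "\<dots> = ennreal (4 * exp 5 * b powr \<gamma> * V powr (- 1 / p) * N)"
      using N0 by (simp add: ennreal_mult[symmetric])
    finally show ?thesis .
  next
    case False
    then have "1 \<le> b powr \<gamma>" using \<gamma> by (simp add: ge_one_powr_ge_zero)
    have "(\<integral>\<^sup>+z. ennreal (cmod (g z)) * ennreal \<bar>gauss V (z - c) - gauss V (z - c')\<bar> \<partial>lborel)
      \<le> (\<integral>\<^sup>+z. ennreal (cmod (g z)) * ennreal (gauss V (z - c)) + ennreal (cmod (g z)) * ennreal (gauss V (z - c')) \<partial>lborel)"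
    proof (rule nn_integral_mono)
      fix z
      have "\<bar>gauss V (z - c) - gauss V (z - c')\<bar> \<le> gauss V (z - c) + gauss V (z - c')"
        using gauss_nonneg[OF V, of "z - c"] gauss_nonneg[OF V, of "z - c'"] by linarith
      then show "ennreal (cmod (g z)) * ennreal \<bar>gauss V (z - c) - gauss V (z - c')\<bar>
        \<le> ennreal (cmod (g z)) * ennreal (gauss V (z - c)) + ennreal (cmod (g z)) * ennreal (gauss V (z - c'))"
        using gauss_nonneg[OF V] by (simp flip: distrib_left ennreal_plus) (intro mult_left_mono ennreal_leI; simp)
    qed
    also have "\<dots> = (\<integral>\<^sup>+z. ennreal (cmod (g z)) * ennreal (gauss V (z - c)) \<partial>lborel)
        + (\<integral>\<^sup>+z. ennreal (cmod (g z)) * ennreal (gauss V (z - c')) \<partial>lborel)"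
      by (rule nn_integral_add) measurable
    also have "\<dots> \<le> ennreal (2 * V powr (- 1 / p) * N) + ennreal (2 * V powr (- 1 / p) * N)"
      by (intro add_mono nn_integral_Lp_gauss V)
    also have "\<dots> = ennreal (4 * V powr (- 1 / p) * N)"
      using N0 by (simp flip: ennreal_plus)
    also have "\<dots> \<le> ennreal (4 * (exp 5 * b powr \<gamma>) * V powr (- 1 / p) * N)"
    proof -
      have "1 * 1 \<le> exp 5 * b powr \<gamma>" using \<open>1 \<le> b powr \<gamma>\<close> by (intro mult_mono) auto
      then have "4 * 1 \<le> 4 * (exp 5 * b powr \<gamma>)" by linarith
      from mult_right_mono[OF mult_right_mono[OF this, of "V powr (- 1 / p)"], of N] show ?thesis
        using N0 by (intro ennreal_leI) auto
    qed
    finally show ?thesis by (simp add: mult.assoc)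
  qed
  also have "4 * exp 5 * b powr \<gamma> * V powr (- 1 / p) * N = 4 * exp 5 * (b powr \<gamma> * V powr (- 1 / p)) * N"
    by (simp only: mult_ac)
  finally show ?thesis unfolding b by (simp add: mult.assoc)
qed

end

section \<open>Heat extension of a Bessel potential\<close>

lemma gauss_minus: "gauss V (- z) = gauss V z"
  by (simp add: gauss_def)

lemma bessel_heat_minus_commute: "bessel_heat s t (z - w) = bessel_heat s t (w - z)"
  using gauss_minus[of _ "z - w"] by (simp add: bessel_heat_def)

context
  fixes s t :: real
  assumes s: "s > 0" and t: "t > 0"
begin

interpretation B: prob_space "bessel_measure s" by (rule prob_space_bessel_measure) (rule s)

lemma AE_gauss_bessel_measure:
  "AE \<tau> in bessel_measure s. 0 \<le> gauss (2 * (t + \<tau>)) z \<and> gauss (2 * (t + \<tau>)) z \<le> 1 / t"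
  using bessel_measure_pos
proof eventually_elim
  case (elim \<tau>)
  have "gauss (2 * (t + \<tau>)) z \<le> 1 / (2 * pi * (2 * (t + \<tau>)))"
    using elim t by (intro gauss_le) auto
  also have "\<dots> \<le> 1 / t"
  proof (intro frac_le)
    have "1 * t \<le> (2 * pi) * (2 * (t + \<tau>))"
      using elim t pi_ge_two by (intro mult_mono) auto
    then show "t \<le> 2 * pi * (2 * (t + \<tau>))" by simp
  qed (use t in auto)
  finally show ?case using elim t by (simp add: gauss_nonneg)
qed

lemma integrable_gauss_bessel_measure: "integrable (bessel_measure s) (\<lambda>\<tau>. gauss (2 * (t + \<tau>)) z)"
proof (rule B.integrable_const_bound)
  show "AE \<tau> in bessel_measure s. norm (gauss (2 * (t + \<tau>)) z) \<le> 1 / t"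
    using AE_gauss_bessel_measure[of z] by eventually_elim auto
qed measurable

lemma bessel_heat_nonneg: "bessel_heat s t z \<ge> 0"
  unfolding bessel_heat_def
  by (rule integral_nonneg_AE) (use AE_gauss_bessel_measure[of z] in \<open>auto elim!: eventually_mono\<close>)

lemma ennreal_bessel_heat:
  "ennreal (bessel_heat s t z) = (\<integral>\<^sup>+\<tau>. ennreal (gauss (2 * (t + \<tau>)) z) \<partial>bessel_measure s)"
  unfolding bessel_heat_def
  by (rule nn_integral_eq_integral[symmetric, OF integrable_gauss_bessel_measure])
     (use AE_gauss_bessel_measure[of z] in \<open>auto elim!: eventually_mono\<close>)

lemma bessel_heat_le: "bessel_heat s t z \<le> 1 / t"
proof -
  have "bessel_heat s t z \<le> (LINT \<tau>|bessel_measure s. 1 / t)"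
    unfolding bessel_heat_def
    by (rule integral_mono_AE[OF integrable_gauss_bessel_measure])
       (use AE_gauss_bessel_measure[of z] in \<open>auto elim!: eventually_mono\<close>)
  then show ?thesis using B.prob_space by simp
qed

lemma nn_integral_bessel_heat_translate: "(\<integral>\<^sup>+z. ennreal (bessel_heat s t (z - c)) \<partial>lborel) = 1"
proof -
  interpret P: pair_sigma_finite "bessel_measure s" "lborel :: (real \<times> real) measure" ..
  have "(\<integral>\<^sup>+z. ennreal (bessel_heat s t (z - c)) \<partial>lborel)
     = (\<integral>\<^sup>+z. \<integral>\<^sup>+\<tau>. ennreal (gauss (2 * (t + \<tau>)) (z - c)) \<partial>bessel_measure s \<partial>lborel)"
    by (simp only: ennreal_bessel_heat)
  also have "\<dots> = (\<integral>\<^sup>+\<tau>. \<integral>\<^sup>+z. ennreal (gauss (2 * (t + \<tau>)) (z - c)) \<partial>lborel \<partial>bessel_measure s)"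
    by (rule P.Fubini') measurable
  also have "\<dots> = (\<integral>\<^sup>+\<tau>. 1 \<partial>bessel_measure s)"
    using bessel_measure_pos[of s] t
    by (intro nn_integral_cong_AE) (auto elim!: eventually_mono intro!: nn_integral_gauss_translate)
  finally show ?thesis using B.emeasure_space_1 by simp
qed

lemma ennreal_bessel_heat_diff_le:
  "ennreal \<bar>bessel_heat s t z - bessel_heat s t z'\<bar>
    \<le> (\<integral>\<^sup>+\<tau>. ennreal \<bar>gauss (2 * (t + \<tau>)) z - gauss (2 * (t + \<tau>)) z'\<bar> \<partial>bessel_measure s)"
proof -
  have "bessel_heat s t z - bessel_heat s t z'
      = (LINT \<tau>|bessel_measure s. gauss (2 * (t + \<tau>)) z - gauss (2 * (t + \<tau>)) z')"
    unfolding bessel_heat_def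
    by (rule Bochner_Integration.integral_diff[symmetric]) (rule integrable_gauss_bessel_measure)+
  moreover have "ennreal (norm (LINT \<tau>|bessel_measure s. gauss (2 * (t + \<tau>)) z - gauss (2 * (t + \<tau>)) z'))
     \<le> (\<integral>\<^sup>+\<tau>. ennreal (norm (gauss (2 * (t + \<tau>)) z - gauss (2 * (t + \<tau>)) z')) \<partial>bessel_measure s)"
    by (rule integral_norm_bound_ennreal)
       (intro Bochner_Integration.integrable_diff integrable_gauss_bessel_measure)
  ultimately show ?thesis by simp
qed

end

text \<open>The convolution of F with the heat kernel, written as the pairing that
  \<open>bessel_op_bessel_heat\<close> produces.\<close>

definition heat_ext :: "(real \<times> real \<Rightarrow> complex) \<Rightarrow> real \<Rightarrow> real \<times> real \<Rightarrow> complex" where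
  "heat_ext F t c = (LINT y|lborel. F y * complex_of_real (gauss (2 * t) (y - c)))"

context
  fixes F f :: "real \<times> real \<Rightarrow> complex" and s p N :: real
  assumes p: "p > 1" and s: "s > 2 / p"
    and f [measurable]: "f \<in> borel_measurable borel"
    and fp: "integrable lborel (\<lambda>z. cmod (f z) powr p)"
    and N: "N = (LINT z|lborel. cmod (f z) powr p) powr (1 / p)"
    and pairing: "\<And>t c. t > 0 \<Longrightarrow>
      heat_ext F t c = (LINT y|lborel. f y * complex_of_real (bessel_heat s t (y - c)))"
begin

lemma s_pos: "s > 0" using s p by (smt (verit) divide_pos_pos)

lemma integrable_Lp_bessel_heat:
  assumes t: "t > 0"
  shows "integrable lborel (\<lambda>y. f y * complex_of_real (bessel_heat s t (y - c)))"
proof (rule integrableI_bounded)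
  note [measurable] = bessel_heat_measurable[OF s_pos]
  show "(\<lambda>y. f y * complex_of_real (bessel_heat s t (y - c))) \<in> borel_measurable lborel" by measurable
  have "(\<integral>\<^sup>+y. ennreal (cmod (f y)) * ennreal (bessel_heat s t (y - c)) \<partial>lborel)
      \<le> ennreal (2 * (1 / t) powr (1 / p) * N)"
    using t p fp N bessel_heat_le[OF s_pos t] nn_integral_bessel_heat_translate[OF s_pos t, of c]
    by (intro nn_integral_Lp_pairing) (auto intro!: ennreal_leI)
  also have "\<dots> < \<infinity>" by simp
  finally show "(\<integral>\<^sup>+y. ennreal (norm (f y * complex_of_real (bessel_heat s t (y - c)))) \<partial>lborel) < \<infinity>"
    using bessel_heat_nonneg[OF s_pos t] by (simp add: norm_mult ennreal_mult)
qed

text \<open>The bound is free of t. The mixture is estimated Gaussian by Gaussian; the power of the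
  variance has a nonpositive exponent, so 2 (t + \<tau>) may be replaced by \<tau>, and the
  resulting negative moment is finite because \<gamma> < s - 2 / p.\<close>

lemma heat_ext_hoelder:
  assumes t: "t > 0" and \<gamma>: "0 < \<gamma>" "\<gamma> \<le> 1" "\<gamma> < s - 2 / p"
  shows "norm (heat_ext F t c - heat_ext F t c')
    \<le> 4 * exp 5 * (LINT \<tau>|bessel_measure s. \<tau> powr (- \<gamma> / 2 - 1 / p)) * norm (c - c') powr \<gamma> * N"
proof -
  note [measurable] = bessel_heat_measurable[OF s_pos]
  interpret B: prob_space "bessel_measure s" by (rule prob_space_bessel_measure) (rule s_pos)
  interpret P: pair_sigma_finite "bessel_measure s" "lborel :: (real \<times> real) measure" ..
  have N0: "N \<ge> 0" using N by simp
  let ?q = "- \<gamma> / 2 - 1 / p" and ?K = "4 * exp 5 * norm (c - c') powr \<gamma> * N"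
  have K0: "?K \<ge> 0" using N0 by simp
  have q: "s / 2 + ?q > 0" using \<gamma> by (simp add: field_simps)
  have "1 / p > 0" using p by simp
  then have q0: "?q \<le> 0" using \<gamma> by linarith
  let ?D = "\<lambda>y. bessel_heat s t (y - c) - bessel_heat s t (y - c')"
  let ?G = "\<lambda>\<tau> y. \<bar>gauss (2 * (t + \<tau>)) (y - c) - gauss (2 * (t + \<tau>)) (y - c')\<bar>"
  have "heat_ext F t c - heat_ext F t c' = (LINT y|lborel. f y * complex_of_real (?D y))"
    unfolding pairing[OF t]
    by (subst Bochner_Integration.integral_diff[symmetric])
       (auto intro!: integrable_Lp_bessel_heat t simp: right_diff_distrib)
  also have "ennreal (norm \<dots>) \<le> (\<integral>\<^sup>+y. ennreal (norm (f y * complex_of_real (?D y))) \<partial>lborel)"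
  proof (rule integral_norm_bound_ennreal)
    show "integrable lborel (\<lambda>y. f y * complex_of_real (?D y))"
      using Bochner_Integration.integrable_diff[OF integrable_Lp_bessel_heat[OF t, of c] integrable_Lp_bessel_heat[OF t, of c']]
      by (simp add: right_diff_distrib)
  qed
  also have "\<dots> \<le> (\<integral>\<^sup>+y. \<integral>\<^sup>+\<tau>. ennreal (cmod (f y)) * ennreal (?G \<tau> y) \<partial>bessel_measure s \<partial>lborel)"
  proof (rule nn_integral_mono)
    fix y
    have "ennreal (norm (f y * complex_of_real (?D y))) = ennreal (cmod (f y)) * ennreal \<bar>?D y\<bar>"
      by (simp add: norm_mult ennreal_mult flip: of_real_diff)
    also have "\<dots> \<le> ennreal (cmod (f y)) * (\<integral>\<^sup>+\<tau>. ennreal (?G \<tau> y) \<partial>bessel_measure s)"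
      by (intro mult_left_mono ennreal_bessel_heat_diff_le s_pos t) auto
    also have "\<dots> = (\<integral>\<^sup>+\<tau>. ennreal (cmod (f y)) * ennreal (?G \<tau> y) \<partial>bessel_measure s)"
      by (rule nn_integral_cmult[symmetric]) measurable
    finally show "ennreal (norm (f y * complex_of_real (?D y)))
      \<le> (\<integral>\<^sup>+\<tau>. ennreal (cmod (f y)) * ennreal (?G \<tau> y) \<partial>bessel_measure s)" .
  qed
  also have "\<dots> = (\<integral>\<^sup>+\<tau>. \<integral>\<^sup>+y. ennreal (cmod (f y)) * ennreal (?G \<tau> y) \<partial>lborel \<partial>bessel_measure s)"
    by (rule P.Fubini') measurable
  also have "\<dots> \<le> (\<integral>\<^sup>+\<tau>. ennreal ?K * ennreal (\<tau> powr ?q) \<partial>bessel_measure s)"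
  proof (rule nn_integral_mono_AE)
    show "AE \<tau> in bessel_measure s. (\<integral>\<^sup>+y. ennreal (cmod (f y)) * ennreal (?G \<tau> y) \<partial>lborel)
      \<le> ennreal ?K * ennreal (\<tau> powr ?q)"
      using bessel_measure_pos
    proof eventually_elim
      case (elim \<tau>)
      have "(\<integral>\<^sup>+y. ennreal (cmod (f y)) * ennreal (?G \<tau> y) \<partial>lborel)
         \<le> ennreal (4 * exp 5 * norm (c - c') powr \<gamma> * (2 * (t + \<tau>)) powr ?q * N)"
        using elim t by (intro nn_integral_Lp_gauss_diff p f fp N \<gamma>) auto
      also have "\<dots> \<le> ennreal (4 * exp 5 * norm (c - c') powr \<gamma> * \<tau> powr ?q * N)"
        using elim t N0
        by (intro ennreal_leI mult_right_mono mult_left_mono powr_mono2'[OF q0]) auto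
      also have "\<dots> = ennreal ?K * ennreal (\<tau> powr ?q)"
        using K0 by (simp add: ennreal_mult[symmetric] mult_ac)
      finally show ?case .
    qed
  qed
  also have "\<dots> = ennreal ?K * ennreal (LINT \<tau>|bessel_measure s. \<tau> powr ?q)"
    by (subst nn_integral_cmult, measurable,
        subst nn_integral_eq_integral[OF integrable_bessel_powr[OF s_pos q]]) auto
  also have "\<dots> = ennreal (?K * (LINT \<tau>|bessel_measure s. \<tau> powr ?q))"
    using K0 by (simp add: ennreal_mult)
  finally have "norm (heat_ext F t c - heat_ext F t c') \<le> ?K * (LINT \<tau>|bessel_measure s. \<tau> powr ?q)"
    using K0 by (subst (asm) ennreal_le_iff) auto
  then show ?thesis by (simp only: mult_ac)
qed

text \<open>By Fubini the integral over R pairs f with m times the kernel averaged over R. This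
  average W has mass at most 1 and is at most 1 / m whatever t is, so the Hoelder-type inequality
  yields a bound free of t.\<close>

lemma heat_ext_set_integral_le:
  assumes t: "t > 0" and R [measurable]: "R \<in> sets borel"
    and m: "emeasure lborel R = ennreal m" "m > 0"
  shows "norm (LINT c:R|lborel. heat_ext F t c) \<le> 2 * m powr (1 - 1 / p) * N"
proof -
  note [measurable] = bessel_heat_measurable[OF s_pos]
  have N0: "N \<ge> 0" using N by simp
  let ?b = "\<lambda>y c. ennreal (bessel_heat s t (y - c))"
  define W where "W y = ennreal (1 / m) * (\<integral>\<^sup>+c. indicator R c * ?b y c \<partial>lborel)" for y
  have [measurable]: "W \<in> borel_measurable borel" unfolding W_def by measurable
  have W1: "W y \<le> ennreal (1 / m)" for y
  proof -
    have "(\<integral>\<^sup>+c. indicator R c * ?b y c \<partial>lborel) \<le> (\<integral>\<^sup>+c. ?b c y \<partial>lborel)"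
      using bessel_heat_minus_commute[of s t y] by (intro nn_integral_mono) (auto simp: indicator_def)
    also have "\<dots> = 1" by (rule nn_integral_bessel_heat_translate[OF s_pos t])
    finally show ?thesis unfolding W_def using mult_left_mono[of _ 1 "ennreal (1 / m)"] by simp
  qed
  have mm: "ennreal (1 / m) * ennreal m = 1" using m by (simp add: ennreal_mult[symmetric])
  have W2: "(\<integral>\<^sup>+y. W y \<partial>lborel) \<le> 1"
  proof -
    have "(\<integral>\<^sup>+y. W y \<partial>lborel) = ennreal (1 / m) * (\<integral>\<^sup>+y. \<integral>\<^sup>+c. indicator R c * ?b y c \<partial>lborel \<partial>lborel)"
      unfolding W_def by (rule nn_integral_cmult) measurable
    also have "(\<integral>\<^sup>+y. \<integral>\<^sup>+c. indicator R c * ?b y c \<partial>lborel \<partial>lborel) = (\<integral>\<^sup>+c. \<integral>\<^sup>+y. indicator R c * ?b y c \<partial>lborel \<partial>lborel)"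
      by (rule lborel_pair.Fubini') measurable
    also have "\<dots> = (\<integral>\<^sup>+c. indicator R c * (\<integral>\<^sup>+y. ?b y c \<partial>lborel) \<partial>lborel)"
      by (intro nn_integral_cong nn_integral_cmult) measurable
    also have "\<dots> = ennreal m"
      using m by (simp add: nn_integral_bessel_heat_translate[OF s_pos t])
    finally show ?thesis using mm by simp
  qed
  \<comment> \<open>A Bochner integral that does not exist has the value 0, so the inequality holds
    before integrability of \<open>heat_ext\<close> on R is known.\<close>
  have "ennreal (norm (LINT c:R|lborel. heat_ext F t c))
      \<le> (\<integral>\<^sup>+c. ennreal (norm (indicator R c *\<^sub>R heat_ext F t c)) \<partial>lborel)"
    unfolding set_lebesgue_integral_def
    by (cases "integrable lborel (\<lambda>c. indicator R c *\<^sub>R heat_ext F t c)")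
       (auto intro: integral_norm_bound_ennreal simp del: norm_scaleR simp: not_integrable_integral_eq)
  also have "\<dots> \<le> (\<integral>\<^sup>+c. \<integral>\<^sup>+y. indicator R c * (ennreal (cmod (f y)) * ?b y c) \<partial>lborel \<partial>lborel)"
  proof (rule nn_integral_mono)
    fix c
    have "ennreal (norm (heat_ext F t c)) \<le> (\<integral>\<^sup>+y. ennreal (cmod (f y)) * ?b y c \<partial>lborel)"
      unfolding pairing[OF t]
      using integral_norm_bound_ennreal[OF integrable_Lp_bessel_heat[OF t, of c]]
        bessel_heat_nonneg[OF s_pos t] by (simp add: norm_mult ennreal_mult)
    moreover have "(\<integral>\<^sup>+y. indicator R c * (ennreal (cmod (f y)) * ?b y c) \<partial>lborel)
        = indicator R c * (\<integral>\<^sup>+y. ennreal (cmod (f y)) * ?b y c \<partial>lborel)"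
      by (rule nn_integral_cmult) measurable
    ultimately show "ennreal (norm (indicator R c *\<^sub>R heat_ext F t c))
        \<le> (\<integral>\<^sup>+y. indicator R c * (ennreal (cmod (f y)) * ?b y c) \<partial>lborel)"
      by (simp add: indicator_def)
  qed
  also have "\<dots> = (\<integral>\<^sup>+y. \<integral>\<^sup>+c. indicator R c * (ennreal (cmod (f y)) * ?b y c) \<partial>lborel \<partial>lborel)"
    by (rule lborel_pair.Fubini') measurable
  also have "\<dots> = (\<integral>\<^sup>+y. ennreal m * (ennreal (cmod (f y)) * W y) \<partial>lborel)"
  proof (intro nn_integral_cong)
    fix y
    have "(\<integral>\<^sup>+c. indicator R c * (ennreal (cmod (f y)) * ?b y c) \<partial>lborel)
      = (\<integral>\<^sup>+c. ennreal (cmod (f y)) * (indicator R c * ?b y c) \<partial>lborel)"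
      by (simp only: mult_ac)
    also have "\<dots> = ennreal (cmod (f y)) * (\<integral>\<^sup>+c. indicator R c * ?b y c \<partial>lborel)"
      by (rule nn_integral_cmult) measurable
    also have "\<dots> = (ennreal (1 / m) * ennreal m) * (ennreal (cmod (f y)) * (\<integral>\<^sup>+c. indicator R c * ?b y c \<partial>lborel))"
      unfolding mm by simp
    finally show "(\<integral>\<^sup>+c. indicator R c * (ennreal (cmod (f y)) * ?b y c) \<partial>lborel)
        = ennreal m * (ennreal (cmod (f y)) * W y)"
      unfolding W_def by (simp only: mult_ac)
  qed
  also have "\<dots> = ennreal m * (\<integral>\<^sup>+y. ennreal (cmod (f y)) * W y \<partial>lborel)"
    by (rule nn_integral_cmult) measurable
  also have "\<dots> \<le> ennreal m * ennreal (2 * (1 / m) powr (1 / p) * N)"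
    using m by (intro mult_left_mono nn_integral_Lp_pairing p fp N W1 W2) auto
  also have "\<dots> = ennreal (2 * (m * (1 / m) powr (1 / p)) * N)"
    using m N0 by (simp add: ennreal_mult[symmetric] mult_ac)
  also have "m * (1 / m) powr (1 / p) = m powr (1 - 1 / p)"
    using m by (simp add: powr_divide powr_diff)
  finally show ?thesis
    using N0 by (subst (asm) ennreal_le_iff) auto
qed

end

text \<open>Half of the exponent stays in the doubled variance and the other half is estimated by
  exp (- u) <= 1 / u. The prefactor tends to 0 with V, while the remaining Gaussian still has mass
  one.\<close>

lemma gauss_tail_le:
  assumes "V > 0" "r > 0" "norm h > r"
  shows "gauss V h \<le> 8 * V / r\<^sup>2 * gauss (2 * V) h"
proof -
  define u where "u = (norm h)\<^sup>2 / (4 * V)"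
  have "norm h > 0" using assms by linarith
  then have u: "u > 0" using assms by (simp add: u_def)
  have "r\<^sup>2 \<le> (norm h)\<^sup>2" using assms by (intro power_mono) auto
  then have ru: "r\<^sup>2 / (4 * V) \<le> u" using assms by (simp add: u_def divide_right_mono)
  have "gauss V h = 2 * gauss (2 * V) h * exp (- u)"
    using assms by (simp add: gauss_def u_def exp_add[symmetric])
  also have "\<dots> \<le> 2 * gauss (2 * V) h * (4 * V / r\<^sup>2)"
  proof (intro mult_left_mono)
    have "exp (- u) \<le> 1 / u"
    proof -
      have "u \<le> exp u" using exp_ge_add_one_self[of u] by linarith
      then show ?thesis using u by (simp add: exp_minus field_simps)
    qed
    also have "\<dots> \<le> 1 / (r\<^sup>2 / (4 * V))" using ru assms u by (intro divide_left_mono) auto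
    finally show "exp (- u) \<le> 4 * V / r\<^sup>2" by simp
  qed (use assms in \<open>simp add: gauss_nonneg\<close>)
  finally show ?thesis by (simp add: mult_ac)
qed

lemma gauss_approximate_identity:
  fixes G :: "real \<times> real \<Rightarrow> complex"
  assumes [measurable]: "G \<in> borel_measurable borel" and K: "\<And>h. norm (G h) \<le> K" and G0: "isCont G 0"
  shows "((\<lambda>t. LINT h|lborel. of_real (gauss (2 * t) h) * G h) \<longlongrightarrow> G 0) (at_right 0)"
proof (rule tendstoI)
  fix e :: real assume e: "e > 0"
  have K0: "K \<ge> 0" using order_trans[OF norm_ge_zero K] .
  obtain r where r: "r > 0" and rG: "\<And>h. norm h \<le> r \<Longrightarrow> norm (G h - G 0) \<le> e / 2"
  proof -
    obtain d where "d > 0" "\<And>h. dist h 0 < d \<Longrightarrow> dist (G h) (G 0) < e / 2"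
      using G0 e unfolding continuous_at_eps_delta by (metis half_gt_zero)
    then show thesis by (intro that[of "d / 2"]) (auto simp: dist_norm intro: less_imp_le)
  qed
  \<comment> \<open>Makes the tail 32 K t / r^2 smaller than e / 2 for t < T; the added 1 covers K =
    0.\<close>
  define T where "T = e * r\<^sup>2 / (2 * (32 * K + 1))"
  have T: "T > 0" using e r K0 by (simp add: T_def)
  have "dist (LINT h|lborel. of_real (gauss (2 * t) h) * G h) (G 0) < e" if t: "0 < t" "t < T" for t
  proof -
    let ?g = "gauss (2 * t)" and ?g2 = "gauss (2 * (2 * t))"
    have ig: "integrable lborel ?g" "integrable lborel ?g2" using t by (auto intro!: integrable_gauss)
    have nn: "?g h \<ge> 0" "?g2 h \<ge> 0" for h using t by (auto intro!: gauss_nonneg)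
    have iG: "integrable lborel (\<lambda>h. of_real (?g h) * G h)"
    proof (rule Bochner_Integration.integrable_bound)
      show "integrable lborel (\<lambda>h. K * ?g h)" using ig by simp
      show "AE h in lborel. norm (of_real (?g h) * G h) \<le> norm (K * ?g h)"
        using K K0 nn by (auto simp: norm_mult abs_mult mult.commute intro!: mult_right_mono)
    qed measurable
    have i0: "integrable lborel (\<lambda>h. complex_of_real (?g h) * G 0)"
      using ig by (intro integrable_mult_left integrable_of_real)
    have "(LINT h|lborel. complex_of_real (?g h) * G 0) = G 0"
      using t by (simp add: integral_gauss)
    then have "(LINT h|lborel. of_real (?g h) * G h) - G 0 = (LINT h|lborel. of_real (?g h) * (G h - G 0))"
      using Bochner_Integration.integral_diff[OF iG i0] by (simp add: right_diff_distrib)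
    also have "norm \<dots> \<le> (LINT h|lborel. norm (of_real (?g h) * (G h - G 0)))"
      by (rule integral_norm_bound)
    also have "\<dots> \<le> (LINT h|lborel. e / 2 * ?g h + 2 * K * (16 * t / r\<^sup>2) * ?g2 h)"
    proof (rule integral_mono_AE)
      show "integrable lborel (\<lambda>h. norm (of_real (?g h) * (G h - G 0)))"
        using integrable_norm[OF Bochner_Integration.integrable_diff[OF iG i0]]
        by (simp add: right_diff_distrib)
      show "integrable lborel (\<lambda>h. e / 2 * ?g h + 2 * K * (16 * t / r\<^sup>2) * ?g2 h)"
        using ig by simp
      show "AE h in lborel. norm (of_real (?g h) * (G h - G 0)) \<le> e / 2 * ?g h + 2 * K * (16 * t / r\<^sup>2) * ?g2 h"
      proof (rule AE_I2)
        fix h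
        have eq: "norm (of_real (?g h) * (G h - G 0)) = ?g h * norm (G h - G 0)"
          using nn by (simp add: norm_mult)
        show "norm (of_real (?g h) * (G h - G 0)) \<le> e / 2 * ?g h + 2 * K * (16 * t / r\<^sup>2) * ?g2 h"
        proof (cases "norm h \<le> r")
          case True
          have "?g h * norm (G h - G 0) \<le> e / 2 * ?g h"
            using mult_left_mono[OF rG[OF True] nn(1)[of h]] by (simp only: mult.commute)
          moreover have "0 \<le> 2 * K * (16 * t / r\<^sup>2) * ?g2 h" using K0 t nn by simp
          ultimately show ?thesis unfolding eq by linarith
        next
          case False
          have "norm (G h - G 0) \<le> 2 * K"
            using norm_triangle_ineq4[of "G h" "G 0"] K[of h] K[of 0] by linarith
          moreover have "?g h \<le> 8 * (2 * t) / r\<^sup>2 * ?g2 h"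
            using False t r by (intro gauss_tail_le) auto
          ultimately have "?g h * norm (G h - G 0) \<le> (8 * (2 * t) / r\<^sup>2 * ?g2 h) * (2 * K)"
            using nn K0 t by (intro mult_mono) auto
          moreover have "0 \<le> e / 2 * ?g h" using e nn by simp
          ultimately show ?thesis unfolding eq by (simp add: mult_ac)
        qed
      qed
    qed
    also have "\<dots> = e / 2 + 32 * K * t / r\<^sup>2"
      using ig t by (simp add: integral_gauss)
    also have "\<dots> < e"
    proof -
      have "32 * K * t \<le> (32 * K + 1) * t" using t by (simp add: algebra_simps)
      also have "\<dots> < (32 * K + 1) * T" using t K0 by (intro mult_strict_left_mono) auto
      also have "\<dots> = e * r\<^sup>2 / 2" using K0 by (simp add: T_def field_simps)
      finally show ?thesis using r by (simp add: field_simps)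
    qed
    finally show ?thesis by (simp add: dist_norm)
  qed
  then show "eventually (\<lambda>t. dist (LINT h|lborel. of_real (gauss (2 * t) h) * G h) (G 0) < e) (at_right 0)"
    using T by (auto simp: eventually_at_right)
qed

section \<open>Integrals over translates of a convex set\<close>

lemma le_one_add_powr: "p \<ge> 1 \<Longrightarrow> x \<ge> 0 \<Longrightarrow> x \<le> 1 + x powr p" for x p :: real
  using le_add_powr[of x 1 p] by simp

lemma integrable_Lp_bounded:
  fixes F :: "real \<times> real \<Rightarrow> complex"
  assumes p: "p \<ge> 1" and [measurable]: "F \<in> borel_measurable borel"
    and Fp: "integrable lborel (\<lambda>z. cmod (F z) powr p)"
    and [measurable]: "A \<in> sets borel" and A: "bounded A"
  shows "integrable lborel (\<lambda>c. indicator A c *\<^sub>R F c)"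
proof (rule Bochner_Integration.integrable_bound)
  show "integrable lborel (\<lambda>c. indicator A c + cmod (F c) powr p)"
    by (intro Bochner_Integration.integrable_add Fp integrable_real_indicator emeasure_bounded_finite A) measurable
  show "AE c in lborel. norm (indicator A c *\<^sub>R F c) \<le> norm (indicator A c + cmod (F c) powr p)"
    by (intro AE_I2) (auto simp: indicator_def intro: le_one_add_powr[OF p])
qed measurable

text \<open>The integral of F over the translate R + h. Smoothing F and then integrating over R
  amounts to averaging these numbers in h.\<close>

definition shifted_integral ::
    "(real \<times> real \<Rightarrow> complex) \<Rightarrow> (real \<times> real) set \<Rightarrow> real \<times> real \<Rightarrow> complex" where
  "shifted_integral F R h = (LINT c|lborel. indicator R c *\<^sub>R F (c + h))"

context
  fixes F :: "real \<times> real \<Rightarrow> complex" and p :: real and R :: "(real \<times> real) set"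
  assumes p: "p \<ge> 1" and F [measurable]: "F \<in> borel_measurable borel"
    and Fp: "integrable lborel (\<lambda>z. cmod (F z) powr p)"
    and R [measurable]: "R \<in> sets borel" and bR: "bounded R" and cR: "convex R"
begin

lemma integrable_indicator_bounded: "integrable lborel (indicator R :: _ \<Rightarrow> real)"
  by (intro integrable_real_indicator emeasure_bounded_finite bR) measurable

lemma integral_norm_shift_le:
  "integrable lborel (\<lambda>c. indicator R c *\<^sub>R F (c + h))" (is ?I)
  "(LINT c|lborel. norm (indicator R c *\<^sub>R F (c + h))) \<le> measure lborel R + (LINT z|lborel. cmod (F z) powr p)" (is ?L)
proof -
  have i: "integrable lborel (\<lambda>c. cmod (F (c + h)) powr p)"
    using integrable_distr[of "(+) h" lborel borel "\<lambda>c. cmod (F c) powr p"] Fp lborel_distr_plus[of h]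
    by (simp add: add.commute)
  have i2: "integrable lborel (\<lambda>c. indicator R c + cmod (F (c + h)) powr p)"
    by (intro Bochner_Integration.integrable_add integrable_indicator_bounded i)
  show ?I
  proof (rule Bochner_Integration.integrable_bound[OF i2])
    show "AE c in lborel. norm (indicator R c *\<^sub>R F (c + h)) \<le> norm (indicator R c + cmod (F (c + h)) powr p)"
      by (intro AE_I2) (auto simp: indicator_def intro: le_one_add_powr[OF p])
  qed measurable
  then have "(LINT c|lborel. norm (indicator R c *\<^sub>R F (c + h))) \<le> (LINT c|lborel. indicator R c + cmod (F (c + h)) powr p)"
    by (rule integral_mono_AE[OF integrable_norm i2])
       (auto intro!: AE_I2 simp: indicator_def intro: le_one_add_powr[OF p])
  also have "\<dots> = measure lborel R + (LINT z|lborel. cmod (F z) powr p)"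
    using lborel_integral_translate[of "\<lambda>z. cmod (F z) powr p" h]
    by (subst Bochner_Integration.integral_add[OF integrable_indicator_bounded i]) (simp add: add.commute)
  finally show ?L .
qed

lemma shifted_integral_measurable: "shifted_integral F R \<in> borel_measurable borel"
  unfolding shifted_integral_def by measurable

lemma norm_shifted_integral_le: "norm (shifted_integral F R h) \<le> measure lborel R + (LINT z|lborel. cmod (F z) powr p)"
  unfolding shifted_integral_def using integral_norm_bound integral_norm_shift_le(2) by (rule order_trans)

text \<open>This is the role of convexity: off the frontier, membership in R is stable under small
  translations, and the frontier of a convex set is null.\<close>

lemma AE_not_frontier: "AE c in lborel. c \<notin> frontier R"
proof -
  have "frontier R \<in> null_sets lebesgue"
    using negligible_convex_frontier[OF cR] by (simp add: negligible_iff_null_sets)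
  moreover have "frontier R \<in> sets lborel" by simp
  ultimately have "frontier R \<in> null_sets lborel" by (simp add: null_sets_completion_iff)
  then show ?thesis by (rule AE_not_in)
qed

lemma shifted_integral_alt: "shifted_integral F R h = (LINT c|lborel. indicator R (c - h) *\<^sub>R F c)"
  unfolding shifted_integral_def
  using lborel_integral_translate[of "\<lambda>c. indicator R (c - h) *\<^sub>R F c" h] by (simp add: add.commute)

text \<open>After a change of variables F stays fixed and the indicator moves, so dominated
  convergence applies to a discontinuous F.\<close>

lemma isCont_shifted_integral: "isCont (shifted_integral F R) 0"
  unfolding continuous_at_sequentially o_def
proof (intro allI impI)
  fix h :: "nat \<Rightarrow> real \<times> real" assume h: "h \<longlonglongrightarrow> 0"
  obtain M where M: "\<And>n. norm (h n) \<le> M"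
    using convergent_imp_Bseq[OF convergentI[OF h]] by (auto simp: Bseq_def)
  obtain B where B: "\<And>c. c \<in> R \<Longrightarrow> norm c \<le> B" using bR by (auto simp: bounded_iff)
  \<comment> \<open>A ball containing all the translates of R by \<open>h n\<close>; F is integrable
    on it and dominates there.\<close>
  let ?A = "cball 0 (B + M) :: (real \<times> real) set"
  have "(\<lambda>n. LINT c|lborel. indicator R (c - h n) *\<^sub>R F c) \<longlonglongrightarrow> (LINT c|lborel. indicator R (c - 0) *\<^sub>R F c)"
  proof (rule integral_dominated_convergence)
    show "integrable lborel (\<lambda>c. norm (indicator ?A c *\<^sub>R F c))"
      by (intro integrable_norm integrable_Lp_bounded[OF p F Fp]) auto
    show "AE c in lborel. norm (indicator R (c - h n) *\<^sub>R F c) \<le> norm (indicator ?A c *\<^sub>R F c)" for n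
    proof (rule AE_I2)
      fix c
      have "c \<in> ?A" if "c - h n \<in> R"
        using B[OF that] M[of n] norm_triangle_ineq[of "c - h n" "h n"] by simp
      then show "norm (indicator R (c - h n) *\<^sub>R F c) \<le> norm (indicator ?A c *\<^sub>R F c)"
        by (auto simp: indicator_def)
    qed
    show "AE c in lborel. (\<lambda>n. indicator R (c - h n) *\<^sub>R F c) \<longlonglongrightarrow> indicator R (c - 0) *\<^sub>R F c"
      using AE_not_frontier
    proof eventually_elim
      case (elim c)
      have lim: "(\<lambda>n. c - h n) \<longlonglongrightarrow> c" using tendsto_diff[OF tendsto_const h, of c] by simp
      have "eventually (\<lambda>n. indicator R (c - h n) *\<^sub>R F c = indicator R (c - 0) *\<^sub>R F c) sequentially"
      proof (cases "c \<in> interior R")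
        case True
        then have "eventually (\<lambda>n. c - h n \<in> interior R) sequentially"
          by (intro topological_tendstoD[OF lim]) auto
        then show ?thesis
          by eventually_elim (use True interior_subset[of R] in \<open>auto simp: indicator_def\<close>)
      next
        case False
        then have "c \<in> - closure R" using elim by (auto simp: frontier_def)
        then have "eventually (\<lambda>n. c - h n \<in> - closure R) sequentially"
          by (intro topological_tendstoD[OF lim]) auto
        then show ?thesis
          by eventually_elim (use \<open>c \<in> - closure R\<close> closure_subset[of R] in \<open>auto simp: indicator_def\<close>)
      qed
      then show ?case by (rule tendsto_eventually)
    qed
  qed measurable
  then show "(\<lambda>n. shifted_integral F R (h n)) \<longlonglongrightarrow> shifted_integral F R 0"
    by (simp only: shifted_integral_alt)
qed

lemma set_integral_heat_ext:
  assumes t: "t > 0"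
  shows "(LINT c:R|lborel. heat_ext F t c) = (LINT h|lborel. of_real (gauss (2 * t) h) * shifted_integral F R h)"
proof -
  let ?g = "gauss (2 * t)" and ?K = "measure lborel R + (LINT z|lborel. cmod (F z) powr p)"
  let ?f = "\<lambda>h c. indicator R c *\<^sub>R (F (c + h) * complex_of_real (?g h))"
  have nn: "?g h \<ge> 0" for h using t by (intro gauss_nonneg) auto
  have eq: "?f h c = of_real (?g h) * (indicator R c *\<^sub>R F (c + h))" for h c
    by (simp add: scaleR_conv_of_real)
  have "integrable (lborel \<Otimes>\<^sub>M lborel) (\<lambda>(h, c). ?f h c)"
  proof (rule lborel_pair.Fubini_integrable)
    show "(\<lambda>(h, c). ?f h c) \<in> borel_measurable (lborel \<Otimes>\<^sub>M lborel)" by measurable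
    show "integrable lborel (\<lambda>h. LINT c|lborel. norm (case (h, c) of (h, c) \<Rightarrow> ?f h c))"
    proof (rule Bochner_Integration.integrable_bound)
      show "integrable lborel (\<lambda>h. ?K * ?g h)" using t by (intro integrable_mult_right integrable_gauss) auto
      show "AE h in lborel. norm (LINT c|lborel. norm (case (h, c) of (h, c) \<Rightarrow> ?f h c)) \<le> norm (?K * ?g h)"
      proof (rule AE_I2)
        fix h
        have "(LINT c|lborel. norm (?f h c)) = ?g h * (LINT c|lborel. norm (indicator R c *\<^sub>R F (c + h)))"
          using nn[of h] by (simp add: norm_mult mult_ac flip: integral_mult_right_zero)
        also have "\<dots> \<le> ?g h * ?K"
          by (intro mult_left_mono integral_norm_shift_le nn)
        finally have le: "(LINT c|lborel. norm (?f h c)) \<le> ?g h * ?K" .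
        have "0 \<le> (LINT c|lborel. norm (?f h c))" by (rule integral_nonneg_AE) (rule AE_I2, rule norm_ge_zero)
        then show "norm (LINT c|lborel. norm (case (h, c) of (h, c) \<Rightarrow> ?f h c)) \<le> norm (?K * ?g h)"
          using le unfolding prod.case real_norm_def by (simp only: abs_of_nonneg mult.commute)
      qed
    qed measurable
    show "AE h in lborel. integrable lborel (\<lambda>c. case (h, c) of (h, c) \<Rightarrow> ?f h c)"
      unfolding prod.case eq by (intro AE_I2 integrable_mult_right integral_norm_shift_le)
  qed
  note swap = lborel_pair.Fubini_integral[OF this]
  have "heat_ext F t c = (LINT h|lborel. F (c + h) * complex_of_real (?g h))" for c
    unfolding heat_ext_def
    using lborel_integral_translate[of "\<lambda>y. F y * complex_of_real (?g (y - c))" c] by simp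
  then have "(LINT c:R|lborel. heat_ext F t c) = (LINT c|lborel. LINT h|lborel. ?f h c)"
    unfolding set_lebesgue_integral_def by simp
  also have "\<dots> = (LINT h|lborel. LINT c|lborel. ?f h c)" by (rule swap)
  also have "\<dots> = (LINT h|lborel. of_real (?g h) * shifted_integral F R h)"
    unfolding eq shifted_integral_def by (simp only: integral_mult_right_zero)
  finally show ?thesis .
qed

text \<open>Fubini moves the smoothing from F to the translation variable, and there the function to
  be smoothed is bounded and continuous at 0.\<close>

proposition heat_ext_set_integral_tendsto:
  "((\<lambda>t. LINT c:R|lborel. heat_ext F t c) \<longlongrightarrow> (LINT c:R|lborel. F c)) (at_right 0)"
proof -
  have "((\<lambda>t. LINT h|lborel. of_real (gauss (2 * t) h) * shifted_integral F R h) \<longlongrightarrow> shifted_integral F R 0) (at_right 0)"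
    by (rule gauss_approximate_identity[OF shifted_integral_measurable norm_shifted_integral_le isCont_shifted_integral])
  moreover have "shifted_integral F R 0 = (LINT c:R|lborel. F c)"
    by (simp add: shifted_integral_def set_lebesgue_integral_def)
  moreover have "eventually (\<lambda>t. (LINT h|lborel. of_real (gauss (2 * t) h) * shifted_integral F R h)
      = (LINT c:R|lborel. heat_ext F t c)) (at_right 0)"
    by (rule eventually_mono[OF eventually_at_right_less]) (simp add: set_integral_heat_ext)
  ultimately show ?thesis by (simp cong: tendsto_cong) (metis (mono_tags, lifting) tendsto_cong)
qed

end

section \<open>Averages of a Bessel potential over convex sets\<close>

text \<open>The function spaces are defined with the completed measure, whereas the Fubini arguments
  run on Borel products; all estimates are therefore made for a Borel representative.\<close>

lemma lebesgue_borel_modification: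
  fixes f :: "real \<times> real \<Rightarrow> complex"
  assumes "f \<in> borel_measurable lebesgue"
  obtains g where "g \<in> borel_measurable borel" "AE z in lebesgue. f z = g z"
proof -
  have "(\<lambda>z. Re (f z)) \<in> borel_measurable lebesgue" "(\<lambda>z. Im (f z)) \<in> borel_measurable lebesgue"
    using assms by measurable
  then obtain u v where uv [measurable]: "u \<in> borel_measurable borel" "v \<in> borel_measurable borel"
    and ae: "AE z in lborel. Re (f z) = u z" "AE z in lborel. Im (f z) = v z"
    using completion_ex_borel_measurable_real[of "\<lambda>z. Re (f z)" lborel]
      completion_ex_borel_measurable_real[of "\<lambda>z. Im (f z)" lborel] by auto
  show thesis
  proof
    show "(\<lambda>z. Complex (u z) (v z)) \<in> borel_measurable borel"
      unfolding Complex_eq by measurable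
    show "AE z in lebesgue. f z = Complex (u z) (v z)"
      using AE_completion[OF ae(1)] AE_completion[OF ae(2)] by eventually_elim (simp add: complex_eq_iff)
  qed
qed

lemma integral_lebesgue_modification:
  fixes f g :: "'a::euclidean_space \<Rightarrow> 'b::{banach, second_countable_topology}"
  assumes "f \<in> borel_measurable lebesgue" "g \<in> borel_measurable borel" "AE z in lebesgue. f z = g z"
  shows "integral\<^sup>L lebesgue f = integral\<^sup>L lborel g" "integrable lebesgue f \<longleftrightarrow> integrable lborel g"
proof -
  have g: "g \<in> borel_measurable lebesgue" using assms(2) by (simp add: measurable_completion)
  show "integral\<^sup>L lebesgue f = integral\<^sup>L lborel g"
    using integral_cong_AE[OF assms(1) g assms(3)] integral_completion[of g lborel] assms(2) by simp
  show "integrable lebesgue f \<longleftrightarrow> integrable lborel g"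
    using integrable_cong_AE[OF assms(1) g assms(3)] integrable_completion[of g lborel] assms(2) by simp
qed

definition mean_value :: "(real \<times> real \<Rightarrow> complex) \<Rightarrow> (real \<times> real) set \<Rightarrow> complex" where
  "mean_value F R = (LINT z:R|lborel. F z) / of_real (measure lborel R)"

text \<open>Wide enough for both the half-open dyadic rectangles and the closed squares of the
  differentiation theorem.\<close>

definition convex_body :: "(real \<times> real) set \<Rightarrow> bool" where
  "convex_body R \<longleftrightarrow> R \<in> sets borel \<and> bounded R \<and> convex R \<and> measure lborel R > 0"

lemma norm_mean_value_diff_le:
  assumes R: "convex_body R" and u: "set_integrable lborel R u"
    and E: "\<And>c. c \<in> R \<Longrightarrow> norm (u c - v) \<le> E"
  shows "norm (mean_value u R - v) \<le> E"
proof -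
  have [measurable]: "R \<in> sets borel" and m: "measure lborel R > 0" and fin: "emeasure lborel R < \<infinity>"
    using R emeasure_bounded_finite[of R] by (auto simp: convex_body_def)
  have iv: "set_integrable lborel R (\<lambda>_. k)" for k :: complex
    using fin by (intro integrable_real_indicator integrable_scaleR_left | simp add: set_integrable_def)+
  have ir: "set_integrable lborel R (\<lambda>_. k)" for k :: real
    using fin by (intro integrable_real_indicator integrable_scaleR_left | simp add: set_integrable_def)+
  have R0: "(LINT c:R|lborel. E) = measure lborel R * E" "(LINT c:R|lborel. v) = of_real (measure lborel R) * v"
    using fin by (simp_all add: set_lebesgue_integral_def scaleR_conv_of_real)
  have "mean_value u R - v = (LINT c:R|lborel. u c - v) / of_real (measure lborel R)"
    using m by (simp add: mean_value_def set_integral_diff[OF u iv] R0 field_simps)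
  also have "norm \<dots> \<le> (LINT c:R|lborel. norm (u c - v)) / measure lborel R"
    using m set_integral_norm_bound[OF set_integral_diff(1)[OF u iv]]
    by (simp add: norm_divide divide_right_mono)
  also have "\<dots> \<le> (LINT c:R|lborel. E) / measure lborel R"
    using m E by (intro divide_right_mono set_integral_mono ir set_integrable_norm set_integral_diff u iv) auto
  also have "\<dots> = E" using m by (simp add: R0)
  finally show ?thesis .
qed

text \<open>The estimate against a fixed value is used twice: first the value of u at a point of Q,
  then the mean over R.\<close>

lemma norm_mean_value_diff_le2:
  assumes R: "convex_body R" and Q: "convex_body Q" and u: "continuous_on UNIV u"
    and E: "\<And>c c'. c \<in> R \<Longrightarrow> c' \<in> Q \<Longrightarrow> norm (u c - u c') \<le> E"
  shows "norm (mean_value u R - mean_value u Q) \<le> E"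
proof -
  have si: "set_integrable lborel A u" if "convex_body A" for A
  proof (rule set_integrable_subset)
    show "set_integrable lborel (closure A) u"
      unfolding set_integrable_def using that u
      by (intro borel_integrable_compact) (auto simp: convex_body_def intro: continuous_on_subset)
  qed (use that closure_subset in \<open>auto simp: convex_body_def\<close>)
  have "norm (mean_value u Q - mean_value u R) \<le> E"
  proof (rule norm_mean_value_diff_le[OF Q si[OF Q]])
    fix c assume c: "c \<in> Q"
    have "norm (mean_value u R - u c) \<le> E"
      by (rule norm_mean_value_diff_le[OF R si[OF R] E[OF _ c]])
    then show "norm (u c - mean_value u R) \<le> E" by (simp add: norm_minus_commute)
  qed
  then show ?thesis by (simp add: norm_minus_commute)
qed

text \<open>Both estimates hold for the heat extension with constants free of t, and both survive
  the limit t -> 0 because the averages converge. C and \<gamma> are fixed before F and depend on s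
  and p alone.\<close>

proposition bessel_potential_means:
  assumes p: "p > 1" and s: "s > 2 / p"
  obtains C \<gamma> where "C \<ge> 0" "\<gamma> > 0"
    "\<And>F. F \<in> sobolev s p \<Longrightarrow> \<exists>G\<in>borel_measurable borel. (AE z in lebesgue. F z = G z) \<and>
      (\<forall>A\<in>sets borel. bounded A \<longrightarrow> set_integrable lborel A G) \<and>
      (\<forall>R. convex_body R \<longrightarrow> norm (mean_value G R) \<le> C * sobolev_norm s p F * measure lborel R powr (- 1 / p)) \<and>
      (\<forall>R Q d. convex_body R \<longrightarrow> convex_body Q \<longrightarrow> (\<forall>c\<in>R. \<forall>c'\<in>Q. norm (c - c') \<le> d) \<longrightarrow>
        norm (mean_value G R - mean_value G Q) \<le> C * sobolev_norm s p F * d powr \<gamma>)"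
proof
  \<comment> \<open>Half of the gap s - 2 / p keeps the inequality strict, as the negative moment
    requires; the cap 1 comes from the bound for Gaussian differences.\<close>
  define \<gamma> where "\<gamma> = min 1 ((s - 2 / p) / 2)"
  define J where "J = (LINT \<tau>|bessel_measure s. \<tau> powr (- \<gamma> / 2 - 1 / p))"
  \<comment> \<open>One constant for both estimates: 2 from the size of averages, the rest from the
    Hoelder bound.\<close>
  define C where "C = 2 + 4 * exp 5 * J"
  have "2 / p > 0" using p by simp
  then have s0: "s > 0" using s by linarith
  have J0: "J \<ge> 0" unfolding J_def by simp
  have \<gamma>: "0 < \<gamma>" "\<gamma> \<le> 1" "\<gamma> < s - 2 / p" using s by (auto simp: \<gamma>_def min_def)
  show "\<gamma> > 0" by fact
  show "C \<ge> 0" using J0 by (simp add: C_def)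
  fix F assume F: "F \<in> sobolev s p"
  \<comment> \<open>The same choice as in \<open>sobolev_norm\<close>, so that the L^p norm of f is
    the Sobolev norm by definition.\<close>
  define f where "f = (SOME f. f \<in> Lp_space p \<and> has_bessel_power s F f)"
  have f: "f \<in> Lp_space p" "has_bessel_power s F f"
    using someI_ex[of "\<lambda>f. f \<in> Lp_space p \<and> has_bessel_power s F f"] F
    unfolding f_def sobolev_def by auto
  have S: "sobolev_norm s p F = Lp_norm p f" by (simp add: sobolev_norm_def f_def)
  have meas: "F \<in> borel_measurable lebesgue" "f \<in> borel_measurable lebesgue"
    using F f by (auto simp: sobolev_def Lp_space_def)
  obtain G where G [measurable]: "G \<in> borel_measurable borel" and FG: "AE z in lebesgue. F z = G z"
    using lebesgue_borel_modification[OF meas(1)] .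
  obtain g where g [measurable]: "g \<in> borel_measurable borel" and fg: "AE z in lebesgue. f z = g z"
    using lebesgue_borel_modification[OF meas(2)] .
  have powr_m: "(\<lambda>z. cmod (h z) powr p) \<in> borel_measurable lebesgue" if "h \<in> borel_measurable lebesgue"
    for h :: "real \<times> real \<Rightarrow> complex"
    using that by measurable
  have Gp: "integrable lborel (\<lambda>z. cmod (G z) powr p)"
  proof (subst integral_lebesgue_modification(2)[symmetric])
    show "integrable lebesgue (\<lambda>z. cmod (F z) powr p)" using F by (simp add: sobolev_def Lp_space_def)
    show "AE z in lebesgue. cmod (F z) powr p = cmod (G z) powr p" using FG by eventually_elim simp
  qed (use powr_m meas in auto)
  have gae: "AE z in lebesgue. cmod (f z) powr p = cmod (g z) powr p" using fg by eventually_elim simp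
  have gp: "integrable lborel (\<lambda>z. cmod (g z) powr p)"
    using f integral_lebesgue_modification(2)[OF powr_m[OF meas(2)] _ gae] by (simp add: Lp_space_def)
  define N where "N = Lp_norm p f"
  have N: "N = (LINT z|lborel. cmod (g z) powr p) powr (1 / p)"
    using integral_lebesgue_modification(1)[OF powr_m[OF meas(2)] _ gae] by (simp add: N_def Lp_norm_def)
  have N0: "N \<ge> 0" using N by simp
  have pairing: "heat_ext G t c = (LINT y|lborel. g y * complex_of_real (bessel_heat s t (y - c)))"
    if t: "t > 0" for t c
  proof -
    note [measurable] = bessel_heat_measurable[OF s0]
    let ?\<phi> = "\<lambda>z. complex_of_real (bessel_heat s t (z - c))"
    have m\<phi>: "?\<phi> \<in> borel_measurable lborel" "(\<lambda>z. complex_of_real (gauss (2 * t) (z - c))) \<in> borel_measurable lborel"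
      by measurable
    note m\<phi>' = m\<phi>[THEN measurable_completion]
    have "(LINT z|lebesgue. f z * ?\<phi> z) = (LINT z|lebesgue. F z * bessel_op s ?\<phi> z)"
      by (rule bspec[OF f(2)[unfolded has_bessel_power_def] bessel_heat_schwartz[OF s0 t]])
    also have "(LINT z|lebesgue. F z * bessel_op s ?\<phi> z) = (LINT z|lebesgue. F z * complex_of_real (gauss (2 * t) (z - c)))"
      by (simp only: bessel_op_bessel_heat[OF s0 t])
    also have "\<dots> = heat_ext G t c"
      unfolding heat_ext_def
    proof (rule integral_lebesgue_modification)
      show "(\<lambda>z. F z * complex_of_real (gauss (2 * t) (z - c))) \<in> borel_measurable lebesgue"
        using meas(1) m\<phi>'(2) by measurable
      show "AE z in lebesgue. F z * complex_of_real (gauss (2 * t) (z - c)) = G z * complex_of_real (gauss (2 * t) (z - c))"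
        using FG by eventually_elim simp
    qed measurable
    also have "(LINT z|lebesgue. f z * ?\<phi> z) = (LINT z|lborel. g z * ?\<phi> z)"
    proof (rule integral_lebesgue_modification)
      show "(\<lambda>z. f z * ?\<phi> z) \<in> borel_measurable lebesgue"
        using meas(2) m\<phi>'(1) by measurable
      show "AE z in lebesgue. f z * ?\<phi> z = g z * ?\<phi> z"
        using fg by eventually_elim simp
    qed measurable
    finally show ?thesis by simp
  qed
  have mean_lim: "((\<lambda>t. mean_value (heat_ext G t) R) \<longlongrightarrow> mean_value G R) (at_right 0)" if "convex_body R" for R
    unfolding mean_value_def using that p
    by (intro tendsto_divide tendsto_const heat_ext_set_integral_tendsto[of p] G Gp) (auto simp: convex_body_def)
  have si: "set_integrable lborel A G" if "A \<in> sets borel" "bounded A" for A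
    unfolding set_integrable_def using that p by (intro integrable_Lp_bounded[OF _ G Gp]) auto
  have m1: "norm (mean_value G R) \<le> C * N * measure lborel R powr (- 1 / p)" if R: "convex_body R" for R
  proof (rule tendsto_upperbound[OF tendsto_norm[OF mean_lim[OF R]]])
    let ?m = "measure lborel R"
    have m: "?m > 0" and Rm: "R \<in> sets borel" and "bounded R"
      using R by (auto simp: convex_body_def)
    then have em: "emeasure lborel R = ennreal ?m"
      using emeasure_bounded_finite[of R] by (intro emeasure_eq_ennreal_measure) auto
    have "norm (mean_value (heat_ext G t) R) \<le> C * N * ?m powr (- 1 / p)" if t: "t > 0" for t
    proof -
      have "norm (mean_value (heat_ext G t) R) \<le> (2 * ?m powr (1 - 1 / p) * N) / ?m"
        unfolding mean_value_def norm_divide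
        using m heat_ext_set_integral_le[OF p s g gp N pairing t Rm em m]
        by (simp add: divide_right_mono)
      also have "\<dots> = 2 * N * ?m powr (- 1 / p)"
        using m by (simp add: powr_diff powr_minus field_simps)
      also have "\<dots> \<le> C * N * ?m powr (- 1 / p)"
        using N0 J0 by (intro mult_right_mono) (auto simp: C_def)
      finally show ?thesis .
    qed
    then show "\<forall>\<^sub>F t in at_right 0. norm (mean_value (heat_ext G t) R) \<le> C * N * ?m powr (- 1 / p)"
      by (auto intro: eventually_mono[OF eventually_at_right_less])
  qed auto
  have m2: "norm (mean_value G R - mean_value G Q) \<le> C * N * d powr \<gamma>"
    if R: "convex_body R" and Q: "convex_body Q" and d: "\<And>c c'. c \<in> R \<Longrightarrow> c' \<in> Q \<Longrightarrow> norm (c - c') \<le> d" for R Q d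
  proof (rule tendsto_upperbound[OF tendsto_norm[OF tendsto_diff[OF mean_lim[OF R] mean_lim[OF Q]]]])
    have "norm (mean_value (heat_ext G t) R - mean_value (heat_ext G t) Q) \<le> C * N * d powr \<gamma>" if t: "t > 0" for t
    proof -
      have H: "norm (heat_ext G t c - heat_ext G t c') \<le> C * N * norm (c - c') powr \<gamma>" for c c'
      proof -
        have "norm (heat_ext G t c - heat_ext G t c') \<le> 4 * exp 5 * J * norm (c - c') powr \<gamma> * N"
          unfolding J_def by (rule heat_ext_hoelder[OF p s g gp N pairing t \<gamma>])
        also have "\<dots> = (4 * exp 5 * J) * N * norm (c - c') powr \<gamma>" by (simp only: mult_ac)
        also have "\<dots> \<le> C * N * norm (c - c') powr \<gamma>"
          using N0 by (intro mult_right_mono) (auto simp: C_def)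
        finally show ?thesis .
      qed
      \<comment> \<open>The Hoelder bound also supplies the continuity that makes the heat extension
        integrable on bounded sets.\<close>
      have "isCont (heat_ext G t) c" for c
        unfolding isCont_def
      proof (rule LIM_zero_cancel, rule Lim_null_comparison)
        show "eventually (\<lambda>c'. norm (heat_ext G t c' - heat_ext G t c) \<le> C * N * norm (c' - c) powr \<gamma>) (at c)"
          using H by simp
        have "((\<lambda>c'. norm (c' - c)) \<longlongrightarrow> 0) (at c)" by (auto intro!: tendsto_eq_intros)
        then have "((\<lambda>c'. C * N * norm (c' - c) powr \<gamma>) \<longlongrightarrow> C * N * 0) (at c)"
          using \<gamma> by (intro tendsto_mult tendsto_const tendsto_zero_powrI[where b = \<gamma>]) auto
        then show "((\<lambda>c'. C * N * norm (c' - c) powr \<gamma>) \<longlongrightarrow> 0) (at c)" by simp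
      qed
      then have "continuous_on UNIV (heat_ext G t)" by (simp add: continuous_at_imp_continuous_on)
      then show ?thesis
      proof (rule norm_mean_value_diff_le2[OF R Q])
        fix c c' assume c: "c \<in> R" "c' \<in> Q"
        have "C * N * norm (c - c') powr \<gamma> \<le> C * N * d powr \<gamma>"
          using d[OF c] N0 J0 \<gamma> by (intro mult_left_mono powr_mono2) (auto simp: C_def)
        then show "norm (heat_ext G t c - heat_ext G t c') \<le> C * N * d powr \<gamma>"
          using H[of c c'] by linarith
      qed
    qed
    then show "\<forall>\<^sub>F t in at_right 0. norm (mean_value (heat_ext G t) R - mean_value (heat_ext G t) Q) \<le> C * N * d powr \<gamma>"
      by (auto intro: eventually_mono[OF eventually_at_right_less])
  qed auto
  show "\<exists>G\<in>borel_measurable borel. (AE z in lebesgue. F z = G z) \<and>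
      (\<forall>A\<in>sets borel. bounded A \<longrightarrow> set_integrable lborel A G) \<and>
      (\<forall>R. convex_body R \<longrightarrow> norm (mean_value G R) \<le> C * sobolev_norm s p F * measure lborel R powr (- 1 / p)) \<and>
      (\<forall>R Q d. convex_body R \<longrightarrow> convex_body Q \<longrightarrow> (\<forall>c\<in>R. \<forall>c'\<in>Q. norm (c - c') \<le> d) \<longrightarrow>
        norm (mean_value G R - mean_value G Q) \<le> C * sobolev_norm s p F * d powr \<gamma>)"
    unfolding S N_def[symmetric]
    by (intro bexI[OF _ G] conjI ballI allI impI FG si m1 m2) auto
qed

section \<open>Orthonormality of the Haar systems\<close>

lemma haar_interval:
  assumes "a < b"
  shows "haar {a..<b} x = (b - a) powr (-1/2) *
    (indicator {a..<(a + b) / 2} x - indicator {(a + b) / 2..<b} x)"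
  using assms by (simp add: haar_def Let_def)

lemma haar_measurable [measurable]: "haar I \<in> borel_measurable borel"
  unfolding haar_def Let_def by measurable

lemma haar_eq_0: "a < b \<Longrightarrow> x \<notin> {a..<b} \<Longrightarrow> haar {a..<b} x = 0"
  by (auto simp: haar_interval indicator_def)

lemma abs_haar_le: "a < b \<Longrightarrow> \<bar>haar {a..<b} x\<bar> \<le> (b - a) powr (-1/2) * indicator {a..<b} x"
  by (auto simp: haar_interval indicator_def)

lemma integral_haar:
  assumes "a < b"
  shows "integrable lborel (haar {a..<b})" "(LINT x|lborel. haar {a..<b} x) = 0"
    "(LINT x|lborel. haar {a..<b} x * haar {a..<b} x) = 1"
proof -
  let ?m = "(a + b) / 2"
  have am: "a < ?m" "?m < b" using assms by auto
  have i: "integrable lborel (indicator {u..<v} :: real \<Rightarrow> real)" for u v :: real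
    by (intro integrable_real_indicator emeasure_bounded_finite) auto
  have I: "(LINT x|lborel. indicator {u..<v} x) = v - u" if "u < v" for u v :: real
    using that by simp
  show "integrable lborel (haar {a..<b})"
    unfolding haar_interval[OF assms, abs_def]
    by (intro integrable_mult_right Bochner_Integration.integrable_diff i)
  have "(LINT x|lborel. haar {a..<b} x) = (b - a) powr (-1/2) * ((?m - a) - (b - ?m))"
    unfolding haar_interval[OF assms] integral_mult_right_zero
    by (subst Bochner_Integration.integral_diff[OF i i]) (simp only: I[OF am(1)] I[OF am(2)])
  then show "(LINT x|lborel. haar {a..<b} x) = 0" by (simp add: field_simps)
  have "haar {a..<b} x * haar {a..<b} x = (b - a) powr (-1) * indicator {a..<b} x" for x
  proof -
    have "(b - a) powr (-1/2) * (b - a) powr (-1/2) = (b - a) powr (-1)"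
      by (simp add: powr_add[symmetric])
    then show ?thesis using assms by (auto simp: haar_interval indicator_def)
  qed
  then have "(LINT x|lborel. haar {a..<b} x * haar {a..<b} x) = (b - a) powr (-1) * (b - a)"
    using assms by simp
  then show "(LINT x|lborel. haar {a..<b} x * haar {a..<b} x) = 1"
    using assms by (simp add: powr_minus field_simps)
qed

text \<open>If no breakpoint of the first function lies inside the second interval, that function is
  constant there, and the second function has mean zero.\<close>

lemma haar_orthogonal_aligned:
  assumes ab: "a < b" and cd: "c < d"
    and al: "\<And>q. q \<in> {a, (a + b) / 2, b} \<Longrightarrow> q \<le> c \<or> d \<le> q"
  shows "(LINT x|lborel. haar {a..<b} x * haar {c..<d} x) = 0"
proof -
  let ?m = "(a + b) / 2"
  have m: "a < ?m" "?m < b" using ab by auto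
  have "haar {a..<b} x * haar {c..<d} x = haar {a..<b} c * haar {c..<d} x" for x
  proof (cases "x \<in> {c..<d}")
    case True
    have "haar {a..<b} x = haar {a..<b} c"
      using al[of a] al[of ?m] al[of b] True m
      by (auto simp: haar_interval[OF ab] indicator_def)
    then show ?thesis by simp
  next
    case False
    then show ?thesis using haar_eq_0[OF cd False] by simp
  qed
  then show ?thesis by (simp only: integral_mult_right_zero integral_haar(2)[OF cd] mult_zero_right)
qed

section \<open>Nested grids of intervals\<close>

definition shifted_interval :: "(int \<Rightarrow> real) \<Rightarrow> int \<Rightarrow> int \<Rightarrow> real set" where
  "shifted_interval \<sigma> k j = {\<sigma> k + 2 powi k * of_int j ..< \<sigma> k + 2 powi k * (of_int j + 1)}"

text \<open>Translations at neighbouring scales differ by a multiple of the finer mesh, so every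
  endpoint of a coarse interval is an endpoint of the finer grid. This form covers the standard grid
  and the shifted one together.\<close>

definition nested_shift :: "(int \<Rightarrow> real) \<Rightarrow> bool" where
  "nested_shift \<sigma> \<longleftrightarrow> (\<forall>k. \<exists>m::int. \<sigma> (k + 1) - \<sigma> k = 2 powi k * m)"

lemma nested_shift_le:
  assumes "nested_shift \<sigma>" "k' \<le> k"
  shows "\<exists>m::int. \<sigma> k - \<sigma> k' = 2 powi k' * m"
  using \<open>k' \<le> k\<close>
proof (induction k rule: int_ge_induct)
  case base
  show ?case by (intro exI[of _ 0]) simp
next
  case (step k)
  then obtain m :: int where m: "\<sigma> k - \<sigma> k' = 2 powi k' * m" by blast
  obtain l :: int where l: "\<sigma> (k + 1) - \<sigma> k = 2 powi k * l"
    using assms(1) by (auto simp: nested_shift_def)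
  have "(2::real) powi k = 2 powi k' * 2 powi (k - k')" by (simp add: power_int_add[symmetric])
  also have "(2::real) powi (k - k') = of_int (2 ^ nat (k - k'))"
    using step by (simp add: power_int_def)
  finally have "\<sigma> (k + 1) - \<sigma> k' = 2 powi k' * (m + 2 ^ nat (k - k') * l)"
    using m l by (simp add: algebra_simps)
  then show ?case by (metis of_int_add of_int_mult of_int_numeral of_int_power)
qed

lemma grid_point_not_inside:
  assumes "nested_shift \<sigma>" "k' \<le> k"
  shows "\<sigma> k + 2 powi k * of_int i \<le> \<sigma> k' + 2 powi k' * of_int j
    \<or> \<sigma> k' + 2 powi k' * (of_int j + 1) \<le> \<sigma> k + 2 powi k * of_int i"
proof -
  obtain m :: int where m: "\<sigma> k - \<sigma> k' = 2 powi k' * m" using nested_shift_le[OF assms] by blast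
  have "(2::real) powi k = 2 powi k' * 2 powi (k - k')" by (simp add: power_int_add[symmetric])
  also have "(2::real) powi (k - k') = of_int (2 ^ nat (k - k'))"
    using assms by (simp add: power_int_def)
  finally have q: "\<sigma> k + 2 powi k * of_int i = \<sigma> k' + 2 powi k' * of_int (m + 2 ^ nat (k - k') * i)"
    using m by (simp add: algebra_simps)
  define n where "n = m + 2 ^ nat (k - k') * i"
  have "n \<le> j \<or> j + 1 \<le> n" by linarith
  then have "real_of_int n \<le> of_int j \<or> of_int j + 1 \<le> real_of_int n"
    by (metis of_int_1 of_int_add of_int_le_iff)
  then show ?thesis unfolding q n_def[symmetric] by (auto intro!: mult_left_mono)
qed

lemma haar_shifted_orthogonal_le:
  assumes s: "nested_shift \<sigma>" and "k' \<le> k" and ne: "shifted_interval \<sigma> k j \<noteq> shifted_interval \<sigma> k' j'"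
  shows "(LINT x|lborel. haar (shifted_interval \<sigma> k j) x * haar (shifted_interval \<sigma> k' j') x) = 0"
proof (cases "k' = k")
  case True
  then have "j \<noteq> j'" using ne by auto
  have "haar (shifted_interval \<sigma> k j) x * haar (shifted_interval \<sigma> k' j') x = 0" for x
  proof (rule ccontr)
    assume "haar (shifted_interval \<sigma> k j) x * haar (shifted_interval \<sigma> k' j') x \<noteq> 0"
    then have "haar (shifted_interval \<sigma> k j) x \<noteq> 0" "haar (shifted_interval \<sigma> k j') x \<noteq> 0"
      using True by auto
    moreover have "haar (shifted_interval \<sigma> k i) x = 0" if "x \<notin> shifted_interval \<sigma> k i" for i
      using that unfolding shifted_interval_def by (intro haar_eq_0) auto
    ultimately have "x \<in> shifted_interval \<sigma> k j" "x \<in> shifted_interval \<sigma> k j'" by blast+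
    then have mem: "\<sigma> k + 2 powi k * of_int j \<le> x" "x < \<sigma> k + 2 powi k * of_int (j + 1)"
      "\<sigma> k + 2 powi k * of_int j' \<le> x" "x < \<sigma> k + 2 powi k * of_int (j' + 1)"
      by (simp_all add: shifted_interval_def)
    have "2 powi k * real_of_int j < 2 powi k * of_int (j' + 1)" using mem by linarith
    moreover have "2 powi k * real_of_int j' < 2 powi k * of_int (j + 1)" using mem by linarith
    ultimately have "j < j' + 1" "j' < j + 1" by (simp_all only: mult_less_cancel_left_pos zero_less_power_int zero_less_numeral of_int_less_iff)
    then show False using \<open>j \<noteq> j'\<close> by simp
  qed
  then show ?thesis by (simp only: Bochner_Integration.integral_zero)
next
  case False
  \<comment> \<open>The midpoint of the longer interval is a breakpoint as well. It belongs to the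
    grid of scale k - 1, which is still at least as coarse as that of the shorter interval.\<close>
  then have k: "k' \<le> k - 1" using assms by simp
  let ?h = "2 powi (k - 1) :: real"
  have h: "2 powi k = 2 * ?h" using power_int_add_1[of "2::real" "k - 1"] by simp
  obtain m :: int where m: "\<sigma> k - \<sigma> (k - 1) = ?h * m"
    using nested_shift_le[OF s, of "k - 1" k] by auto
  have al: "\<sigma> k + ?h * of_int i \<le> \<sigma> k' + 2 powi k' * of_int j'
    \<or> \<sigma> k' + 2 powi k' * (of_int j' + 1) \<le> \<sigma> k + ?h * of_int i" for i
    using grid_point_not_inside[OF s k, of "m + i" j'] m by (simp add: algebra_simps)
  show ?thesis
    unfolding shifted_interval_def
  proof (rule haar_orthogonal_aligned)
    fix q assume "q \<in> {\<sigma> k + 2 powi k * real_of_int j,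
        (\<sigma> k + 2 powi k * real_of_int j + (\<sigma> k + 2 powi k * (real_of_int j + 1))) / 2,
        \<sigma> k + 2 powi k * (real_of_int j + 1)}"
    then have "q = \<sigma> k + ?h * of_int (2 * j) \<or> q = \<sigma> k + ?h * of_int (2 * j + 1) \<or> q = \<sigma> k + ?h * of_int (2 * j + 2)"
      unfolding h by (auto simp: field_simps)
    then show "q \<le> \<sigma> k' + 2 powi k' * real_of_int j' \<or> \<sigma> k' + 2 powi k' * (real_of_int j' + 1) \<le> q"
      using al[of "2 * j"] al[of "2 * j + 1"] al[of "2 * j + 2"] by auto
  qed auto
qed

text \<open>In the differences the thirds disappear: they are 0 for negative k, 1 at k = 0, and then
  2^k for even and 0 for odd k.\<close>

lemma nested_dyadic_shift: "nested_shift (dyadic_shift d)"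
  unfolding nested_shift_def
proof
  fix k :: int
  consider "k < 0" | "k = 0" | "k > 0" "even k" | "k > 0" "odd k" by linarith
  then show "\<exists>m::int. dyadic_shift d (k + 1) - dyadic_shift d k = 2 powi k * m"
  proof cases
    case 1
    then show ?thesis by (intro exI[of _ 0]) (simp add: dyadic_shift_def)
  next
    case 2
    then show ?thesis by (intro exI[of _ 1]) (simp add: dyadic_shift_def)
  next
    case 3
    then show ?thesis
      by (intro exI[of _ 1]) (simp add: dyadic_shift_def power_int_add field_simps)
  next
    case 4
    then show ?thesis by (intro exI[of _ 0]) (simp add: dyadic_shift_def power_int_add field_simps)
  qed
qed

lemma dyadic_grid_shifted:
  obtains \<sigma> where "nested_shift \<sigma>" "dyadic_grid a = {shifted_interval \<sigma> k j | k j. True}"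
proof (cases "a = 0")
  case True
  show thesis
    by (rule that[of "\<lambda>_. 0"])
       (auto simp: True nested_shift_def dyadic_grid_def dyadic_interval_def shifted_interval_def intro!: exI[of _ 0])
next
  case False
  have "(+) (dyadic_shift a k) ` dyadic_interval k j = shifted_interval (dyadic_shift a) k j" for k j
    by (simp add: dyadic_interval_def shifted_interval_def add.commute)
  then show thesis
    using False by (intro that[of "dyadic_shift a"] nested_dyadic_shift) (simp add: dyadic_grid_def)
qed

lemma haar_grid_orthonormal:
  assumes "I \<in> dyadic_grid a" "I' \<in> dyadic_grid a"
  shows "(LINT x|lborel. haar I x * haar I' x) = (if I = I' then 1 else 0)"
proof -
  obtain \<sigma> where s: "nested_shift \<sigma>" and g: "dyadic_grid a = {shifted_interval \<sigma> k j | k j. True}"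
    by (rule dyadic_grid_shifted)
  obtain k j k' j' where I: "I = shifted_interval \<sigma> k j" "I' = shifted_interval \<sigma> k' j'"
    using assms unfolding g by auto
  show ?thesis
  proof (cases "I = I'")
    case True
    then show ?thesis using integral_haar(3) unfolding I by (simp add: shifted_interval_def)
  next
    case False
    then show ?thesis
      using haar_shifted_orthogonal_le[OF s, of k' k j j'] haar_shifted_orthogonal_le[OF s, of k k' j' j]
      unfolding I by (cases "k' \<le> k") (auto simp: mult.commute)
  qed
qed

lemma dyadic_grid_interval:
  assumes "I \<in> dyadic_grid a" obtains u v where "u < v" "I = {u..<v}"
proof -
  obtain \<sigma> where g: "dyadic_grid a = {shifted_interval \<sigma> k j | k j. True}"
    by (rule dyadic_grid_shifted)
  obtain k j where "I = shifted_interval \<sigma> k j" using assms unfolding g by auto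
  then show thesis
    by (intro that[of "\<sigma> k + 2 powi k * real_of_int j" "\<sigma> k + 2 powi k * real_of_int (j + 1)"])
       (auto simp: shifted_interval_def)
qed

section \<open>Tensor products of Haar functions\<close>

definition haar2 :: "real set \<times> real set \<Rightarrow> real \<times> real \<Rightarrow> real" where
  "haar2 R z = haar (fst R) (fst z) * haar (snd R) (snd z)"

lemma haar2_measurable [measurable]: "haar2 R \<in> borel_measurable borel"
proof -
  have "(\<lambda>z. haar (fst R) (fst z) * haar (snd R) (snd z)) \<in> borel_measurable (borel \<Otimes>\<^sub>M borel)"
    by measurable
  then show ?thesis by (simp add: haar2_def[abs_def] borel_prod)
qed

lemma haar2_bounded:
  assumes "R \<in> dyadic_grid a \<times> dyadic_grid b"
  obtains K where "K \<ge> 0" "\<And>z. \<bar>haar2 R z\<bar> \<le> K * indicator (fst R \<times> snd R) z"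
    "emeasure lborel (fst R \<times> snd R) < \<infinity>" "fst R \<times> snd R \<in> sets borel"
proof -
  obtain I J where R: "R = (I, J)" by force
  obtain u v where I: "u < v" "I = {u..<v}" using assms R dyadic_grid_interval by (metis mem_Sigma_iff)
  obtain u' v' where J: "u' < v'" "J = {u'..<v'}" using assms R dyadic_grid_interval by (metis mem_Sigma_iff)
  show thesis
  proof
    show "0 \<le> (v - u) powr (-1/2) * (v' - u') powr (-1/2)" by simp
    fix z
    have "\<bar>haar2 R z\<bar> \<le> ((v - u) powr (-1/2) * indicator I (fst z)) * ((v' - u') powr (-1/2) * indicator J (snd z))"
      unfolding haar2_def R I J fst_conv snd_conv abs_mult
      by (intro mult_mono abs_haar_le I J) auto
    then show "\<bar>haar2 R z\<bar> \<le> (v - u) powr (-1/2) * (v' - u') powr (-1/2) * indicator (fst R \<times> snd R) z"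
      by (cases z) (simp add: R indicator_times mult_ac)
  next
    have "bounded (I \<times> J)" unfolding I J by (intro bounded_Times) auto
    then show "emeasure lborel (fst R \<times> snd R) < \<infinity>" using emeasure_bounded_finite by (simp add: R)
    show "fst R \<times> snd R \<in> sets borel" unfolding R I J fst_conv snd_conv
      by (intro borel_Times) auto
  qed
qed

lemma haar2_orthonormal:
  assumes "R \<in> dyadic_grid a \<times> dyadic_grid b" "R' \<in> dyadic_grid a \<times> dyadic_grid b"
  shows "integrable lborel (\<lambda>z. haar2 R z * haar2 R' z)"
    "(LINT z|lborel. haar2 R z * haar2 R' z) = (if R = R' then 1 else 0)"
proof -
  obtain I J I' J' where R: "R = (I, J)" "R' = (I', J')" by force
  have I: "I \<in> dyadic_grid a" "I' \<in> dyadic_grid a" and J: "J \<in> dyadic_grid b" "J' \<in> dyadic_grid b"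
    using assms R by auto
  have int: "integrable lborel (\<lambda>x. complex_of_real (haar I x * haar I' x))"
    if grid: "I \<in> dyadic_grid c" "I' \<in> dyadic_grid c" for I I' c
  proof -
    obtain u v where I: "u < v" "I = {u..<v}" by (rule dyadic_grid_interval[OF grid(1)])
    obtain u' v' where I': "u' < v'" "I' = {u'..<v'}" by (rule dyadic_grid_interval[OF grid(2)])
    have "integrable lborel (\<lambda>x. haar I x * haar I' x)"
    proof (rule Bochner_Integration.integrable_bound)
      show "integrable lborel (\<lambda>x. (v - u) powr (-1/2) * haar I' x)"
        using integral_haar(1)[OF I'(1)] I' by simp
      have "\<bar>haar I x\<bar> \<le> (v - u) powr (-1/2)" for x
        using abs_haar_le[OF I(1), of x] I by (cases "x \<in> I") (auto simp: indicator_def)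
      then show "AE x in lborel. norm (haar I x * haar I' x) \<le> norm ((v - u) powr (-1/2) * haar I' x)"
        by (auto simp: abs_mult intro!: mult_right_mono)
    qed measurable
    then show ?thesis by (rule integrable_of_real)
  qed
  have eq: "complex_of_real (haar2 R z * haar2 R' z)
      = complex_of_real (haar I (fst z) * haar I' (fst z)) * complex_of_real (haar J (snd z) * haar J' (snd z))" for z
    by (simp add: haar2_def R)
  have "integrable lborel (\<lambda>z. complex_of_real (haar2 R z * haar2 R' z))"
    unfolding eq by (rule integrable_product[OF int[OF I] int[OF J]])
  from integrable_Re[OF this] show "integrable lborel (\<lambda>z. haar2 R z * haar2 R' z)" by simp
  have "complex_of_real (LINT z|lborel. haar2 R z * haar2 R' z)
     = of_real (LINT x|lborel. haar I x * haar I' x) * of_real (LINT y|lborel. haar J y * haar J' y)"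
    using integral_product_eq[OF int[OF I] int[OF J]] unfolding eq[symmetric] integral_complex_of_real .
  then show "(LINT z|lborel. haar2 R z * haar2 R' z) = (if R = R' then 1 else 0)"
    unfolding haar_grid_orthonormal[OF I] haar_grid_orthonormal[OF J]
    by (simp add: R split: if_splits)
qed

text \<open>The squared distance of u from its projection v is integrated and expanded. The Haar
  functions are real, so complex values are treated as real vectors with the real inner
  product.\<close>

lemma haar2_bessel_inequality:
  fixes H :: "real \<times> real \<Rightarrow> complex"
  assumes [measurable]: "H \<in> borel_measurable borel" and M: "\<And>z. norm (H z) \<le> M"
    and [measurable]: "\<Omega> \<in> sets borel" and fin: "emeasure lborel \<Omega> < \<infinity>"
    and T: "finite T" "T \<subseteq> dyadic_grid a \<times> dyadic_grid b" "\<And>R. R \<in> T \<Longrightarrow> fst R \<times> snd R \<subseteq> \<Omega>"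
  shows "(\<Sum>R\<in>T. (norm (LINT z|lborel. haar2 R z *\<^sub>R H z))\<^sup>2) \<le> M\<^sup>2 * measure lborel \<Omega>"
proof -
  \<comment> \<open>Cutting H off outside \<Omega> leaves the coefficients unchanged, as the
    rectangles lie inside, and makes it square integrable.\<close>
  define u where "u z = indicator \<Omega> z *\<^sub>R H z" for z
  have [measurable]: "u \<in> borel_measurable borel" unfolding u_def by measurable
  have M0: "M \<ge> 0" using order_trans[OF norm_ge_zero M] .
  have uM: "norm (u z) \<le> M" for z using M M0 by (auto simp: u_def indicator_def)
  have hu: "haar2 R z *\<^sub>R H z = haar2 R z *\<^sub>R u z" if "R \<in> T" for R z
  proof (cases "z \<in> \<Omega>")
    case False
    have "R \<in> dyadic_grid a \<times> dyadic_grid b" using T(2) that by blast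
    then obtain K where "\<bar>haar2 R z\<bar> \<le> K * indicator (fst R \<times> snd R) z"
      by (rule haar2_bounded) blast
    moreover have "z \<notin> fst R \<times> snd R" using T(3)[OF that] False by blast
    ultimately show ?thesis by simp
  qed (simp add: u_def)
  define c where "c R = (LINT z|lborel. haar2 R z *\<^sub>R H z)" for R
  have ic: "integrable lborel (\<lambda>z. haar2 R z *\<^sub>R u z)" if R: "R \<in> T" for R
  proof -
    have "R \<in> dyadic_grid a \<times> dyadic_grid b" using T(2) R by blast
    then obtain K where K: "K \<ge> 0" "\<And>z. \<bar>haar2 R z\<bar> \<le> K * indicator (fst R \<times> snd R) z"
      "emeasure lborel (fst R \<times> snd R) < \<infinity>" and [measurable]: "fst R \<times> snd R \<in> sets borel"
      by (rule haar2_bounded) blast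
    show ?thesis
    proof (rule Bochner_Integration.integrable_bound)
      show "integrable lborel (\<lambda>z. (K * M) * indicator (fst R \<times> snd R) z)"
        using K by (intro integrable_mult_right integrable_real_indicator) auto
      show "AE z in lborel. norm (haar2 R z *\<^sub>R u z) \<le> norm ((K * M) * indicator (fst R \<times> snd R) z)"
      proof (rule AE_I2)
        fix z
        have "norm (haar2 R z *\<^sub>R u z) \<le> (K * indicator (fst R \<times> snd R) z) * M"
          unfolding norm_scaleR using K uM by (intro mult_mono) auto
        then show "norm (haar2 R z *\<^sub>R u z) \<le> norm ((K * M) * indicator (fst R \<times> snd R) z)"
          using K(1) M0 by (cases "z \<in> fst R \<times> snd R") (simp_all only: indicator_simps, simp_all)
      qed
    qed measurable
  qed
  have c: "c R = (LINT z|lborel. haar2 R z *\<^sub>R u z)" if "R \<in> T" for R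
    by (simp only: c_def hu[OF that])
  define v where "v z = (\<Sum>R\<in>T. haar2 R z *\<^sub>R c R)" for z
  have iuu: "integrable lborel (\<lambda>z. u z \<bullet> u z)"
  proof (rule Bochner_Integration.integrable_bound)
    show "integrable lborel (\<lambda>z. M\<^sup>2 * indicator \<Omega> z)"
      using fin by (intro integrable_mult_right integrable_real_indicator) auto
    show "AE z in lborel. norm (u z \<bullet> u z) \<le> norm (M\<^sup>2 * indicator \<Omega> z)"
      using M by (intro AE_I2) (auto simp: u_def indicator_def dot_square_norm intro: power_mono)
  qed measurable
  have iuv: "integrable lborel (\<lambda>z. \<Sum>R\<in>T. (haar2 R z *\<^sub>R u z) \<bullet> c R)"
    by (intro Bochner_Integration.integrable_sum integrable_inner_left ic)
  have ivv: "integrable lborel (\<lambda>z. \<Sum>R\<in>T. \<Sum>R'\<in>T. (haar2 R z * haar2 R' z) * (c R \<bullet> c R'))"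
    using T by (intro Bochner_Integration.integrable_sum integrable_mult_left haar2_orthonormal) auto
  have expand: "(norm (u z - v z))\<^sup>2 = u z \<bullet> u z - 2 * (\<Sum>R\<in>T. (haar2 R z *\<^sub>R u z) \<bullet> c R)
     + (\<Sum>R\<in>T. \<Sum>R'\<in>T. (haar2 R z * haar2 R' z) * (c R \<bullet> c R'))" for z
  proof -
    have "u z \<bullet> v z = (\<Sum>R\<in>T. (haar2 R z *\<^sub>R u z) \<bullet> c R)"
      by (simp add: v_def inner_sum_right)
    moreover have "v z \<bullet> v z = (\<Sum>R\<in>T. \<Sum>R'\<in>T. (haar2 R z * haar2 R' z) * (c R \<bullet> c R'))"
      by (simp add: v_def inner_sum_right inner_sum_left sum_distrib_left mult_ac inner_commute)
    ultimately show ?thesis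
      unfolding power2_norm_eq_inner by (simp add: inner_diff_left inner_diff_right inner_commute)
  qed
  have "0 \<le> (LINT z|lborel. (norm (u z - v z))\<^sup>2)" by simp
  also have "\<dots> = (LINT z|lborel. u z \<bullet> u z) - 2 * (LINT z|lborel. (\<Sum>R\<in>T. (haar2 R z *\<^sub>R u z) \<bullet> c R))
      + (LINT z|lborel. (\<Sum>R\<in>T. \<Sum>R'\<in>T. (haar2 R z * haar2 R' z) * (c R \<bullet> c R')))"
    unfolding expand using iuu iuv ivv by simp
  also have "(LINT z|lborel. (\<Sum>R\<in>T. (haar2 R z *\<^sub>R u z) \<bullet> c R)) = (\<Sum>R\<in>T. (norm (c R))\<^sup>2)"
    by (subst Bochner_Integration.integral_sum)
       (auto intro!: integrable_inner_left ic sum.cong simp: integral_inner_left ic c power2_norm_eq_inner simp del: inner_scaleR_left)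
  also have "(LINT z|lborel. (\<Sum>R\<in>T. \<Sum>R'\<in>T. (haar2 R z * haar2 R' z) * (c R \<bullet> c R')))
      = (\<Sum>R\<in>T. \<Sum>R'\<in>T. (LINT z|lborel. haar2 R z * haar2 R' z) * (c R \<bullet> c R'))"
    using T
    by (subst Bochner_Integration.integral_sum,
        intro Bochner_Integration.integrable_sum integrable_mult_left haar2_orthonormal, auto,
        intro sum.cong refl, subst Bochner_Integration.integral_sum)
       (auto intro!: integrable_mult_left haar2_orthonormal)
  also have "\<dots> = (\<Sum>R\<in>T. \<Sum>R'\<in>T. if R = R' then (norm (c R))\<^sup>2 else 0)"
    using T by (intro sum.cong refl) (auto simp: haar2_orthonormal(2)[of _ a b] subset_eq power2_norm_eq_inner)
  also have "\<dots> = (\<Sum>R\<in>T. (norm (c R))\<^sup>2)" using T by simp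
  finally have "(\<Sum>R\<in>T. (norm (c R))\<^sup>2) \<le> (LINT z|lborel. u z \<bullet> u z)" by simp
  also have "\<dots> \<le> (LINT z|lborel. M\<^sup>2 * indicator \<Omega> z)"
    using fin M by (intro integral_mono_AE iuu integrable_mult_right integrable_real_indicator AE_I2)
      (auto simp: u_def indicator_def dot_square_norm intro: power_mono)
  also have "\<dots> = M\<^sup>2 * measure lborel \<Omega>" by simp
  finally show ?thesis by (simp add: c_def)
qed

section \<open>Bounded functions and product BMO\<close>

lemma haar_coeff_modification:
  assumes "G \<in> borel_measurable borel" "AE z in lebesgue. F z = G z"
  shows "haar_coeff F I J = (LINT z|lborel. haar2 (I, J) z *\<^sub>R G z)"
proof -
  have [measurable]: "G \<in> borel_measurable lebesgue" using assms(1) by (simp add: measurable_completion)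
  have F: "F \<in> borel_measurable lebesgue"
    by (rule borel_measurable_AE[of G]) (use assms(2) in \<open>auto elim: eventually_mono\<close>)
  have h: "haar2 (I, J) \<in> borel_measurable lebesgue" by (rule measurable_completion) measurable
  have "haar_coeff F I J = (LINT z|lebesgue. haar2 (I, J) z *\<^sub>R F z)"
    unfolding haar_coeff_def haar2_def
    by (intro Bochner_Integration.integral_cong refl) (simp add: scaleR_conv_of_real mult.commute)
  also have "\<dots> = (LINT z|lborel. haar2 (I, J) z *\<^sub>R G z)"
  proof (rule integral_lebesgue_modification)
    show "(\<lambda>z. haar2 (I, J) z *\<^sub>R F z) \<in> borel_measurable lebesgue"
      using h F by (rule borel_measurable_scaleR)
    show "(\<lambda>z. haar2 (I, J) z *\<^sub>R G z) \<in> borel_measurable borel"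
      using assms(1) by measurable
    show "AE z in lebesgue. haar2 (I, J) z *\<^sub>R F z = haar2 (I, J) z *\<^sub>R G z"
      using assms(2) by eventually_elim simp
  qed
  finally show ?thesis .
qed

proposition dyadic_bmo_norm_le_sup:
  fixes H G :: "real \<times> real \<Rightarrow> complex"
  assumes G [measurable]: "G \<in> borel_measurable borel" and HG: "AE z in lebesgue. H z = G z"
    and M: "M \<ge> 0" "AE z in lebesgue. norm (H z) \<le> M"
  shows "dyadic_bmo_norm a b H \<le> ennreal M"
  unfolding dyadic_bmo_norm_def
proof (rule SUP_least, clarify)
  fix \<Omega> :: "(real \<times> real) set"
  assume \<Omega>: "open \<Omega>" "\<Omega> \<noteq> {}" "emeasure lborel \<Omega> < \<infinity>"
  \<comment> \<open>The bound M holds only almost everywhere; the truncation makes it hold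
    everywhere without changing any coefficient.\<close>
  define G' where "G' z = (if norm (G z) \<le> M then G z else 0)" for z
  have G' [measurable]: "G' \<in> borel_measurable borel" unfolding G'_def by measurable
  have G'M: "norm (G' z) \<le> M" for z using M by (simp add: G'_def)
  have HG': "AE z in lebesgue. H z = G' z"
    using HG M(2) by eventually_elim (simp add: G'_def)
  have \<Omega>m: "\<Omega> \<in> sets borel" using \<Omega> by simp
  let ?A = "{(I, J). I \<in> dyadic_grid a \<and> J \<in> dyadic_grid b \<and> I \<times> J \<subseteq> \<Omega>}"
  let ?f = "\<lambda>(I, J). ennreal ((cmod (haar_coeff H I J))\<^sup>2)"
  have em: "emeasure lborel \<Omega> = ennreal (measure lborel \<Omega>)"
    using \<Omega>(3) by (simp add: emeasure_eq_ennreal_measure)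
  \<comment> \<open>A nonempty open set has positive measure, so the quotient in the norm is a
    genuine one.\<close>
  have pos: "emeasure lborel \<Omega> > 0"
  proof (rule ccontr)
    assume "\<not> 0 < emeasure lborel \<Omega>"
    then have "\<Omega> \<in> null_sets lborel" using \<Omega>m by (auto simp: null_sets_def)
    then have "negligible \<Omega>" by (simp add: negligible_iff_null_sets null_sets_completionI)
    then show False using open_not_negligible \<Omega> by blast
  qed
  have "infsum ?f ?A \<le> ennreal (M\<^sup>2) * emeasure lborel \<Omega>"
  \<comment> \<open>A sum in \<open>ennreal\<close> is controlled by its finite subsums, to which
    Bessel's inequality applies.\<close>
  proof (rule infsum_le_finite_sums)
    show "?f summable_on ?A" by (rule nonneg_summable_on_complete) simp
    fix T assume T: "finite T" "T \<subseteq> ?A"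
    have "(\<Sum>R\<in>T. (norm (LINT z|lborel. haar2 R z *\<^sub>R G' z))\<^sup>2) \<le> M\<^sup>2 * measure lborel \<Omega>"
    proof (rule haar2_bessel_inequality[OF G' G'M \<Omega>m \<Omega>(3) T(1)])
      show "T \<subseteq> dyadic_grid a \<times> dyadic_grid b" using T(2) by auto
      show "fst R \<times> snd R \<subseteq> \<Omega>" if "R \<in> T" for R
        using subsetD[OF T(2) that] by (simp add: case_prod_beta)
    qed
    moreover have "?f R = ennreal ((norm (LINT z|lborel. haar2 R z *\<^sub>R G' z))\<^sup>2)" for R
      by (cases R) (simp add: haar_coeff_modification[OF G' HG'])
    ultimately show "sum ?f T \<le> ennreal (M\<^sup>2) * emeasure lborel \<Omega>"
      unfolding em by (simp add: ennreal_mult[symmetric] sum_ennreal ennreal_leI)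
  qed
  then have le: "infsum ?f ?A / emeasure lborel \<Omega> \<le> ennreal (M\<^sup>2)"
    using pos \<Omega>(3) by (simp add: divide_le_posI_ennreal mult.commute)
  then have "infsum ?f ?A / emeasure lborel \<Omega> \<noteq> \<infinity>" by (auto simp: top_unique)
  moreover have "sqrt (enn2real (infsum ?f ?A / emeasure lborel \<Omega>)) \<le> M"
    using enn2real_mono[OF le] M by (intro real_le_lsqrt) auto
  ultimately show "esqrt (infsum ?f ?A / emeasure lborel \<Omega>) \<le> ennreal M"
    unfolding esqrt_def by (simp add: ennreal_leI)
qed

lemma haar_coeff_le_bmo:
  assumes bmo: "dyadic_bmo_norm a b F \<le> ennreal B" "B \<ge> 0"
    and I: "{u..<u + 2 * h} \<in> dyadic_grid a" and J: "{v..<v + 2 * l} \<in> dyadic_grid b"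
    and hl: "h > 0" "l > 0"
  shows "cmod (haar_coeff F {u..<u + 2 * h} {v..<v + 2 * l}) \<le> 4 * B * sqrt (h * l)"
proof -
  \<comment> \<open>The supremum runs over open sets and the dyadic rectangle is half-open, so it is
    enlarged to an open one with doubled sides. Its measure 16 h l is the origin of the constant
    4.\<close>
  define \<Omega> where "\<Omega> = {u - 2 * h<..<u + 2 * h} \<times> {v - 2 * l<..<v + 2 * l}"
  have "emeasure (lborel \<Otimes>\<^sub>M lborel) \<Omega> = emeasure lborel {u - 2 * h<..<u + 2 * h} * emeasure lborel {v - 2 * l<..<v + 2 * l}"
    unfolding \<Omega>_def by (rule lborel.emeasure_pair_measure_Times) auto
  then have em: "emeasure lborel \<Omega> = ennreal (16 * (h * l))"
    using hl by (simp add: lborel_prod ennreal_mult[symmetric])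
  have op: "open \<Omega>" unfolding \<Omega>_def by (intro open_Times) auto
  have "(u, v) \<in> \<Omega>" using hl by (simp add: \<Omega>_def)
  then have ne: "\<Omega> \<noteq> {}" by blast
  let ?A = "{(I, J). I \<in> dyadic_grid a \<and> J \<in> dyadic_grid b \<and> I \<times> J \<subseteq> \<Omega>}"
  let ?f = "\<lambda>(I, J). ennreal ((cmod (haar_coeff F I J))\<^sup>2)"
  let ?R = "({u..<u + 2 * h}, {v..<v + 2 * l})"
  have RA: "?R \<in> ?A" using I J hl by (auto simp: \<Omega>_def)
  have "esqrt (infsum ?f ?A / emeasure lborel \<Omega>) \<le> dyadic_bmo_norm a b F"
    unfolding dyadic_bmo_norm_def by (rule SUP_upper) (use op ne em in auto)
  then have le: "esqrt (infsum ?f ?A / emeasure lborel \<Omega>) \<le> ennreal B"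
    using bmo(1) by (rule order_trans)
  \<comment> \<open>An infinite quotient would make \<open>esqrt\<close> infinite, against the
    finite bound; hence \<open>enn2real\<close> loses nothing.\<close>
  then have fin: "infsum ?f ?A / emeasure lborel \<Omega> \<noteq> \<infinity>"
    unfolding esqrt_def by (auto simp: top_unique split: if_splits)
  then have "ennreal (sqrt (enn2real (infsum ?f ?A / emeasure lborel \<Omega>))) \<le> ennreal B"
    using le by (simp add: esqrt_def)
  then have "sqrt (enn2real (infsum ?f ?A / emeasure lborel \<Omega>)) \<le> B"
    using bmo by (simp add: ennreal_le_iff)
  then have "enn2real (infsum ?f ?A / emeasure lborel \<Omega>) \<le> B\<^sup>2"
    using sqrt_le_D by blast
  then have "ennreal (enn2real (infsum ?f ?A / emeasure lborel \<Omega>)) \<le> ennreal (B\<^sup>2)"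
    by (rule ennreal_leI)
  moreover have "ennreal (enn2real (infsum ?f ?A / emeasure lborel \<Omega>)) = infsum ?f ?A / emeasure lborel \<Omega>"
    using fin by (intro ennreal_enn2real) (simp add: less_top)
  ultimately have "infsum ?f ?A / emeasure lborel \<Omega> \<le> ennreal (B\<^sup>2)" by simp
  then have "infsum ?f ?A / emeasure lborel \<Omega> * emeasure lborel \<Omega> \<le> ennreal (B\<^sup>2) * emeasure lborel \<Omega>"
    by (rule mult_right_mono) simp
  then have "infsum ?f ?A \<le> ennreal (B\<^sup>2) * emeasure lborel \<Omega>"
    using hl by (simp add: em ennreal_divide_times ennreal_mult_divide_eq)
  also have "\<dots> = ennreal (B\<^sup>2 * (16 * (h * l)))"
    using hl by (simp add: em ennreal_mult[symmetric])
  finally have "infsum ?f ?A \<le> ennreal (B\<^sup>2 * (16 * (h * l)))" .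
  moreover have "infsum ?f {?R} \<le> infsum ?f ?A"
    using RA by (intro infsum_mono_neutral nonneg_summable_on_complete) auto
  ultimately have "infsum ?f {?R} \<le> ennreal (B\<^sup>2 * (16 * (h * l)))" by (rule order_trans[rotated])
  then have "(cmod (haar_coeff F {u..<u + 2 * h} {v..<v + 2 * l}))\<^sup>2 \<le> B\<^sup>2 * (16 * (h * l))"
    using hl by (simp add: ennreal_le_iff)
  also have "\<dots> = (4 * B * sqrt (h * l))\<^sup>2"
    using hl by (simp add: power_mult_distrib)
  finally show ?thesis
    by (rule power2_le_imp_le) (use bmo hl in simp)
qed

section \<open>Mixed differences of dyadic averages\<close>

lemma measure_lborel_Ico_times:
  assumes "a < b" "c < d"
  shows "measure lborel ({a..<b} \<times> {c..<d :: real}) = (b - a) * (d - c)" "convex_body ({a..<b} \<times> {c..<d})"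
proof -
  have "emeasure (lborel \<Otimes>\<^sub>M lborel) ({a..<b} \<times> {c..<d}) = emeasure lborel {a..<b} * emeasure lborel {c..<d}"
    by (rule lborel.emeasure_pair_measure_Times) auto
  then have "emeasure lborel ({a..<b} \<times> {c..<d}) = ennreal ((b - a) * (d - c))"
    using assms by (simp add: lborel_prod ennreal_mult[symmetric])
  then show m: "measure lborel ({a..<b} \<times> {c..<d}) = (b - a) * (d - c)"
    using assms by (intro measure_eq_emeasure_eq_ennreal) auto
  have "{a..<b} \<times> {c..<d} \<in> sets borel" by (intro borel_Times) auto
  moreover have "bounded ({a..<b} \<times> {c..<d})" by (intro bounded_Times) auto
  moreover have "convex ({a..<b} \<times> {c..<d})" by (intro convex_Times) auto
  ultimately show "convex_body ({a..<b} \<times> {c..<d})"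
    using m assms by (simp add: convex_body_def)
qed

text \<open>Over the denominator 4 h l the four means combine to the signed sum D of the quarter
  integrals, up to a sign depending on the chosen halves. The Haar coefficient is D / (2 sqrt (h
  l)), and the modulus makes all choices equivalent.\<close>

lemma mixed_difference_eq_haar:
  fixes G :: "real \<times> real \<Rightarrow> complex"
  assumes G: "\<And>A. A \<in> sets borel \<Longrightarrow> bounded A \<Longrightarrow> set_integrable lborel A G" and hl: "h > 0" "l > 0"
    and I': "I' = {u..<u + h} \<or> I' = {u + h..<u + 2 * h}"
    and J': "J' = {v..<v + l} \<or> J' = {v + l..<v + 2 * l}"
  shows "cmod (mean_value G (I' \<times> J') - mean_value G ({u..<u + 2 * h} \<times> J')
      - mean_value G (I' \<times> {v..<v + 2 * l}) + mean_value G ({u..<u + 2 * h} \<times> {v..<v + 2 * l}))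
    = cmod (LINT z|lborel. haar2 ({u..<u + 2 * h}, {v..<v + 2 * l}) z *\<^sub>R G z) / (2 * sqrt (h * l))"
proof -
  let ?Il = "{u..<u + h}" and ?Ir = "{u + h..<u + 2 * h}" and ?I = "{u..<u + 2 * h}"
  let ?Jl = "{v..<v + l}" and ?Jr = "{v + l..<v + 2 * l}" and ?J = "{v..<v + 2 * l}"
  define T where "T A B = (LINT z:A \<times> B|lborel. G z)" for A B
  have si: "set_integrable lborel ({a..<b} \<times> {c..<d}) G" for a b c d :: real
    by (rule G) (intro borel_Times bounded_Times; simp)+
  have I: "?I = ?Il \<union> ?Ir" "?Il \<inter> ?Ir = {}"
    using hl by (intro ivl_disj_un_two(3)[symmetric] ivl_disj_int_two(3); simp)+
  have J: "?J = ?Jl \<union> ?Jr" "?Jl \<inter> ?Jr = {}"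
    using hl by (intro ivl_disj_un_two(3)[symmetric] ivl_disj_int_two(3); simp)+
  have TI: "T ?I {c..<d} = T ?Il {c..<d} + T ?Ir {c..<d}" for c d
    unfolding T_def I(1) Sigma_Un_distrib1
    by (rule set_integral_Un) (use I(2) si in auto)
  have TJ: "T {a..<b} ?J = T {a..<b} ?Jl + T {a..<b} ?Jr" for a b
    unfolding T_def J(1) Sigma_Un_distrib2
    by (rule set_integral_Un) (use J(2) si in auto)
  have mv: "mean_value G ({a..<b} \<times> {c..<d}) = T {a..<b} {c..<d} / of_real ((b - a) * (d - c))"
    if "a < b" "c < d" for a b c d :: real
    unfolding mean_value_def T_def measure_lborel_Ico_times(1)[OF that] ..
  define D where "D = T ?Il ?Jl - T ?Ir ?Jl - T ?Il ?Jr + T ?Ir ?Jr"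
  let ?c = "(2 * h) powr (-1/2) * (2 * l) powr (-1/2)"
  have hI: "haar ?I x = (2 * h) powr (-1/2) * (indicator ?Il x - indicator ?Ir x)" for x
  proof -
    have mid: "(u + (u + 2 * h)) / 2 = u + h" by simp
    show ?thesis using haar_interval[of u "u + 2 * h" x] hl unfolding mid by simp
  qed
  have hJ: "haar ?J x = (2 * l) powr (-1/2) * (indicator ?Jl x - indicator ?Jr x)" for x
  proof -
    have mid: "(v + (v + 2 * l)) / 2 = v + l" by simp
    show ?thesis using haar_interval[of v "v + 2 * l" x] hl unfolding mid by simp
  qed
  have hz: "haar2 (?I, ?J) z *\<^sub>R G z = ?c *\<^sub>R (indicator (?Il \<times> ?Jl) z *\<^sub>R G z - indicator (?Ir \<times> ?Jl) z *\<^sub>R G z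
      - indicator (?Il \<times> ?Jr) z *\<^sub>R G z + indicator (?Ir \<times> ?Jr) z *\<^sub>R G z)" for z
  proof (cases z)
    case (Pair x y)
    have "haar2 (?I, ?J) z = ?c * (indicator (?Il \<times> ?Jl) z - indicator (?Ir \<times> ?Jl) z
      - indicator (?Il \<times> ?Jr) z + indicator (?Ir \<times> ?Jr) z)"
      unfolding Pair haar2_def fst_conv snd_conv hI hJ indicator_times by (simp add: algebra_simps)
    then show ?thesis by (simp only: scaleR_scaleR[symmetric] scaleR_diff_left scaleR_add_left)
  qed
  have "(LINT z|lborel. haar2 (?I, ?J) z *\<^sub>R G z) = ?c *\<^sub>R D"
    unfolding hz D_def T_def set_lebesgue_integral_def
    using si[unfolded set_integrable_def] by simp
  moreover have "?c = 1 / (2 * sqrt (h * l))"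
  proof -
    have "(2 * h) powr (-1/2) = 1 / sqrt (2 * h)" "(2 * l) powr (-1/2) = 1 / sqrt (2 * l)"
      using hl by (simp_all add: powr_minus_divide powr_half_sqrt)
    then show ?thesis by (simp add: real_sqrt_mult)
  qed
  ultimately have hc: "cmod (LINT z|lborel. haar2 (?I, ?J) z *\<^sub>R G z) = cmod D / (2 * sqrt (h * l))"
    using hl by simp
  have TT: "T ?I ?J = T ?Il ?Jl + T ?Ir ?Jl + T ?Il ?Jr + T ?Ir ?Jr"
    by (simp only: TI TJ add_ac)
  have m00: "mean_value G (?I \<times> ?J) = (T ?Il ?Jl + T ?Ir ?Jl + T ?Il ?Jr + T ?Ir ?Jr) / of_real (4 * (h * l))"
    using mv[of u "u + 2 * h" v "v + 2 * l"] hl unfolding TT by simp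
  have mI: "mean_value G (?I \<times> ?Jl) = (T ?Il ?Jl + T ?Ir ?Jl) / of_real (2 * (h * l))"
    "mean_value G (?I \<times> ?Jr) = (T ?Il ?Jr + T ?Ir ?Jr) / of_real (2 * (h * l))"
    using mv[of u "u + 2 * h" v "v + l"] mv[of u "u + 2 * h" "v + l" "v + 2 * l"] hl unfolding TI by simp_all
  have mJ: "mean_value G (?Il \<times> ?J) = (T ?Il ?Jl + T ?Il ?Jr) / of_real (2 * (h * l))"
    "mean_value G (?Ir \<times> ?J) = (T ?Ir ?Jl + T ?Ir ?Jr) / of_real (2 * (h * l))"
    using mv[of u "u + h" v "v + 2 * l"] mv[of "u + h" "u + 2 * h" v "v + 2 * l"] hl unfolding TJ
    by (simp_all add: mult_ac)
  have m: "mean_value G (?Il \<times> ?Jl) = T ?Il ?Jl / of_real (h * l)" "mean_value G (?Ir \<times> ?Jl) = T ?Ir ?Jl / of_real (h * l)"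
    "mean_value G (?Il \<times> ?Jr) = T ?Il ?Jr / of_real (h * l)" "mean_value G (?Ir \<times> ?Jr) = T ?Ir ?Jr / of_real (h * l)"
    using mv[of u "u + h" v "v + l"] mv[of "u + h" "u + 2 * h" v "v + l"]
      mv[of u "u + h" "v + l" "v + 2 * l"] mv[of "u + h" "u + 2 * h" "v + l" "v + 2 * l"] hl by simp_all
  have quarter: "x / of_real (2 * (h * l)) = 2 * (x / of_real (4 * (h * l)))"
    "x / of_real (h * l) = 4 * (x / of_real (4 * (h * l)))" for x :: complex
    using hl by simp_all
  let ?D = "mean_value G (I' \<times> J') - mean_value G (?I \<times> J') - mean_value G (I' \<times> ?J) + mean_value G (?I \<times> ?J)"
  have "?D = D / of_real (4 * (h * l)) \<or> ?D = - (D / of_real (4 * (h * l)))"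
    using I' J'
    by (elim disjE; simp only: m m00 mI mJ quarter D_def add_divide_distrib diff_divide_distrib; simp add: algebra_simps)
  then have "cmod ?D = cmod D / (4 * (h * l))"
    using hl by (auto simp: norm_divide norm_mult)
  moreover have "2 * sqrt (h * l) * (2 * sqrt (h * l)) = 4 * (h * l)" using hl by simp
  ultimately show ?thesis unfolding hc by (simp only: divide_divide_eq_left)
qed

section \<open>Dyadic ancestors and telescoping\<close>

definition dyadic_at :: "int \<Rightarrow> real \<Rightarrow> real set" where
  "dyadic_at k x = dyadic_interval k \<lfloor>x / 2 powi k\<rfloor>"

lemma dyadic_at_in_grid: "dyadic_at k x \<in> dyadic_grid 0"
  by (auto simp: dyadic_at_def dyadic_grid_def)

lemma dyadic_at_Ico:
  obtains u where "dyadic_at k x = {u..<u + 2 powi k}" "u \<le> x" "x < u + 2 powi k"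
proof
  let ?u = "2 powi k * real_of_int \<lfloor>x / 2 powi k\<rfloor>"
  show "dyadic_at k x = {?u..<?u + 2 powi k}"
    by (simp add: dyadic_at_def dyadic_interval_def algebra_simps)
  have f: "real_of_int \<lfloor>x / 2 powi k\<rfloor> \<le> x / 2 powi k" "x / 2 powi k < real_of_int \<lfloor>x / 2 powi k\<rfloor> + 1"
    by linarith+
  have "?u \<le> 2 powi k * (x / 2 powi k)" by (rule mult_left_mono[OF f(1)]) simp
  then show "?u \<le> x" by simp
  show "x < ?u + 2 powi k" using f(2) by (simp add: field_simps)
qed

lemma dyadic_at_Suc:
  obtains u where "dyadic_at (k + 1) x = {u..<u + 2 * 2 powi k}"
    "dyadic_at k x = {u..<u + 2 powi k} \<or> dyadic_at k x = {u + 2 powi k..<u + 2 * 2 powi k}"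
proof
  let ?h = "2 powi k :: real"
  have h2: "2 powi (k + 1) = 2 * ?h" by (simp add: power_int_add)
  define j j' where "j = \<lfloor>x / ?h\<rfloor>" and "j' = \<lfloor>x / (2 * ?h)\<rfloor>"
  have "real_of_int j' \<le> x / (2 * ?h)" "x / (2 * ?h) < real_of_int j' + 1" unfolding j'_def by linarith+
  then have "real_of_int (2 * j') \<le> x / ?h" "x / ?h < real_of_int (2 * j' + 2)"
    by (simp_all add: field_simps)
  then have "2 * j' \<le> j" "j < 2 * j' + 2" unfolding j_def by linarith+
  then have j: "j = 2 * j' \<or> j = 2 * j' + 1" by linarith
  let ?u = "2 * ?h * of_int j'"
  show "dyadic_at (k + 1) x = {?u..<?u + 2 * ?h}"
    unfolding dyadic_at_def dyadic_interval_def h2 j'_def by (simp add: algebra_simps)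
  show "dyadic_at k x = {?u..<?u + ?h} \<or> dyadic_at k x = {?u + ?h..<?u + 2 * ?h}"
    using j unfolding dyadic_at_def dyadic_interval_def j_def[symmetric] by (auto simp: algebra_simps)
qed

lemma telescoping_bound:
  fixes d :: "nat \<Rightarrow> 'a::real_normed_vector"
  assumes "\<And>i. norm (d i - d (Suc i)) \<le> E"
  shows "norm (d 0 - d n) \<le> real n * E"
proof (induction n)
  case (Suc n)
  have "norm (d 0 - d (Suc n)) \<le> norm (d 0 - d n) + norm (d n - d (Suc n))"
    using norm_triangle_ineq[of "d 0 - d n" "d n - d (Suc n)"] by simp
  then show ?case using Suc assms[of n] by (simp add: algebra_simps)
qed simp

text \<open>The telescope in one variable is applied in each variable in turn, which accounts for
  n^2 cells.\<close>

lemma telescoping_bound_2: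
  fixes a :: "nat \<Rightarrow> nat \<Rightarrow> 'a::real_normed_vector"
  assumes "\<And>i j. norm (a i j - a (Suc i) j - a i (Suc j) + a (Suc i) (Suc j)) \<le> E"
  shows "norm (a 0 0 - a n 0 - a 0 n + a n n) \<le> (real n)\<^sup>2 * E"
proof -
  have 1: "norm ((a 0 j - a 0 (Suc j)) - (a n j - a n (Suc j))) \<le> real n * E" for j
    using assms by (intro telescoping_bound[of "\<lambda>i. a i j - a i (Suc j)"]) (simp add: algebra_simps)
  have "norm ((a 0 0 - a n 0) - (a 0 n - a n n)) \<le> real n * (real n * E)"
    by (rule telescoping_bound[of "\<lambda>j. a 0 j - a n j"]) (use 1 in \<open>simp add: algebra_simps\<close>)
  then show ?thesis by (simp add: power2_eq_square algebra_simps)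
qed

section \<open>The pointwise bound\<close>

text \<open>The exceptional set lies in the image of a null set under the inverse rotation, and
  differentiable images of null sets are null.\<close>

lemma AE_rotation:
  assumes "AE z in lebesgue. P z"
  shows "AE z in lebesgue. P (rotation \<theta> z)"
proof -
  obtain N where N: "N \<in> null_sets lebesgue" "\<And>z. \<not> P z \<Longrightarrow> z \<in> N"
    using assms unfolding eventually_ae_filter by auto
  have inv: "rotation (- \<theta>) (rotation \<theta> z) = z" for z
    by (simp add: rotation_def algebra_simps prod_eq_iff)
       (simp add: mult.assoc[symmetric] distrib_left[symmetric] flip: power2_eq_square)
  have "rotation (- \<theta>) differentiable_on N"
  proof -
    have "bounded_linear (rotation (- \<theta>))"
      unfolding rotation_def[abs_def]
      by (intro bounded_linear_Pair bounded_linear_add bounded_linear_sub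
          bounded_linear_const_mult bounded_linear_fst bounded_linear_snd)
    then show ?thesis
      by (intro differentiable_at_imp_differentiable_on bounded_linear_imp_differentiable) auto
  qed
  then have "negligible (rotation (- \<theta>) ` N)"
    using N by (intro negligible_differentiable_image_negligible) (auto simp: negligible_iff_null_sets)
  then have "rotation (- \<theta>) ` N \<in> null_sets lebesgue" by (simp add: negligible_iff_null_sets)
  moreover have "{z \<in> space lebesgue. \<not> P (rotation \<theta> z)} \<subseteq> rotation (- \<theta>) ` N"
  proof
    fix z assume "z \<in> {z \<in> space lebesgue. \<not> P (rotation \<theta> z)}"
    then have "rotation \<theta> z \<in> N" using N by auto
    then show "z \<in> rotation (- \<theta>) ` N" using inv[of z] by (metis image_eqI)
  qed
  ultimately show ?thesis by (rule AE_I')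
qed

lemma rotation_measurable [measurable]: "rotation \<theta> \<in> borel_measurable borel"
  unfolding rotation_def[abs_def] by (intro borel_measurable_continuous_onI continuous_intros)

lemma bmo_norm_finite: "F \<in> bmo d \<Longrightarrow> bmo_norm d F < \<infinity>"
  by (auto simp: bmo_def bmo_norm_def sup_max max_def bot_ennreal)

lemma two_powi_powr_le:
  fixes q :: real
  assumes "k \<le> m" "q \<ge> 0"
  shows "(2 powi m) powr (- q) \<le> 2 powr (- (of_int k * q))"
proof -
  have "(2 powi m :: real) powr (- q) = 2 powr (- (of_int m * q))"
    by (simp add: powr_real_of_int'[symmetric] powr_powr)
  also have "\<dots> \<le> 2 powr (- (of_int k * q))"
    using assms by (intro powr_mono) (auto intro!: mult_right_mono)
  finally show ?thesis .
qed

lemma dyadic_mean_bound: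
  assumes G: "G \<in> borel_measurable borel" "AE z in lebesgue. F z = G z"
    and Gi: "\<And>A. A \<in> sets borel \<Longrightarrow> bounded A \<Longrightarrow> set_integrable lborel A G"
    and means: "\<And>R. convex_body R \<Longrightarrow> norm (mean_value G R) \<le> K * measure lborel R powr (- q)"
    and K: "K \<ge> 0" "q \<ge> 0"
    and bmo: "dyadic_bmo_norm 0 0 F \<le> ennreal B" "B \<ge> 0"
  shows "norm (mean_value G (dyadic_at (- int k) x \<times> dyadic_at (- int k) y))
    \<le> 18 * (real k)\<^sup>2 * B + 3 * K * 2 powr (- (real k * q))"
proof -
  define a where "a i j = mean_value G (dyadic_at (int i - int k) x \<times> dyadic_at (int j - int k) y)" for i j
  have mixed: "norm (a i j - a (Suc i) j - a i (Suc j) + a (Suc i) (Suc j)) \<le> 2 * B" for i j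
  proof -
    let ?h = "2 powi (int i - int k) :: real" and ?l = "2 powi (int j - int k) :: real"
    have hl: "?h > 0" "?l > 0" by simp_all
    obtain u where u: "dyadic_at (int i - int k + 1) x = {u..<u + 2 * ?h}"
      "dyadic_at (int i - int k) x = {u..<u + ?h} \<or> dyadic_at (int i - int k) x = {u + ?h..<u + 2 * ?h}"
      by (rule dyadic_at_Suc)
    obtain v where v: "dyadic_at (int j - int k + 1) y = {v..<v + 2 * ?l}"
      "dyadic_at (int j - int k) y = {v..<v + ?l} \<or> dyadic_at (int j - int k) y = {v + ?l..<v + 2 * ?l}"
      by (rule dyadic_at_Suc)
    have Suc: "int (Suc n) - int k = int n - int k + 1" for n by simp
    have "norm (a i j - a (Suc i) j - a i (Suc j) + a (Suc i) (Suc j))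
       = cmod (haar_coeff F {u..<u + 2 * ?h} {v..<v + 2 * ?l}) / (2 * sqrt (?h * ?l))"
      unfolding a_def Suc u(1) v(1) haar_coeff_modification[OF G]
      by (rule mixed_difference_eq_haar[OF Gi hl u(2) v(2)])
    also have "\<dots> \<le> (4 * B * sqrt (?h * ?l)) / (2 * sqrt (?h * ?l))"
    proof (rule divide_right_mono)
      show "cmod (haar_coeff F {u..<u + 2 * ?h} {v..<v + 2 * ?l}) \<le> 4 * B * sqrt (?h * ?l)"
        using haar_coeff_le_bmo[OF bmo _ _ hl, of u v] dyadic_at_in_grid u(1) v(1) by metis
    qed simp
    also have "\<dots> = 2 * B" by simp
    finally show ?thesis .
  qed
  \<comment> \<open>The rectangle has area 2^(i + j - 2 k), so the condition on i + j says that the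
    area is at least 2^k.\<close>
  have size: "norm (a i j) \<le> K * 2 powr (- (real k * q))" if "3 * k \<le> i + j" for i j
  proof -
    obtain u where u: "dyadic_at (int i - int k) x = {u..<u + 2 powi (int i - int k)}" by (rule dyadic_at_Ico)
    obtain v where v: "dyadic_at (int j - int k) y = {v..<v + 2 powi (int j - int k)}" by (rule dyadic_at_Ico)
    have lt: "u < u + 2 powi (int i - int k)" "v < v + 2 powi (int j - int k)" by simp_all
    have "measure lborel ({u..<u + 2 powi (int i - int k)} \<times> {v..<v + 2 powi (int j - int k)})
        = 2 powi ((int i - int k) + (int j - int k))"
      unfolding measure_lborel_Ico_times(1)[OF lt] by (subst power_int_add) simp_all
    then have "norm (a i j) \<le> K * (2 powi ((int i - int k) + (int j - int k))) powr (- q)"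
      using means[OF measure_lborel_Ico_times(2)[OF lt]] by (simp add: a_def u v)
    also have "\<dots> \<le> K * 2 powr (- (of_int (int k) * q))"
      using that K by (intro mult_left_mono two_powi_powr_le) auto
    finally show ?thesis by simp
  qed
  \<comment> \<open>The corners (n, 0) and (0, n) have area 2^(n - 2 k), which n = 3 k turns into
    2^k. The constant 18 is 2 times 3^2.\<close>
  let ?n = "3 * k"
  have "norm (a 0 0) \<le> norm (a 0 0 - a ?n 0 - a 0 ?n + a ?n ?n) + norm (a ?n 0) + norm (a 0 ?n) + norm (a ?n ?n)"
    by norm
  also have "\<dots> \<le> (real ?n)\<^sup>2 * (2 * B) + K * 2 powr (- (real k * q)) + K * 2 powr (- (real k * q)) + K * 2 powr (- (real k * q))"
    by (intro add_mono telescoping_bound_2 mixed size) auto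
  also have "\<dots> = 18 * (real k)\<^sup>2 * B + 3 * K * 2 powr (- (real k * q))"
    by (simp add: power_mult_distrib)
  finally show ?thesis by (simp add: a_def)
qed

lemma convex_body_cbox:
  fixes x y h :: real assumes "h > 0"
  shows "measure lborel (cbox (x, y) (x + h, y + h)) = h\<^sup>2" "convex_body (cbox (x, y) (x + h, y + h))"
proof -
  have "emeasure (lborel \<Otimes>\<^sub>M lborel) ({x..x + h} \<times> {y..y + h}) = emeasure lborel {x..x + h} * emeasure lborel {y..y + h}"
    by (rule lborel.emeasure_pair_measure_Times) auto
  then have "emeasure lborel (cbox (x, y) (x + h, y + h)) = ennreal (h\<^sup>2)"
    using assms by (simp add: lborel_prod cbox_Pair_eq ennreal_mult[symmetric] power2_eq_square)
  then show m: "measure lborel (cbox (x, y) (x + h, y + h)) = h\<^sup>2"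
    by (intro measure_eq_emeasure_eq_ennreal) auto
  show "convex_body (cbox (x, y) (x + h, y + h))"
    using assms by (simp add: convex_body_def m convex_box)
qed

text \<open>At almost every z, G z is the limit of averages over closed squares with lower left
  corner z. Such a square is compared with the dyadic square of side 2^(-k) containing z. The null
  set does not depend on k, so k may be chosen afterwards.\<close>

lemma pointwise_bound:
  assumes G: "G \<in> borel_measurable borel" "AE z in lebesgue. F z = G z"
    and Gi: "\<And>A. A \<in> sets borel \<Longrightarrow> bounded A \<Longrightarrow> set_integrable lborel A G"
    and means: "\<And>R. convex_body R \<Longrightarrow> norm (mean_value G R) \<le> K * measure lborel R powr (- q)"
    and diff: "\<And>R Q d. convex_body R \<Longrightarrow> convex_body Q \<Longrightarrow> (\<And>c c'. c \<in> R \<Longrightarrow> c' \<in> Q \<Longrightarrow> norm (c - c') \<le> d) \<Longrightarrow>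
        norm (mean_value G R - mean_value G Q) \<le> K * d powr \<gamma>"
    and K: "K \<ge> 0" "q \<ge> 0" "\<gamma> \<ge> 0"
    and bmo: "dyadic_bmo_norm 0 0 F \<le> ennreal B" "B \<ge> 0"
  shows "AE z in lebesgue. \<forall>k. norm (G z) \<le> 18 * (real k)\<^sup>2 * B + (3 + 4 powr \<gamma>) * K * 2 powr (- (real k * min q \<gamma>))"
proof -
  have HK: "(LINT z:cbox a b|lborel. G z) = integral (cbox a b) G" "G integrable_on cbox a b" for a b
    using set_borel_integral_eq_integral[OF Gi[of "cbox a b"]] by auto
  obtain N where N: "negligible N" "\<And>z e. z \<notin> N \<Longrightarrow> 0 < e \<Longrightarrow>
      \<exists>d>0. \<forall>h. 0 < h \<and> h < d \<longrightarrow> norm (integral (cbox z (z + h *\<^sub>R One)) G /\<^sub>R h ^ DIM(real \<times> real) - G z) < e"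
    using integrable_ccontinuous_explicit[OF HK(2)] by metis
  have One: "One = (1 :: real, 1 :: real)" by (simp add: Basis_prod_def Basis_real_def)
  have bound: "norm (G z) \<le> 18 * (real k)\<^sup>2 * B + (3 + 4 powr \<gamma>) * K * 2 powr (- (real k * min q \<gamma>))"
    (is "_ \<le> ?M") if z: "z \<notin> N" for z k
  proof (rule field_le_epsilon)
    fix e :: real assume "e > 0"
    obtain x y where xy: "z = (x, y)" by force
    obtain d where d: "d > 0" "\<And>h. 0 < h \<Longrightarrow> h < d \<Longrightarrow>
        norm (integral (cbox z (z + h *\<^sub>R One)) G /\<^sub>R h ^ DIM(real \<times> real) - G z) < e"
      using N(2)[OF z \<open>e > 0\<close>] by blast
    let ?r = "2 powi (- int k) :: real"
    \<comment> \<open>Below d for the differentiation theorem, and at most the dyadic side so that Q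
      stays within that distance of z.\<close>
    define h where "h = min (d / 2) ?r"
    have h: "0 < h" "h < d" "h \<le> ?r" using d by (auto simp: h_def)
    define Q where "Q = cbox (x, y) (x + h, y + h)"
    have Q: "measure lborel Q = h\<^sup>2" "convex_body Q" unfolding Q_def using convex_body_cbox[OF h(1)] by auto
    have mQ: "integral (cbox z (z + h *\<^sub>R One)) G /\<^sub>R h ^ DIM(real \<times> real) = mean_value G Q"
    proof -
      have "cbox z (z + h *\<^sub>R One) = Q" by (simp add: Q_def xy One)
      moreover have "h ^ DIM(real \<times> real) = h\<^sup>2" by (simp add: power2_eq_square)
      ultimately show ?thesis
        using HK(1)[of "(x, y)" "(x + h, y + h)"]
        by (simp add: mean_value_def Q(1) Q_def[symmetric] scaleR_conv_of_real divide_inverse mult.commute power2_eq_square)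
    qed
    obtain u where u: "dyadic_at (- int k) x = {u..<u + ?r}" "u \<le> x" "x < u + ?r" by (rule dyadic_at_Ico)
    obtain v where v: "dyadic_at (- int k) y = {v..<v + ?r}" "v \<le> y" "y < v + ?r" by (rule dyadic_at_Ico)
    define R where "R = {u..<u + ?r} \<times> {v..<v + ?r}"
    have r: "?r > 0" by simp
    have R: "convex_body R" unfolding R_def by (rule measure_lborel_Ico_times) simp_all
    have dQ: "norm (mean_value G Q - mean_value G R) \<le> K * (4 * ?r) powr \<gamma>"
    proof (rule diff[OF Q(2) R])
      fix c c' assume c: "c \<in> Q" "c' \<in> R"
      \<comment> \<open>In each coordinate both points are within one dyadic side of z.\<close>
      have "\<bar>fst c - fst c'\<bar> \<le> 2 * ?r" "\<bar>snd c - snd c'\<bar> \<le> 2 * ?r"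
        using c u v h unfolding Q_def R_def by (auto simp: cbox_Pair_eq abs_le_iff)
      moreover have "norm (c - c') \<le> \<bar>fst c - fst c'\<bar> + \<bar>snd c - snd c'\<bar>"
      proof -
        have cc: "c - c' = (fst c - fst c', snd c - snd c')" by (simp add: prod_eq_iff)
        show ?thesis
          unfolding cc using norm_Pair_le[of "fst c - fst c'" "snd c - snd c'"] by simp
      qed
      ultimately show "norm (c - c') \<le> 4 * ?r" by linarith
    qed
    have r\<gamma>: "(4 * ?r) powr \<gamma> = 4 powr \<gamma> * 2 powr (- (real k * \<gamma>))"
      by (simp add: powr_mult powr_real_of_int'[symmetric] powr_powr)
    note dQ[unfolded r\<gamma>]
    moreover have "norm (mean_value G R) \<le> 18 * (real k)\<^sup>2 * B + 3 * K * 2 powr (- (real k * q))"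
      using dyadic_mean_bound[OF G Gi means K(1,2) bmo, of k x y] by (simp add: R_def u v)
    moreover have "norm (G z) \<le> norm (mean_value G Q) + e"
      using d(2)[OF h(1,2)] unfolding mQ by norm
    moreover have "norm (mean_value G Q) \<le> norm (mean_value G Q - mean_value G R) + norm (mean_value G R)"
      by norm
    moreover have "K * (4 powr \<gamma> * 2 powr (- (real k * \<gamma>))) \<le> K * (4 powr \<gamma> * 2 powr (- (real k * min q \<gamma>)))"
      using K by (intro mult_left_mono powr_mono) (auto intro!: mult_left_mono)
    moreover have "3 * K * 2 powr (- (real k * q)) \<le> 3 * K * 2 powr (- (real k * min q \<gamma>))"
      using K by (intro mult_left_mono powr_mono) (auto intro!: mult_left_mono)
    ultimately have "norm (G z) \<le> 18 * (real k)\<^sup>2 * B + 3 * K * 2 powr (- (real k * min q \<gamma>))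
        + K * (4 powr \<gamma> * 2 powr (- (real k * min q \<gamma>))) + e"
      by linarith
    then show "norm (G z) \<le> ?M + e" by (simp add: algebra_simps)
  qed
  have "N \<in> null_sets lebesgue" using N(1) by (simp add: negligible_iff_null_sets)
  from AE_not_in[OF this] show ?thesis by eventually_elim (use bound in blast)
qed

text \<open>The number \<open>k\<close> of scales is chosen so that \<open>2\<^sup>-\<^sup>k\<^sup>\<eta>\<close> is about \<open>B / S\<close>.\<close>

lemma optimise_scales:
  fixes \<alpha> \<eta> A :: real
  assumes \<alpha>: "0 < \<alpha>" "\<alpha> < 1" and \<eta>: "\<eta> > 0" and A: "A \<ge> 0"
  obtains C where "C \<ge> 0" "\<And>B S X. B \<ge> 0 \<Longrightarrow> S \<ge> 0 \<Longrightarrow>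
    (\<And>k. X \<le> 18 * (real k)\<^sup>2 * B + A * S * 2 powr (- (real k * \<eta>))) \<Longrightarrow> X \<le> C * B powr \<alpha> * S powr (1 - \<alpha>)"
proof
  \<comment> \<open>k will grow like ln (S / B). Its square has to be bounded by a multiple of the
    power 1 - \<alpha> of S / B, which leaves half of that exponent for k itself.\<close>
  define \<beta> where "\<beta> = (1 - \<alpha>) / 2"
  have \<beta>: "\<beta> > 0" using \<alpha> by (simp add: \<beta>_def)
  \<comment> \<open>From ln r <= r^\<beta> / \<beta>, with room for rounding k up.\<close>
  define E where "E = 2 + 1 / (\<beta> * (\<eta> * ln 2))"
  have E: "E \<ge> 0" using \<beta> \<eta> by (simp add: E_def)
  show "0 \<le> 18 * E\<^sup>2 + A" using A by simp
  fix B S X :: real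
  assume B: "B \<ge> 0" and S: "S \<ge> 0"
    and X: "\<And>k. X \<le> 18 * (real k)\<^sup>2 * B + A * S * 2 powr (- (real k * \<eta>))"
  have X0: "X \<le> A * S" using X[of 0] by simp
  \<comment> \<open>B = 0 is settled by letting k tend to infinity, and S = 0 or S <= B by k = 0;
    the last case calls for a genuine choice of k.\<close>
  consider "S = 0" | "S > 0" "B = 0" | "S > 0" "B \<ge> S" | "0 < B" "B < S" using B S by linarith
  then show "X \<le> (18 * E\<^sup>2 + A) * B powr \<alpha> * S powr (1 - \<alpha>)"
  proof cases
    case 1
    then show ?thesis using X0 by simp
  next
    case 2
    have "(\<lambda>k. A * S * (2 powr (- \<eta>)) ^ k) \<longlonglongrightarrow> A * S * 0"
      using \<eta> by (intro tendsto_mult tendsto_const LIMSEQ_realpow_zero) (auto simp: powr_less_one)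
    moreover have "X \<le> A * S * (2 powr (- \<eta>)) ^ k" for k
      using X[of k] 2 by (simp add: powr_power mult.commute)
    ultimately have "X \<le> 0" using LIMSEQ_le_const by fastforce
    then show ?thesis using 2 \<alpha> by simp
  next
    case 3
    have "S = S powr \<alpha> * S powr (1 - \<alpha>)" using 3 by (simp add: powr_add[symmetric])
    also have "\<dots> \<le> B powr \<alpha> * S powr (1 - \<alpha>)"
      using 3 \<alpha> by (intro mult_right_mono powr_mono2) auto
    finally have "A * S \<le> A * (B powr \<alpha> * S powr (1 - \<alpha>))" using A by (rule mult_left_mono)
    moreover have "0 \<le> 18 * E\<^sup>2 * (B powr \<alpha> * S powr (1 - \<alpha>))" by simp
    moreover have "(18 * E\<^sup>2 + A) * B powr \<alpha> * S powr (1 - \<alpha>)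
        = 18 * E\<^sup>2 * (B powr \<alpha> * S powr (1 - \<alpha>)) + A * (B powr \<alpha> * S powr (1 - \<alpha>))"
      by (simp only: distrib_right mult.assoc)
    ultimately show ?thesis using X0 by linarith
  next
    case 4
    define r where "r = S / B"
    have r: "r > 1" using 4 by (simp add: r_def)
    \<comment> \<open>The least k with 2^(- k \<eta>) <= 1 / r, so that the Sobolev term is at most
      A B.\<close>
    define k where "k = nat \<lceil>ln r / (\<eta> * ln 2)\<rceil>"
    have pos: "ln r / (\<eta> * ln 2) > 0" using r \<eta> by simp
    have k1: "ln r / (\<eta> * ln 2) \<le> real k" and k2: "real k \<le> ln r / (\<eta> * ln 2) + 1"
      unfolding k_def using pos by linarith+
    have rb: "r powr \<beta> \<ge> 1" using r \<beta> by (simp add: ge_one_powr_ge_zero)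
    have "ln r \<le> r powr \<beta> / \<beta>" using r \<beta> by (intro ln_powr_bound) auto
    then have "ln r / (\<eta> * ln 2) \<le> r powr \<beta> / \<beta> / (\<eta> * ln 2)"
      using \<eta> by (intro divide_right_mono) auto
    then have "real k \<le> E * r powr \<beta>"
      using k2 rb by (simp add: E_def algebra_simps)
    then have "(real k)\<^sup>2 \<le> (E * r powr \<beta>)\<^sup>2" by (intro power_mono) auto
    also have "\<dots> = E\<^sup>2 * r powr (1 - \<alpha>)"
      using r by (simp add: power_mult_distrib powr_power \<beta>_def diff_divide_distrib)
    finally have kk: "18 * (real k)\<^sup>2 * B \<le> 18 * (E\<^sup>2 * r powr (1 - \<alpha>)) * B"
      using 4 by (intro mult_right_mono mult_left_mono) auto
    have "2 powr (- (real k * \<eta>)) \<le> 2 powr (- (ln r / ln 2))"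
      using k1 \<eta> by (intro powr_mono) (auto simp: field_simps)
    also have "\<dots> = 1 / r"
      using r by (simp add: powr_def exp_minus inverse_eq_divide)
    finally have "A * S * 2 powr (- (real k * \<eta>)) \<le> A * S * (1 / r)"
      using A S by (intro mult_left_mono) auto
    also have "\<dots> = A * 1 * B" using 4 by (simp add: r_def)
    also have "\<dots> \<le> A * r powr (1 - \<alpha>) * B"
      using A 4 r \<alpha> by (intro mult_right_mono mult_left_mono ge_one_powr_ge_zero) auto
    finally have "X \<le> 18 * (E\<^sup>2 * r powr (1 - \<alpha>)) * B + A * r powr (1 - \<alpha>) * B"
      using X[of k] kk by linarith
    also have "\<dots> = (18 * E\<^sup>2 + A) * (r powr (1 - \<alpha>) * B)" by (simp add: algebra_simps)
    also have "r powr (1 - \<alpha>) * B = B powr \<alpha> * S powr (1 - \<alpha>)"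
      using 4 by (simp add: r_def powr_divide powr_diff field_simps)
    finally show ?thesis by (simp add: mult.assoc)
  qed
qed

theorem theorem1p4:
  fixes \<delta>\<^sub>0 \<theta> p s \<delta> \<alpha> :: real
  assumes "0 < \<delta>\<^sub>0" and "\<delta>\<^sub>0 < 1/2"
    and "2 < p" and "2 / p < s"
    and "\<delta> = min (s - 2 / p) (1 / p)"
    and "0 < \<alpha>" and "\<alpha> \<le> \<delta> / (2 + \<delta>)"
  shows "\<exists>C::real. \<forall>F \<in> bmo \<delta>\<^sub>0 \<inter> sobolev s p.
           bmo_norm \<delta>\<^sub>0 (F \<circ> rotation \<theta>) \<le>
             ennreal (C * enn2real (bmo_norm \<delta>\<^sub>0 F) powr \<alpha> * sobolev_norm s p F powr (1 - \<alpha>))"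
proof -
  have "\<delta> > 0" using assms by simp
  then have "\<delta> / (2 + \<delta>) < 1" by simp
  \<comment> \<open>The room 1 - \<alpha> > 0 is what absorbs the squared logarithm.\<close>
  then have \<alpha>: "0 < \<alpha>" "\<alpha> < 1" using assms by linarith+
  have p: "p > 1" using assms by simp
  obtain C\<^sub>1 \<gamma> where C\<^sub>1: "C\<^sub>1 \<ge> 0" and \<gamma>: "\<gamma> > 0" and
    means: "\<And>F. F \<in> sobolev s p \<Longrightarrow> \<exists>G\<in>borel_measurable borel. (AE z in lebesgue. F z = G z) \<and>
      (\<forall>A\<in>sets borel. bounded A \<longrightarrow> set_integrable lborel A G) \<and>
      (\<forall>R. convex_body R \<longrightarrow> norm (mean_value G R) \<le> C\<^sub>1 * sobolev_norm s p F * measure lborel R powr (- 1 / p)) \<and>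
      (\<forall>R Q d. convex_body R \<longrightarrow> convex_body Q \<longrightarrow> (\<forall>c\<in>R. \<forall>c'\<in>Q. norm (c - c') \<le> d) \<longrightarrow>
        norm (mean_value G R - mean_value G Q) \<le> C\<^sub>1 * sobolev_norm s p F * d powr \<gamma>)"
    by (rule bessel_potential_means[OF p assms(4)]) (rule that; blast)
  obtain C where C: "C \<ge> 0" "\<And>B S X. B \<ge> 0 \<Longrightarrow> S \<ge> 0 \<Longrightarrow>
    (\<And>k. X \<le> 18 * (real k)\<^sup>2 * B + ((3 + 4 powr \<gamma>) * C\<^sub>1) * S * 2 powr (- (real k * min (1 / p) \<gamma>)))
      \<Longrightarrow> X \<le> C * B powr \<alpha> * S powr (1 - \<alpha>)"
    using optimise_scales[OF \<alpha>, of "min (1 / p) \<gamma>" "(3 + 4 powr \<gamma>) * C\<^sub>1"] \<gamma> p C\<^sub>1 by auto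
  show ?thesis
  proof (intro exI[of _ C] ballI)
    fix F assume F: "F \<in> bmo \<delta>\<^sub>0 \<inter> sobolev s p"
    define S where "S = sobolev_norm s p F"
    define B where "B = enn2real (bmo_norm \<delta>\<^sub>0 F)"
    define M where "M = C * B powr \<alpha> * S powr (1 - \<alpha>)"
    have S: "S \<ge> 0" by (simp add: S_def sobolev_norm_def Lp_norm_def)
    have B: "B \<ge> 0" by (simp add: B_def)
    have M: "M \<ge> 0" using C by (simp add: M_def)
    \<comment> \<open>The telescoping runs through ancestors in the standard grid, whose parameters
      are 0, 0.\<close>
    have "dyadic_bmo_norm 0 0 F \<le> bmo_norm \<delta>\<^sub>0 F"
      unfolding bmo_norm_def by (rule SUP_upper2[of "(0, 0)"]) auto
    \<comment> \<open>Membership in \<open>bmo\<close> makes the norm finite, so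
      \<open>enn2real\<close> does not replace an infinite value by 0.\<close>
    also have "bmo_norm \<delta>\<^sub>0 F = ennreal B"
      using bmo_norm_finite[of F \<delta>\<^sub>0] F by (simp add: B_def)
    finally have bmo: "dyadic_bmo_norm 0 0 F \<le> ennreal B" .
    obtain G where G [measurable]: "G \<in> borel_measurable borel" and FG: "AE z in lebesgue. F z = G z"
      and Gm: "\<forall>A\<in>sets borel. bounded A \<longrightarrow> set_integrable lborel A G"
      "\<forall>R. convex_body R \<longrightarrow> norm (mean_value G R) \<le> C\<^sub>1 * S * measure lborel R powr (- 1 / p)"
      "\<forall>R Q d. convex_body R \<longrightarrow> convex_body Q \<longrightarrow> (\<forall>c\<in>R. \<forall>c'\<in>Q. norm (c - c') \<le> d) \<longrightarrow>
        norm (mean_value G R - mean_value G Q) \<le> C\<^sub>1 * S * d powr \<gamma>"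
      using means[of F] F unfolding S_def[symmetric] by blast
    have Gi: "\<And>A. A \<in> sets borel \<Longrightarrow> bounded A \<Longrightarrow> set_integrable lborel A G"
      using Gm(1) by blast
    have m1: "\<And>R. convex_body R \<Longrightarrow> norm (mean_value G R) \<le> C\<^sub>1 * S * measure lborel R powr (- (1 / p))"
      using Gm(2) by simp
    have m2: "\<And>R Q d. convex_body R \<Longrightarrow> convex_body Q \<Longrightarrow> (\<And>c c'. c \<in> R \<Longrightarrow> c' \<in> Q \<Longrightarrow> norm (c - c') \<le> d) \<Longrightarrow>
        norm (mean_value G R - mean_value G Q) \<le> C\<^sub>1 * S * d powr \<gamma>"
      using Gm(3) by blast
    have "AE z in lebesgue. \<forall>k. norm (G z) \<le> 18 * (real k)\<^sup>2 * B
        + (3 + 4 powr \<gamma>) * (C\<^sub>1 * S) * 2 powr (- (real k * min (1 / p) \<gamma>))"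
    proof (rule pointwise_bound[OF G FG])
      show "dyadic_bmo_norm 0 0 F \<le> ennreal B" by fact
      show "norm (mean_value G R - mean_value G Q) \<le> C\<^sub>1 * S * d powr \<gamma>"
        if "convex_body R" "convex_body Q" "\<And>c c'. c \<in> R \<Longrightarrow> c' \<in> Q \<Longrightarrow> norm (c - c') \<le> d" for R Q d
        by (rule m2[OF that])
    qed (use Gi m1 C\<^sub>1 S p \<gamma> B in auto)
    with FG have "AE z in lebesgue. norm (F z) \<le> M"
    proof eventually_elim
      case (elim z)
      have "norm (G z) \<le> M"
        unfolding M_def by (rule C(2)[OF B S]) (use elim in \<open>simp add: mult.assoc\<close>)
      then show ?case using elim by simp
    qed
    then have "AE z in lebesgue. norm ((F \<circ> rotation \<theta>) z) \<le> M"
      using AE_rotation[of "\<lambda>z. norm (F z) \<le> M"] by simp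
    moreover have "AE z in lebesgue. (F \<circ> rotation \<theta>) z = (G \<circ> rotation \<theta>) z"
      using AE_rotation[OF FG] by simp
    moreover have "G \<circ> rotation \<theta> \<in> borel_measurable borel"
      by (rule measurable_comp[OF rotation_measurable G])
    \<comment> \<open>The supremum bound serves all four pairs of grids at once.\<close>
    ultimately have "dyadic_bmo_norm a b (F \<circ> rotation \<theta>) \<le> ennreal M" for a b
      using M by (intro dyadic_bmo_norm_le_sup)
    then show "bmo_norm \<delta>\<^sub>0 (F \<circ> rotation \<theta>) \<le>
        ennreal (C * enn2real (bmo_norm \<delta>\<^sub>0 F) powr \<alpha> * sobolev_norm s p F powr (1 - \<alpha>))"
      unfolding bmo_norm_def[of _ "F \<circ> rotation \<theta>"] M_def B_def S_def by (auto intro!: SUP_least)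
  qed
qed

end
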